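(* Let $G$ be a discrete group containing a nonabelian free subgroup. Then, for every integer $d\geq 2$, $$M_{d+1}(G)\subsetneq M_d(G),$$ i.e. $M_{d+1}(G)$ is a proper subset of $M_d(G)$.
   Context: Let $G$ be a discrete group and $d\ge 2$ an integer. $M_d(G)$ denotes the space of $M_d$-multipliers of $G$: the bounded functions $\varphi:G\to\mathbb{C}$ for which there are Hilbert spaces $\mathcal{H}_0,\ldots,\mathcal{H}_d$ with $\mathcal{H}_0=\mathcal{H}_d=\mathbb{C}$ and bounded maps $\xi_i:G\to\mathbf{B}(\mathcal{H}_i,\mathcal{H}_{i-1})$ ($i=1,\ldots,d$) such that $$\varphi(t_1\cdots t_d)=\xi_1(t_1)\cdots\xi_d(t_d)1\quad\text{for all } t_1,\ldots,t_d\in G.$$ Here $\mathbf{B}(E,F)$ denotes the space of bounded linear operators from $E$ to $F$. *)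

theory Defs
  imports Complex_Main "HOL-Algebra.Module"
begin

section \<open>Complex Hilbert spaces with explicit carriers\<close>

definition complex_ring :: "complex ring" where
  "complex_ring = \<lparr>carrier = UNIV, mult = (*), one = 1, zero = 0, add = (+)\<rparr>"

text \<open>As in every module record of the algebra library, the fields \<^const>\<open>mult\<close> and \<^const>\<open>one\<close>
  carry no information here.\<close>

record 'v hilbert = "(complex, 'v) module" +
  cinner :: "'v \<Rightarrow> 'v \<Rightarrow> complex"

definition hnorm :: "('v, 'm) hilbert_scheme \<Rightarrow> 'v \<Rightarrow> real" where
  "hnorm H v = sqrt (Re (cinner H v v))"

locale complex_hilbert = module complex_ring H for H :: "('v, 'm) hilbert_scheme" (structure) +
  assumes cinner_add_left:
      "\<lbrakk>x \<in> carrier H; y \<in> carrier H; z \<in> carrier H\<rbrakk> \<Longrightarrow>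
        cinner H (x \<oplus> y) z = cinner H x z + cinner H y z"
    and cinner_smult_left:
      "\<lbrakk>x \<in> carrier H; y \<in> carrier H\<rbrakk> \<Longrightarrow> cinner H (a \<odot> x) y = a * cinner H x y"
    and cinner_commute:
      "\<lbrakk>x \<in> carrier H; y \<in> carrier H\<rbrakk> \<Longrightarrow> cinner H x y = cnj (cinner H y x)"
    and cinner_pos:
      "\<lbrakk>x \<in> carrier H; x \<noteq> \<zero>\<rbrakk> \<Longrightarrow> Re (cinner H x x) > 0"
    and complete:
      "\<lbrakk>\<And>n. \<sigma> n \<in> carrier H;
        \<And>e. e > 0 \<Longrightarrow> \<exists>N. \<forall>m\<ge>N. \<forall>n\<ge>N. hnorm H (\<sigma> m \<ominus> \<sigma> n) < e\<rbrakk> \<Longrightarrow>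
        \<exists>x\<in>carrier H. (\<lambda>n. hnorm H (\<sigma> n \<ominus> x)) \<longlonglongrightarrow> 0"

text \<open>The Hilbert space of complex numbers, placed in a sum type so that it can occur in one
  sequence together with Hilbert spaces whose vectors are of type \<^typ>\<open>'h\<close>.\<close>

definition scalars :: "(complex + 'h) hilbert" where
  "scalars = \<lparr>carrier = range Inl,
     mult = (\<lambda>x y. Inl (projl x * projl y)), one = Inl 1,
     zero = Inl 0, add = (\<lambda>x y. Inl (projl x + projl y)),
     smult = (\<lambda>a x. Inl (a * projl x)),
     cinner = (\<lambda>x y. projl x * cnj (projl y))\<rparr>"

definition linear_operators ::
    "('v, 'm) hilbert_scheme \<Rightarrow> ('w, 'n) hilbert_scheme \<Rightarrow> ('v \<Rightarrow> 'w) set" where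
  "linear_operators E F = {T \<in> carrier E \<rightarrow> carrier F.
     (\<forall>x\<in>carrier E. \<forall>y\<in>carrier E. T (x \<oplus>\<^bsub>E\<^esub> y) = T x \<oplus>\<^bsub>F\<^esub> T y) \<and>
     (\<forall>a. \<forall>x\<in>carrier E. T (a \<odot>\<^bsub>E\<^esub> x) = a \<odot>\<^bsub>F\<^esub> T x)}"

definition bounded_operators ::
    "('v, 'm) hilbert_scheme \<Rightarrow> ('w, 'n) hilbert_scheme \<Rightarrow> ('v \<Rightarrow> 'w) set" where
  "bounded_operators E F =
     {T \<in> linear_operators E F. \<exists>C. \<forall>x\<in>carrier E. hnorm F (T x) \<le> C * hnorm E x}"

definition op_norm ::
    "('v, 'm) hilbert_scheme \<Rightarrow> ('w, 'n) hilbert_scheme \<Rightarrow> ('v \<Rightarrow> 'w) \<Rightarrow> real" where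
  "op_norm E F T = (SUP x\<in>{x \<in> carrier E. hnorm E x \<le> 1}. hnorm F (T x))"


section \<open>Multipliers\<close>

definition multiplier_factorization ::
    "('g, 'm) monoid_scheme \<Rightarrow> nat \<Rightarrow> ('g \<Rightarrow> complex) \<Rightarrow>
     (nat \<Rightarrow> (complex + 'h) hilbert) \<Rightarrow>
     (nat \<Rightarrow> 'g \<Rightarrow> complex + 'h \<Rightarrow> complex + 'h) \<Rightarrow> bool" where
  "multiplier_factorization G d \<phi> H \<xi> \<longleftrightarrow>
     (\<forall>i\<le>d. complex_hilbert (H i)) \<and> H 0 = scalars \<and> H d = scalars \<and>
     (\<forall>i\<in>{1..d}.
        (\<forall>t\<in>carrier G. \<xi> i t \<in> bounded_operators (H i) (H (i - 1))) \<and>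
        bdd_above ((\<lambda>t. op_norm (H i) (H (i - 1)) (\<xi> i t)) ` carrier G)) \<and>
     (\<forall>t\<in>{1..d} \<rightarrow> carrier G.
        Inl (\<phi> (foldr (\<lambda>i. mult G (t i)) [1..<Suc d] \<one>\<^bsub>G\<^esub>)) =
        foldr (\<lambda>i. \<xi> i (t i)) [1..<Suc d] (Inl 1))"

text \<open>HOL cannot quantify existentially over types, so the Hilbert spaces are taken inside one fixed
  type.  This is no restriction: by \<open>multiplier_spaceI\<close> below, a factorization through
  Hilbert spaces in an arbitrary type \<^typ>\<open>'h\<close> yields a member of \<open>multiplier_space\<close>.
  Functions on the group are normalised to be \<^const>\<open>undefined\<close> outside its carrier.\<close>

definition multiplier_space ::
    "nat \<Rightarrow> ('g, 'm) monoid_scheme \<Rightarrow> ('g \<Rightarrow> complex) set" where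
  "multiplier_space d G = {\<phi> \<in> carrier G \<rightarrow>\<^sub>E UNIV.
     bdd_above ((\<lambda>t. cmod (\<phi> t)) ` carrier G) \<and>
     (\<exists>(H :: nat \<Rightarrow> (complex + ('g list \<Rightarrow> complex)) hilbert) \<xi>.
        multiplier_factorization G d \<phi> H \<xi>)}"


section \<open>Free subgroups\<close>

text \<open>Letters are pairs of a generator and a sign, \<^term>\<open>(s, False)\<close> standing for the inverse.\<close>

definition reduced_words :: "'g set \<Rightarrow> ('g \<times> bool) list set" where
  "reduced_words S = {w \<in> lists (S \<times> UNIV).
     successively (\<lambda>x y. \<not> (fst x = fst y \<and> snd x \<noteq> snd y)) w}"

definition word_value :: "('g, 'm) monoid_scheme \<Rightarrow> ('g \<times> bool) list \<Rightarrow> 'g" where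
  "word_value G w =
     foldr (\<lambda>(s, b) x. (if b then s else inv\<^bsub>G\<^esub> s) \<otimes>\<^bsub>G\<^esub> x) w \<one>\<^bsub>G\<^esub>"

definition free_subgroup :: "('g, 'm) monoid_scheme \<Rightarrow> 'g set \<Rightarrow> bool" where
  "free_subgroup G F \<longleftrightarrow> subgroup F G \<and>
     (\<exists>S\<subseteq>F. bij_betw (word_value G) (reduced_words S) F)"

definition has_nonabelian_free_subgroup :: "('g, 'm) monoid_scheme \<Rightarrow> bool" where
  "has_nonabelian_free_subgroup G \<longleftrightarrow>
     (\<exists>F. free_subgroup G F \<and> \<not> comm_group (G\<lparr>carrier := F\<rparr>))"

section \<open>The choice of the type of vectors is immaterial\<close>

lemma carrier_complex_ring [simp]: "carrier complex_ring = UNIV"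
  and ops_complex_ring [simp]: "x \<otimes>\<^bsub>complex_ring\<^esub> y = x * y" "\<one>\<^bsub>complex_ring\<^esub> = 1"
    "\<zero>\<^bsub>complex_ring\<^esub> = 0" "x \<oplus>\<^bsub>complex_ring\<^esub> y = x + y"
  by (simp_all add: complex_ring_def)

lemma cring_complex_ring: "cring complex_ring"
proof (rule cringI)
  show "abelian_group complex_ring"
  proof (rule abelian_groupI)
    fix x assume "x \<in> carrier complex_ring"
    show "\<exists>y\<in>carrier complex_ring. y \<oplus>\<^bsub>complex_ring\<^esub> x = \<zero>\<^bsub>complex_ring\<^esub>"
      by (rule bexI[of _ "- x"]) simp_all
  qed simp_all
  show "comm_monoid complex_ring"
    by (rule comm_monoidI) simp_all
qed (simp add: algebra_simps)

lemma uminus_complex_ring [simp]: "\<ominus>\<^bsub>complex_ring\<^esub> x = - x"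
proof -
  interpret cring complex_ring by (rule cring_complex_ring)
  have "\<ominus>\<^bsub>complex_ring\<^esub> x \<oplus>\<^bsub>complex_ring\<^esub> x = \<zero>\<^bsub>complex_ring\<^esub>"
    by (rule l_neg) simp
  then show ?thesis by (simp add: eq_neg_iff_add_eq_0)
qed

lemma complex_module_minus:
  assumes "module complex_ring H" "y \<in> carrier H"
  shows "x \<ominus>\<^bsub>H\<^esub> y = x \<oplus>\<^bsub>H\<^esub> ((- 1) \<odot>\<^bsub>H\<^esub> y)"
proof -
  interpret module complex_ring H by fact
  show ?thesis
    using smult_l_minus[of 1 y] smult_one[of y] assms(2) by (simp add: a_minus_def)
qed

context complex_hilbert
begin

lemma module_H: "module complex_ring H" ..

lemma smult_carrier [simp]: "x \<in> carrier H \<Longrightarrow> a \<odot> x \<in> carrier H"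
  by (rule smult_closed) simp_all

lemma minus_smult: "y \<in> carrier H \<Longrightarrow> x \<ominus> y = x \<oplus> ((- 1) \<odot> y)"
  by (rule complex_module_minus[OF module_H])

lemma cinner_add_right:
  "\<lbrakk>x \<in> carrier H; y \<in> carrier H; z \<in> carrier H\<rbrakk> \<Longrightarrow>
    cinner H z (x \<oplus> y) = cinner H z x + cinner H z y"
  by (simp add: cinner_commute[of z] cinner_add_left)

lemma cinner_smult_right:
  "\<lbrakk>x \<in> carrier H; y \<in> carrier H\<rbrakk> \<Longrightarrow> cinner H x (a \<odot> y) = cnj a * cinner H x y"
  by (simp add: cinner_commute[of x] cinner_smult_left)

lemma cinner_minus_right:
  "\<lbrakk>x \<in> carrier H; y \<in> carrier H; z \<in> carrier H\<rbrakk> \<Longrightarrow>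
    cinner H z (x \<ominus> y) = cinner H z x - cinner H z y"
  by (simp add: minus_smult cinner_add_right cinner_smult_right)

lemma cinner_minus_left:
  "\<lbrakk>x \<in> carrier H; y \<in> carrier H; z \<in> carrier H\<rbrakk> \<Longrightarrow>
    cinner H (x \<ominus> y) z = cinner H x z - cinner H y z"
  by (simp add: minus_smult cinner_add_left cinner_smult_left)

lemma cinner_zero_left [simp]: "x \<in> carrier H \<Longrightarrow> cinner H \<zero> x = 0"
  using cinner_add_left[of \<zero> \<zero> x] by simp

lemma cinner_zero_right [simp]: "x \<in> carrier H \<Longrightarrow> cinner H x \<zero> = 0"
  using cinner_add_right[of \<zero> \<zero> x] by simp

lemma cinner_self_ge: "x \<in> carrier H \<Longrightarrow> Re (cinner H x x) \<ge> 0"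
  using cinner_pos[of x] by (cases "x = \<zero>") auto

lemma Im_cinner_self: "x \<in> carrier H \<Longrightarrow> Im (cinner H x x) = 0"
  using arg_cong[OF cinner_commute[of x x], of Im] by simp

lemma hnorm_ge: "x \<in> carrier H \<Longrightarrow> hnorm H x \<ge> 0"
  by (simp add: hnorm_def cinner_self_ge)

lemma hnorm_zero [simp]: "hnorm H \<zero> = 0"
  by (simp add: hnorm_def)

lemma hnorm_pos: "\<lbrakk>x \<in> carrier H; x \<noteq> \<zero>\<rbrakk> \<Longrightarrow> hnorm H x > 0"
  by (simp add: hnorm_def cinner_pos)

lemma cinner_self: "x \<in> carrier H \<Longrightarrow> cinner H x x = of_real ((hnorm H x)\<^sup>2)"
  by (simp add: complex_eq_iff hnorm_def cinner_self_ge Im_cinner_self)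

lemma hnorm_smult: "x \<in> carrier H \<Longrightarrow> hnorm H (a \<odot> x) = cmod a * hnorm H x"
proof -
  assume x: "x \<in> carrier H"
  have "cinner H (a \<odot> x) (a \<odot> x) = (a * cnj a) * cinner H x x"
    using x by (simp add: cinner_smult_left cinner_smult_right)
  also have "\<dots> = of_real ((cmod a * hnorm H x)\<^sup>2)"
    by (simp only: cinner_self[OF x] power_mult_distrib of_real_mult complex_norm_square)
  finally have "hnorm H (a \<odot> x) = sqrt ((cmod a * hnorm H x)\<^sup>2)"
    by (subst hnorm_def) simp
  then show ?thesis using x by (simp add: hnorm_ge)
qed

lemma cauchy_schwarz:
  assumes x: "x \<in> carrier H" and y: "y \<in> carrier H"
  shows "cmod (cinner H x y) \<le> hnorm H x * hnorm H y"
proof (cases "y = \<zero>")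
  case True
  then show ?thesis using x by simp
next
  case False
  define p where "p = (hnorm H y)\<^sup>2"
  have p: "p > 0" using hnorm_pos[OF y False] by (simp add: p_def)
  define c where "c = cinner H x y / of_real p"
  define z where "z = x \<ominus> c \<odot> y"
  have z: "z \<in> carrier H" using x y by (simp add: z_def)
  have yx: "cinner H y x = cnj (cinner H x y)" by (rule cinner_commute[OF y x])
  have "cinner H z z = cinner H x x - cnj c * cinner H x y - c * cinner H y x
      + c * cnj c * cinner H y y"
    using x y by (simp add: z_def cinner_minus_left cinner_minus_right cinner_smult_left
        cinner_smult_right algebra_simps)
  also have "\<dots> = cinner H x x - cnj c * cinner H x y"
    using p by (simp add: yx cinner_self[OF y] c_def del: of_real_power flip: p_def)
  also have "cnj c * cinner H x y = of_real ((cmod (cinner H x y))\<^sup>2 / p)"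
    by (simp add: c_def complex_norm_square mult.commute del: of_real_power)
  finally have "Re (cinner H z z) = (hnorm H x)\<^sup>2 - (cmod (cinner H x y))\<^sup>2 / p"
    using x by (simp add: cinner_self)
  with cinner_self_ge[OF z] have "(cmod (cinner H x y))\<^sup>2 / p \<le> (hnorm H x)\<^sup>2" by simp
  then have "(cmod (cinner H x y))\<^sup>2 \<le> (hnorm H x * hnorm H y)\<^sup>2"
    using p by (simp add: p_def power_mult_distrib field_simps)
  then show ?thesis
    by (rule power2_le_imp_le) (simp add: hnorm_ge x y)
qed

definition closed_subspace :: "'v set \<Rightarrow> bool" where
  "closed_subspace S \<longleftrightarrow> submodule S complex_ring H \<and>
     (\<forall>\<sigma>. \<forall>x\<in>carrier H. (\<forall>n. \<sigma> n \<in> S) \<longrightarrow> (\<lambda>n. hnorm H (\<sigma> n \<ominus> x)) \<longlonglongrightarrow> 0 \<longrightarrow> x \<in> S)"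

definition closed_span :: "'v set \<Rightarrow> 'v set" where
  "closed_span V = \<Inter>{S. closed_subspace S \<and> V \<subseteq> S}"

lemma submodule_alt:
  "submodule S complex_ring H \<longleftrightarrow> S \<subseteq> carrier H \<and> \<zero> \<in> S \<and>
     (\<forall>x\<in>S. \<forall>y\<in>S. x \<oplus> y \<in> S) \<and> (\<forall>a. \<forall>x\<in>S. a \<odot> x \<in> S)"
proof
  assume S: "submodule S complex_ring H"
  note E = submoduleE[OF S]
  obtain x where "x \<in> S" using E(2) by auto
  then have "x \<in> carrier H" "0 \<odot> x \<in> S" using E(1) E(4)[of 0 x] by auto
  then have "\<zero> \<in> S" using smult_l_null[of x] by simp
  then show "S \<subseteq> carrier H \<and> \<zero> \<in> S \<and>
     (\<forall>x\<in>S. \<forall>y\<in>S. x \<oplus> y \<in> S) \<and> (\<forall>a. \<forall>x\<in>S. a \<odot> x \<in> S)"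
    using E(1,4,5) by simp
next
  assume S: "S \<subseteq> carrier H \<and> \<zero> \<in> S \<and>
     (\<forall>x\<in>S. \<forall>y\<in>S. x \<oplus> y \<in> S) \<and> (\<forall>a. \<forall>x\<in>S. a \<odot> x \<in> S)"
  show "submodule S complex_ring H"
  proof (rule submoduleI)
    fix a assume a: "a \<in> S"
    then have "\<ominus> a = (- 1) \<odot> a"
      using smult_l_minus[of 1 a] smult_one[of a] S by (simp add: subset_iff)
    then show "\<ominus> a \<in> S" using a S by simp
  qed (use S in simp_all)
qed

lemma closed_subspaceI:
  assumes "S \<subseteq> carrier H" "\<zero> \<in> S" "\<And>x y. x \<in> S \<Longrightarrow> y \<in> S \<Longrightarrow> x \<oplus> y \<in> S"
    "\<And>a x. x \<in> S \<Longrightarrow> a \<odot> x \<in> S"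
    "\<And>\<sigma> x. x \<in> carrier H \<Longrightarrow> (\<And>n. \<sigma> n \<in> S) \<Longrightarrow> (\<lambda>n. hnorm H (\<sigma> n \<ominus> x)) \<longlonglongrightarrow> 0 \<Longrightarrow> x \<in> S"
  shows "closed_subspace S"
  unfolding closed_subspace_def submodule_alt
proof (intro conjI allI ballI impI)
  fix \<sigma> x
  assume "x \<in> carrier H" "\<forall>n. \<sigma> n \<in> S" "(\<lambda>n. hnorm H (\<sigma> n \<ominus> x)) \<longlonglongrightarrow> 0"
  then show "x \<in> S" using assms(5)[of x \<sigma>] by simp
qed (simp_all add: assms(1-4))

lemma closed_subspaceD:
  assumes "closed_subspace S"
  shows "S \<subseteq> carrier H" "\<zero> \<in> S" "x \<in> S \<Longrightarrow> y \<in> S \<Longrightarrow> x \<oplus> y \<in> S"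
    "x \<in> S \<Longrightarrow> a \<odot> x \<in> S"
    "x \<in> carrier H \<Longrightarrow> (\<And>n. \<sigma> n \<in> S) \<Longrightarrow> (\<lambda>n. hnorm H (\<sigma> n \<ominus> x)) \<longlonglongrightarrow> 0 \<Longrightarrow> x \<in> S"
proof -
  have *: "S \<subseteq> carrier H \<and> \<zero> \<in> S \<and> (\<forall>x\<in>S. \<forall>y\<in>S. x \<oplus> y \<in> S) \<and> (\<forall>a. \<forall>x\<in>S. a \<odot> x \<in> S)"
    using assms unfolding closed_subspace_def submodule_alt by (rule conjunct1)
  then show "S \<subseteq> carrier H" "\<zero> \<in> S" "x \<in> S \<Longrightarrow> y \<in> S \<Longrightarrow> x \<oplus> y \<in> S" "x \<in> S \<Longrightarrow> a \<odot> x \<in> S"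
    by simp_all
  show "x \<in> carrier H \<Longrightarrow> (\<And>n. \<sigma> n \<in> S) \<Longrightarrow> (\<lambda>n. hnorm H (\<sigma> n \<ominus> x)) \<longlonglongrightarrow> 0 \<Longrightarrow> x \<in> S"
    by (rule assms[unfolded closed_subspace_def, THEN conjunct2, rule_format])
qed

lemma closed_subspace_carrier: "closed_subspace (carrier H)"
  by (rule closed_subspaceI) simp_all

lemma closed_span_minimal: "closed_subspace S \<Longrightarrow> V \<subseteq> S \<Longrightarrow> closed_span V \<subseteq> S"
  by (auto simp: closed_span_def)

lemma closed_span_superset: "V \<subseteq> closed_span V"
  by (auto simp: closed_span_def)

lemma closed_subspace_closed_span:
  assumes "V \<subseteq> carrier H"
  shows "closed_subspace (closed_span V)"
proof (rule closed_subspaceI)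
  show "closed_span V \<subseteq> carrier H"
    by (rule closed_span_minimal[OF closed_subspace_carrier assms])
next
  fix \<sigma> x
  assume x: "x \<in> carrier H" and \<sigma>: "\<And>n. \<sigma> n \<in> closed_span V"
    and lim: "(\<lambda>n. hnorm H (\<sigma> n \<ominus> x)) \<longlonglongrightarrow> 0"
  have "x \<in> S" if S: "closed_subspace S" "V \<subseteq> S" for S
    by (rule closed_subspaceD(5)[OF S(1) x _ lim]) (use \<sigma> S in \<open>auto simp: closed_span_def\<close>)
  then show "x \<in> closed_span V" by (simp add: closed_span_def)
qed (auto simp: closed_span_def closed_subspaceD(2-4))

lemma cinner_tendsto:
  assumes u: "u \<in> carrier H" and x: "x \<in> carrier H" and \<sigma>: "\<And>n. \<sigma> n \<in> carrier H"
    and lim: "(\<lambda>n. hnorm H (\<sigma> n \<ominus> x)) \<longlonglongrightarrow> 0"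
  shows "(\<lambda>n. cinner H u (\<sigma> n)) \<longlonglongrightarrow> cinner H u x"
proof -
  have "(\<lambda>n. cinner H u (\<sigma> n) - cinner H u x) \<longlonglongrightarrow> 0"
  proof (rule tendsto_0_le[OF lim])
    have "cmod (cinner H u (\<sigma> n) - cinner H u x) \<le> norm (hnorm H (\<sigma> n \<ominus> x)) * hnorm H u" for n
      using cauchy_schwarz[of u "\<sigma> n \<ominus> x"] u x \<sigma>[of n] hnorm_ge[of "\<sigma> n \<ominus> x"]
      by (simp add: cinner_minus_right mult.commute)
    then show "\<forall>\<^sub>F n in sequentially.
        cmod (cinner H u (\<sigma> n) - cinner H u x) \<le> norm (hnorm H (\<sigma> n \<ominus> x)) * hnorm H u"
      by simp
  qed
  then show ?thesis by (simp add: LIM_zero_iff)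
qed

lemma closed_span_inner_eq:
  assumes V: "V \<subseteq> carrier H" and u: "u \<in> closed_span V" and v: "v \<in> closed_span V"
    and eq: "\<And>k. k \<in> V \<Longrightarrow> cinner H u k = cinner H v k"
  shows "u = v"
proof -
  have K: "closed_span V \<subseteq> carrier H"
    using closed_subspaceD(1)[OF closed_subspace_closed_span[OF V]] .
  have uc: "u \<in> carrier H" and vc: "v \<in> carrier H" using K u v by auto
  let ?S = "{x \<in> carrier H. cinner H u x = cinner H v x}"
  have "closed_subspace ?S"
  proof (rule closed_subspaceI)
    fix \<sigma> x
    assume x: "x \<in> carrier H" and \<sigma>: "\<And>n. \<sigma> n \<in> ?S" and lim: "(\<lambda>n. hnorm H (\<sigma> n \<ominus> x)) \<longlonglongrightarrow> 0"
    have "(\<lambda>n. cinner H u (\<sigma> n)) \<longlonglongrightarrow> cinner H u x"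
      by (rule cinner_tendsto[OF uc x _ lim]) (use \<sigma> in auto)
    moreover have "(\<lambda>n. cinner H v (\<sigma> n)) \<longlonglongrightarrow> cinner H v x"
      by (rule cinner_tendsto[OF vc x _ lim]) (use \<sigma> in auto)
    moreover have "(\<lambda>n. cinner H u (\<sigma> n)) = (\<lambda>n. cinner H v (\<sigma> n))"
      using \<sigma> by auto
    ultimately show "x \<in> ?S" using x LIMSEQ_unique by auto
  qed (auto simp: uc vc cinner_add_right cinner_smult_right)
  then have "closed_span V \<subseteq> ?S"
    by (rule closed_span_minimal) (use V eq in auto)
  then have "cinner H u u = cinner H v u" "cinner H u v = cinner H v v"
    using u v by auto
  then have "cinner H (u \<ominus> v) (u \<ominus> v) = 0"
    by (simp add: cinner_minus_left cinner_minus_right uc vc)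
  then have "u \<ominus> v = \<zero>"
    using cinner_pos[of "u \<ominus> v"] uc vc by force
  then have "u \<ominus> v \<oplus> v = \<zero> \<oplus> v" by simp
  then show "u = v" using uc vc by (simp add: a_minus_def M.a_assoc M.l_neg)
qed

end


text \<open>Moving a closed subspace to another type along an injective map.\<close>

definition transport :: "('v \<Rightarrow> 'w) \<Rightarrow> 'v set \<Rightarrow> 'v hilbert \<Rightarrow> 'w hilbert" where
  "transport J S H = (let I = inv_into S J in \<lparr>carrier = J ` S,
     mult = (\<lambda>x y. J (I x \<otimes>\<^bsub>H\<^esub> I y)), one = J \<one>\<^bsub>H\<^esub>,
     zero = J \<zero>\<^bsub>H\<^esub>, add = (\<lambda>x y. J (I x \<oplus>\<^bsub>H\<^esub> I y)),
     smult = (\<lambda>a x. J (a \<odot>\<^bsub>H\<^esub> I x)),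
     cinner = (\<lambda>x y. cinner H (I x) (I y))\<rparr>)"

lemma transport_simps [simp]:
  "carrier (transport J S H) = J ` S"
  "\<zero>\<^bsub>transport J S H\<^esub> = J \<zero>\<^bsub>H\<^esub>"
  by (simp_all add: transport_def Let_def)

lemma transport_ops:
  assumes "inj_on J S" "x \<in> S"
  shows "y \<in> S \<Longrightarrow> J x \<oplus>\<^bsub>transport J S H\<^esub> J y = J (x \<oplus>\<^bsub>H\<^esub> y)"
    "a \<odot>\<^bsub>transport J S H\<^esub> J x = J (a \<odot>\<^bsub>H\<^esub> x)"
    "y \<in> S \<Longrightarrow> cinner (transport J S H) (J x) (J y) = cinner H x y"
    "hnorm (transport J S H) (J x) = hnorm H x"
  using assms by (simp_all add: transport_def Let_def hnorm_def)

lemma module_transport: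
  assumes H: "complex_hilbert H" and S: "complex_hilbert.closed_subspace H S"
    and J: "inj_on J S"
  shows "module complex_ring (transport J S H)"
proof -
  interpret H: complex_hilbert H by fact
  note S' = H.closed_subspaceD[OF S]
  note [simp] = transport_ops[OF J] S'(2-4)
  have sub: "x \<in> carrier H" if "x \<in> S" for x using S'(1) that by auto
  show ?thesis
  proof (rule moduleI)
    show "abelian_group (transport J S H)"
    proof (rule abelian_groupI)
      fix x assume "x \<in> carrier (transport J S H)"
      then obtain v where v: "x = J v" "v \<in> S" by auto
      have "(- 1) \<odot>\<^bsub>H\<^esub> v \<oplus>\<^bsub>H\<^esub> v = \<zero>\<^bsub>H\<^esub>"
        using H.smult_l_distr[of "- 1" 1 v] H.smult_l_null[of v] H.smult_one[of v] sub[OF v(2)]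
        by simp
      then show "\<exists>y\<in>carrier (transport J S H). y \<oplus>\<^bsub>transport J S H\<^esub> x = \<zero>\<^bsub>transport J S H\<^esub>"
        using v by (intro bexI[of _ "J ((- 1) \<odot>\<^bsub>H\<^esub> v)"]) auto
    qed (auto simp: sub H.M.a_assoc H.M.a_comm H.M.a_lcomm)
  qed (auto simp: cring_complex_ring sub H.smult_r_distr
      H.smult_l_distr[simplified] H.smult_assoc1[simplified] H.smult_one[simplified])
qed

lemma transport_minus:
  assumes H: "complex_hilbert H" and S: "complex_hilbert.closed_subspace H S"
    and J: "inj_on J S" and x: "x \<in> S" and y: "y \<in> S"
  shows "J x \<ominus>\<^bsub>transport J S H\<^esub> J y = J (x \<ominus>\<^bsub>H\<^esub> y)" "x \<ominus>\<^bsub>H\<^esub> y \<in> S"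
proof -
  interpret H: complex_hilbert H by fact
  note S' = H.closed_subspaceD[OF S]
  have yc: "y \<in> carrier H" using S'(1) y by auto
  show "x \<ominus>\<^bsub>H\<^esub> y \<in> S" using x y yc S'(3,4) by (simp add: H.minus_smult)
  show "J x \<ominus>\<^bsub>transport J S H\<^esub> J y = J (x \<ominus>\<^bsub>H\<^esub> y)"
    using x y yc S'(3,4)
    by (subst complex_module_minus[OF module_transport[OF H S J]])
      (simp_all add: H.minus_smult transport_ops[OF J])
qed

lemma complex_hilbert_transport:
  assumes H: "complex_hilbert H" and S: "complex_hilbert.closed_subspace H S"
    and J: "inj_on J S"
  shows "complex_hilbert (transport J S H)"
proof -
  interpret H: complex_hilbert H by fact
  note S' = H.closed_subspaceD[OF S]
  note [simp] = transport_ops[OF J] S'(2-4)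
  have sub: "x \<in> carrier H" if "x \<in> S" for x using S'(1) that by auto
  show ?thesis
  proof (intro complex_hilbert.intro complex_hilbert_axioms.intro module_transport[OF H S J])
    fix \<sigma> :: "nat \<Rightarrow> _"
    assume \<sigma>: "\<And>n. \<sigma> n \<in> carrier (transport J S H)"
      and cauchy: "\<And>e. e > 0 \<Longrightarrow> \<exists>N. \<forall>m\<ge>N. \<forall>n\<ge>N.
        hnorm (transport J S H) (\<sigma> m \<ominus>\<^bsub>transport J S H\<^esub> \<sigma> n) < e"
    from \<sigma> have "\<exists>\<tau>. \<forall>n. \<sigma> n = J (\<tau> n) \<and> \<tau> n \<in> S" by (intro choice) auto
    then obtain \<tau> where \<tau>: "\<And>n. \<sigma> n = J (\<tau> n)" "\<And>n. \<tau> n \<in> S" by auto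
    have eq: "hnorm (transport J S H) (J x \<ominus>\<^bsub>transport J S H\<^esub> J y) = hnorm H (x \<ominus>\<^bsub>H\<^esub> y)"
      if "x \<in> S" "y \<in> S" for x y
      using transport_minus[OF H S J that] by simp
    have "\<exists>N. \<forall>m\<ge>N. \<forall>n\<ge>N. hnorm H (\<tau> m \<ominus>\<^bsub>H\<^esub> \<tau> n) < e" if "e > 0" for e
      using cauchy[OF that] by (simp add: \<tau> eq)
    from H.complete[OF sub[OF \<tau>(2)] this]
    obtain x where x: "x \<in> carrier H" and lim: "(\<lambda>n. hnorm H (\<tau> n \<ominus>\<^bsub>H\<^esub> x)) \<longlonglongrightarrow> 0"
      by blast
    have xS: "x \<in> S" using S'(5)[OF x \<tau>(2) lim] .
    show "\<exists>x\<in>carrier (transport J S H).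
        (\<lambda>n. hnorm (transport J S H) (\<sigma> n \<ominus>\<^bsub>transport J S H\<^esub> x)) \<longlonglongrightarrow> 0"
      using xS lim by (intro bexI[of _ "J x"]) (simp_all add: \<tau> eq)
  next
    fix x y assume "x \<in> carrier (transport J S H)" "y \<in> carrier (transport J S H)"
    then obtain u v where "x = J u" "u \<in> S" "y = J v" "v \<in> S" by auto
    then show "cinner (transport J S H) x y = cnj (cinner (transport J S H) y x)"
      using H.cinner_commute[of u v] sub by simp
  next
    fix x assume "x \<in> carrier (transport J S H)" "x \<noteq> \<zero>\<^bsub>transport J S H\<^esub>"
    then obtain u where "x = J u" "u \<in> S" "u \<noteq> \<zero>\<^bsub>H\<^esub>" by auto
    then show "Re (cinner (transport J S H) x x) > 0"
      using H.cinner_pos[of u] sub by simp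
  qed (auto simp: sub H.cinner_add_left H.cinner_smult_left)
qed

lemma complex_hilbert_scalars: "complex_hilbert scalars"
proof -
  have m: "module complex_ring (scalars :: (complex + 'h) hilbert)"
  proof (rule moduleI)
    show "abelian_group (scalars :: (complex + 'h) hilbert)"
    proof (rule abelian_groupI)
      fix x :: "complex + 'h" assume "x \<in> carrier scalars"
      then show "\<exists>y\<in>carrier scalars. y \<oplus>\<^bsub>scalars\<^esub> x = \<zero>\<^bsub>scalars\<^esub>"
        by (intro bexI[of _ "Inl (- projl x)"]) (auto simp: scalars_def)
    qed (auto simp: scalars_def)
  qed (auto simp: cring_complex_ring scalars_def algebra_simps)
  have norm: "hnorm scalars (Inl z :: complex + 'h) = cmod z" for z
    by (simp add: hnorm_def scalars_def cmod_def power2_eq_square)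
  have minus: "x \<ominus>\<^bsub>scalars\<^esub> y = Inl (projl x - projl y)"
    if "y \<in> carrier scalars" for x y :: "complex + 'h"
    using that by (simp add: complex_module_minus[OF m]) (simp add: scalars_def)
  show ?thesis
  proof (intro complex_hilbert.intro complex_hilbert_axioms.intro m)
    fix \<sigma> :: "nat \<Rightarrow> complex + 'h"
    assume \<sigma>: "\<And>n. \<sigma> n \<in> carrier scalars"
      and cauchy: "\<And>e. e > 0 \<Longrightarrow> \<exists>N. \<forall>m\<ge>N. \<forall>n\<ge>N. hnorm scalars (\<sigma> m \<ominus>\<^bsub>scalars\<^esub> \<sigma> n) < e"
    have "Cauchy (\<lambda>n. projl (\<sigma> n))"
      using cauchy \<sigma> by (auto simp: minus norm Cauchy_def dist_norm)
    then obtain z where z: "(\<lambda>n. projl (\<sigma> n)) \<longlonglongrightarrow> z"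
      using Cauchy_convergent convergentD by blast
    have c: "(Inl z :: complex + 'h) \<in> carrier scalars" by (simp add: scalars_def)
    show "\<exists>x\<in>carrier scalars. (\<lambda>n. hnorm scalars (\<sigma> n \<ominus>\<^bsub>scalars\<^esub> x)) \<longlonglongrightarrow> 0"
      by (rule bexI[OF _ c])
        (use z in \<open>simp add: minus[OF c] norm tendsto_norm_zero_iff LIM_zero_iff\<close>)
  next
    fix x :: "complex + 'h" assume "x \<in> carrier scalars" "x \<noteq> \<zero>\<^bsub>scalars\<^esub>"
    then show "Re (cinner scalars x x) > 0"
      by (auto simp: scalars_def complex_eq_iff sum_squares_gt_zero_iff)
  qed (auto simp: scalars_def algebra_simps)
qed

lemma bounded_family_iff:
  assumes E: "complex_hilbert E" and F: "complex_hilbert F"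
  shows "(\<forall>t\<in>A. T t \<in> bounded_operators E F) \<and> bdd_above ((\<lambda>t. op_norm E F (T t)) ` A) \<longleftrightarrow>
    (\<forall>t\<in>A. T t \<in> linear_operators E F) \<and>
    (\<exists>C. \<forall>t\<in>A. \<forall>x\<in>carrier E. hnorm F (T t x) \<le> C * hnorm E x)" (is "?L \<longleftrightarrow> ?R")
proof -
  interpret E: complex_hilbert E by fact
  interpret F: complex_hilbert F by fact
  let ?B = "{x \<in> carrier E. hnorm E x \<le> 1}"
  have ne: "?B \<noteq> {}" using E.hnorm_zero by force
  show ?thesis
  proof
    assume L: ?L
    then have lin: "\<And>t. t \<in> A \<Longrightarrow> T t \<in> linear_operators E F"
      by (auto simp: bounded_operators_def)
    from L obtain C where C: "\<And>t. t \<in> A \<Longrightarrow> op_norm E F (T t) \<le> C"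
      by (auto simp: bdd_above_def)
    have "hnorm F (T t x) \<le> C * hnorm E x" if t: "t \<in> A" and x: "x \<in> carrier E" for t x
    proof (cases "x = \<zero>\<^bsub>E\<^esub>")
      case True
      have "T t (0 \<odot>\<^bsub>E\<^esub> x) = 0 \<odot>\<^bsub>F\<^esub> T t x" "T t x \<in> carrier F"
        using lin[OF t] x by (auto simp: linear_operators_def)
      then have "T t x = \<zero>\<^bsub>F\<^esub>"
        using E.smult_l_null[OF x] F.smult_l_null[of "T t x"] True by simp
      then show ?thesis using True by simp
    next
      case False
      define r where "r = hnorm E x"
      have r: "r > 0" using E.hnorm_pos[OF x False] by (simp add: r_def)
      let ?u = "of_real (1 / r) \<odot>\<^bsub>E\<^esub> x"
      have u: "?u \<in> ?B" using x r by (simp add: E.hnorm_smult norm_divide flip: r_def)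
      obtain D where D: "\<And>y. y \<in> carrier E \<Longrightarrow> hnorm F (T t y) \<le> D * hnorm E y"
        using L t by (simp add: bounded_operators_def) blast
      have "bdd_above ((\<lambda>x. hnorm F (T t x)) ` ?B)"
      proof (rule bdd_aboveI2)
        fix y assume y: "y \<in> ?B"
        have "hnorm F (T t y) \<le> D * hnorm E y" using D y by simp
        also have "\<dots> \<le> \<bar>D\<bar> * 1"
          using y E.hnorm_ge[of y] by (intro mult_mono) auto
        finally show "hnorm F (T t y) \<le> \<bar>D\<bar>" by simp
      qed
      then have "hnorm F (T t ?u) \<le> op_norm E F (T t)"
        unfolding op_norm_def by (rule cSUP_upper[OF u])
      moreover have "T t ?u = of_real (1 / r) \<odot>\<^bsub>F\<^esub> T t x" "T t x \<in> carrier F"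
        using lin[OF t] x by (auto simp: linear_operators_def)
      ultimately have "hnorm F (T t x) / r \<le> C"
        using C[OF t] r by (simp add: F.hnorm_smult norm_divide)
      then show ?thesis using r by (simp add: field_simps flip: r_def)
    qed
    then show ?R using lin by blast
  next
    assume R: ?R
    then obtain C where C: "\<And>t x. t \<in> A \<Longrightarrow> x \<in> carrier E \<Longrightarrow> hnorm F (T t x) \<le> C * hnorm E x"
      by auto
    have "op_norm E F (T t) \<le> \<bar>C\<bar>" if t: "t \<in> A" for t
      unfolding op_norm_def
    proof (rule cSUP_least[OF ne])
      fix y assume y: "y \<in> ?B"
      have "hnorm F (T t y) \<le> C * hnorm E y" using C t y by simp
      also have "\<dots> \<le> \<bar>C\<bar> * 1"
        using y E.hnorm_ge[of y] by (intro mult_mono) auto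
      finally show "hnorm F (T t y) \<le> \<bar>C\<bar>" by simp
    qed
    then have "bdd_above ((\<lambda>t. op_norm E F (T t)) ` A)" by (intro bdd_aboveI2)
    then show ?L using R by (auto simp: bounded_operators_def)
  qed
qed

lemma closed_span_image:
  assumes E: "complex_hilbert E" and F: "complex_hilbert F"
    and T: "T \<in> linear_operators E F"
    and bd: "\<And>x. x \<in> carrier E \<Longrightarrow> hnorm F (T x) \<le> C * hnorm E x"
    and V: "V \<subseteq> carrier E" and W: "W \<subseteq> carrier F" and VW: "T ` V \<subseteq> W"
    and x: "x \<in> complex_hilbert.closed_span E V"
  shows "T x \<in> complex_hilbert.closed_span F W"
proof -
  interpret E: complex_hilbert E by fact
  interpret F: complex_hilbert F by fact
  have T1: "T x \<in> carrier F" "T (a \<odot>\<^bsub>E\<^esub> x) = a \<odot>\<^bsub>F\<^esub> T x" if "x \<in> carrier E" for x a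
    using T that by (auto simp: linear_operators_def)
  have T2: "T (x \<oplus>\<^bsub>E\<^esub> y) = T x \<oplus>\<^bsub>F\<^esub> T y" if "x \<in> carrier E" "y \<in> carrier E" for x y
    using T that by (auto simp: linear_operators_def)
  have T0: "T \<zero>\<^bsub>E\<^esub> = \<zero>\<^bsub>F\<^esub>"
    using T1(2)[of "\<zero>\<^bsub>E\<^esub>" 0] T1(1)[of "\<zero>\<^bsub>E\<^esub>"] E.smult_l_null F.smult_l_null by simp
  note W' = F.closed_subspaceD[OF F.closed_subspace_closed_span[OF W]]
  let ?S = "{x \<in> carrier E. T x \<in> F.closed_span W}"
  have "E.closed_subspace ?S"
  proof (rule E.closed_subspaceI)
    fix \<sigma> x
    assume x: "x \<in> carrier E" and \<sigma>: "\<And>n. \<sigma> n \<in> ?S"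
      and lim: "(\<lambda>n. hnorm E (\<sigma> n \<ominus>\<^bsub>E\<^esub> x)) \<longlonglongrightarrow> 0"
    have "(\<lambda>n. hnorm F (T (\<sigma> n) \<ominus>\<^bsub>F\<^esub> T x)) \<longlonglongrightarrow> 0"
    proof (rule tendsto_0_le[OF lim])
      have "norm (hnorm F (T (\<sigma> n) \<ominus>\<^bsub>F\<^esub> T x)) \<le> norm (hnorm E (\<sigma> n \<ominus>\<^bsub>E\<^esub> x)) * C" for n
      proof -
        have \<sigma>n: "\<sigma> n \<in> carrier E" using \<sigma> by auto
        have "T (\<sigma> n) \<ominus>\<^bsub>F\<^esub> T x = T (\<sigma> n \<ominus>\<^bsub>E\<^esub> x)"
          using x \<sigma>n by (simp add: E.minus_smult F.minus_smult T1 T2)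
        moreover have "\<sigma> n \<ominus>\<^bsub>E\<^esub> x \<in> carrier E" using x \<sigma>n by simp
        ultimately show ?thesis using bd[of "\<sigma> n \<ominus>\<^bsub>E\<^esub> x"] T1(1)[of "\<sigma> n \<ominus>\<^bsub>E\<^esub> x"]
            F.hnorm_ge E.hnorm_ge by (simp add: mult.commute)
      qed
      then show "\<forall>\<^sub>F n in sequentially.
          norm (hnorm F (T (\<sigma> n) \<ominus>\<^bsub>F\<^esub> T x)) \<le> norm (hnorm E (\<sigma> n \<ominus>\<^bsub>E\<^esub> x)) * C"
        by simp
    qed
    then show "x \<in> ?S" using x T1(1) \<sigma> W'(5)[of "T x" "\<lambda>n. T (\<sigma> n)"] by auto
  qed (auto simp: T0 T1 T2 W'(2-4))
  then have "E.closed_span V \<subseteq> ?S"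
    by (rule E.closed_span_minimal) (use V VW F.closed_span_superset[of W] in auto)
  then show ?thesis using x by auto
qed

theorem multiplier_spaceI:
  fixes G :: "('g, 'm) monoid_scheme" and H :: "nat \<Rightarrow> (complex + 'h) hilbert"
  assumes G: "group G"
    and \<phi>: "\<phi> \<in> carrier G \<rightarrow>\<^sub>E UNIV" "bdd_above ((\<lambda>t. cmod (\<phi> t)) ` carrier G)"
    and fact: "multiplier_factorization G d \<phi> H \<xi>"
  shows "\<phi> \<in> multiplier_space d G"
proof -
  note fact' = fact[unfolded multiplier_factorization_def]
  have hil: "complex_hilbert (H i)" if "i \<le> d" for i using fact' that by blast
  have H0: "H 0 = scalars" and Hd: "H d = scalars" using fact' by blast+
  have fam: "(\<forall>t\<in>carrier G. \<xi> i t \<in> linear_operators (H i) (H (i - 1))) \<and>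
      (\<exists>C. \<forall>t\<in>carrier G. \<forall>x\<in>carrier (H i). hnorm (H (i - 1)) (\<xi> i t x) \<le> C * hnorm (H i) x)"
    if "i \<in> {1..d}" for i
    using bounded_family_iff[of "H i" "H (i - 1)" "carrier G" "\<xi> i"] hil[of i] hil[of "i - 1"]
      fact' that by auto
  define k where "k i t = foldr (\<lambda>j. \<xi> j (t j)) [Suc i..<Suc d] (Inl 1)" for i and t :: "nat \<Rightarrow> 'g"
  have k_step: "k (i - 1) t = \<xi> i (t i) (k i t)" if "i \<in> {1..d}" for i t
  proof -
    have "[Suc (i - 1)..<Suc d] = i # [Suc i..<Suc d]" using that upt_conv_Cons[of i "Suc d"] by simp
    then show ?thesis by (simp add: k_def)
  qed
  have k_carrier: "k i t \<in> carrier (H i)" if "i \<le> d" "t \<in> {1..d} \<rightarrow> carrier G" for i t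
    using that(1)
  proof (induction "d - i" arbitrary: i)
    case 0
    then show ?case using Hd by (simp add: k_def) (simp add: scalars_def)
  next
    case (Suc n)
    then have "k (Suc i) t \<in> carrier (H (Suc i))" by simp
    moreover have "\<xi> (Suc i) (t (Suc i)) \<in> linear_operators (H (Suc i)) (H i)"
      using fam[of "Suc i"] Suc(2,3) that(2) by (auto simp: Pi_iff)
    ultimately show ?case
      using k_step[of "Suc i" t] Suc by (auto simp: linear_operators_def)
  qed
  define V where "V i = (if i = 0 then carrier (H i) else {k i t | t. t \<in> {1..d} \<rightarrow> carrier G})" for i
  define K where "K i = complex_hilbert.closed_span (H i) (V i)" for i
  have VH: "V i \<subseteq> carrier (H i)" if "i \<le> d" for i
    using k_carrier that by (auto simp: V_def)
  have K_sub: "complex_hilbert.closed_subspace (H i) (K i)" if "i \<le> d" for i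
    unfolding K_def using complex_hilbert.closed_subspace_closed_span[OF hil VH] that by blast
  have KH: "K i \<subseteq> carrier (H i)" if "i \<le> d" for i
    using complex_hilbert.closed_subspaceD(1)[OF hil K_sub] that by blast
  have VK: "V i \<subseteq> K i" if "i \<le> d" for i
    unfolding K_def using complex_hilbert.closed_span_superset[OF hil] that by blast
  have kK: "k i t \<in> K i" if "i \<le> d" "t \<in> {1..d} \<rightarrow> carrier G" for i t
    using VK[OF that(1)] k_carrier[OF that] that by (auto simp: V_def split: if_splits)
  have K_end: "K i = range Inl" if i: "i = 0 \<or> i = d" for i
  proof -
    have Hi: "H i = scalars" using i H0 Hd by auto
    have "range Inl \<subseteq> K i"
    proof (cases "i = 0")
      case True
      then show ?thesis using VK[of 0] H0 by (simp add: V_def scalars_def)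
    next
      case False
      then have id: "i = d" using i by simp
      have "(\<lambda>_. \<one>\<^bsub>G\<^esub>) \<in> {1..d} \<rightarrow> carrier G"
        using group.is_monoid[OF G] by (simp add: monoid.one_closed)
      then have "Inl 1 \<in> K i" using kK[of d "\<lambda>_. \<one>\<^bsub>G\<^esub>"] id by (simp add: k_def)
      then have "z \<odot>\<^bsub>H i\<^esub> Inl 1 \<in> K i" for z
        using complex_hilbert.closed_subspaceD(4)[OF hil K_sub] id by blast
      then show ?thesis by (auto simp: Hi scalars_def)
    qed
    then show ?thesis using KH[of i] i Hi by (auto simp: scalars_def)
  qed
  have \<xi>_lin: "\<xi> i t \<in> linear_operators (H i) (H (i - 1))"
    if "i \<in> {1..d}" "t \<in> carrier G" for i t
    using fam that by blast
  have \<xi>K: "\<xi> i t v \<in> K (i - 1)"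
    if i: "i \<in> {1..d}" and t: "t \<in> carrier G" and v: "v \<in> K i" for i t v
  proof -
    obtain C where C: "\<And>x. x \<in> carrier (H i) \<Longrightarrow> hnorm (H (i - 1)) (\<xi> i t x) \<le> C * hnorm (H i) x"
      using fam[OF i] t by blast
    have le: "i \<le> d" "i - 1 \<le> d" using i by auto
    have "\<xi> i t ` V i \<subseteq> V (i - 1)"
    proof (cases "i - 1 = 0")
      case True
      then have "V (i - 1) = carrier (H (i - 1))" by (simp add: V_def)
      moreover have "\<xi> i t \<in> carrier (H i) \<rightarrow> carrier (H (i - 1))"
        using \<xi>_lin[OF i t] by (simp only: linear_operators_def mem_Collect_eq)
      ultimately show ?thesis
        using VH[OF le(1)] by (simp only:) blast
    next
      case False
      have "\<xi> i t (k i s) \<in> V (i - 1)" if s: "s \<in> {1..d} \<rightarrow> carrier G" for s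
      proof -
        have "k i (s(i := t)) = k i s"
          unfolding k_def by (rule foldr_cong) auto
        then have "\<xi> i t (k i s) = k (i - 1) (s(i := t))"
          using k_step[OF i, of "s(i := t)"] by simp
        moreover have "s(i := t) \<in> {1..d} \<rightarrow> carrier G" using s t by auto
        ultimately show ?thesis using False by (auto simp: V_def)
      qed
      then show ?thesis using i by (auto simp: V_def[of i])
    qed
    from closed_span_image[OF hil[OF le(1)] hil[OF le(2)] \<xi>_lin[OF i t] C VH[OF le(1)]
        VH[OF le(2)] this] v
    show ?thesis by (simp add: K_def)
  qed
  define J :: "nat \<Rightarrow> complex + 'h \<Rightarrow> complex + ('g list \<Rightarrow> complex)" where
    "J i v = (if i = 0 \<or> i = d then Inl (projl v)
      else Inr (\<lambda>w. cinner (H i) v (k i (\<lambda>j. w ! j))))" for i v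
  have inj: "inj_on (J i) (K i)" if i: "i \<le> d" for i
  proof (cases "i = 0 \<or> i = d")
    case True
    then show ?thesis using K_end[of i] by (auto simp: inj_on_def J_def)
  next
    case False
    show ?thesis
    proof (rule inj_onI)
      fix u v assume uv: "u \<in> K i" "v \<in> K i" "J i u = J i v"
      have "cinner (H i) u (k i t) = cinner (H i) v (k i t)" for t
      proof -
        have "k i (\<lambda>j. map t [0..<Suc d] ! j) = k i t"
          unfolding k_def by (rule foldr_cong) (auto simp del: upt_Suc)
        moreover have "(\<lambda>w. cinner (H i) u (k i (\<lambda>j. w ! j))) =
            (\<lambda>w. cinner (H i) v (k i (\<lambda>j. w ! j)))"
          using uv(3) False by (simp add: J_def)
        from fun_cong[OF this, of "map t [0..<Suc d]"]
        have "cinner (H i) u (k i (\<lambda>j. map t [0..<Suc d] ! j)) =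
            cinner (H i) v (k i (\<lambda>j. map t [0..<Suc d] ! j))" .
        ultimately show ?thesis by (simp only:)
      qed
      then show "u = v"
        using complex_hilbert.closed_span_inner_eq[OF hil VH, of i u v] i uv False
        by (auto simp: K_def V_def)
    qed
  qed
  define H' where "H' i = (if i = 0 \<or> i = d then scalars else transport (J i) (K i) (H i))" for i
  have H'_end: "H' i = scalars" if "i = 0 \<or> i = d" for i using that by (auto simp: H'_def)
  have hil': "complex_hilbert (H' i)" if "i \<le> d" for i
    using complex_hilbert_transport[OF hil K_sub inj] that
    by (simp add: H'_def complex_hilbert_scalars)
  have carrier': "carrier (H' i) = J i ` K i" for i
    using K_end[of i] by (auto simp: H'_def J_def scalars_def image_iff)
  have ops': "J i x \<oplus>\<^bsub>H' i\<^esub> J i y = J i (x \<oplus>\<^bsub>H i\<^esub> y)" "a \<odot>\<^bsub>H' i\<^esub> J i x = J i (a \<odot>\<^bsub>H i\<^esub> x)"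
      "hnorm (H' i) (J i x) = hnorm (H i) x"
    if "i \<le> d" "x \<in> K i" "y \<in> K i" for i x y a
  proof -
    have "H i = scalars" if "i = 0 \<or> i = d" using that H0 Hd by auto
    then show "J i x \<oplus>\<^bsub>H' i\<^esub> J i y = J i (x \<oplus>\<^bsub>H i\<^esub> y)" "a \<odot>\<^bsub>H' i\<^esub> J i x = J i (a \<odot>\<^bsub>H i\<^esub> x)"
        "hnorm (H' i) (J i x) = hnorm (H i) x"
      using transport_ops(1)[OF inj[OF that(1)] that(2) that(3), where H = "H i"]
        transport_ops(2)[OF inj[OF that(1)] that(2), where H = "H i" and a = a]
        transport_ops(4)[OF inj[OF that(1)] that(2), where H = "H i"]
      by (cases "i = 0 \<or> i = d"; simp add: H'_def; auto simp: J_def scalars_def hnorm_def)+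
  qed
  define \<xi>' where "\<xi>' i t y = J (i - 1) (\<xi> i t (inv_into (K i) (J i) y))" for i t y
  have \<xi>': "\<xi>' i t (J i v) = J (i - 1) (\<xi> i t v)" if "i \<le> d" "v \<in> K i" for i t v
    using inj[OF that(1)] that(2) by (simp add: \<xi>'_def)
  have fam': "(\<forall>t\<in>carrier G. \<xi>' i t \<in> bounded_operators (H' i) (H' (i - 1))) \<and>
      bdd_above ((\<lambda>t. op_norm (H' i) (H' (i - 1)) (\<xi>' i t)) ` carrier G)" if i: "i \<in> {1..d}" for i
  proof -
    have le: "i \<le> d" "i - 1 \<le> d" using i by auto
    have ops2: "a \<odot>\<^bsub>H' j\<^esub> J j x = J j (a \<odot>\<^bsub>H j\<^esub> x)" if "j \<le> d" "x \<in> K j" for j x a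
      using ops'(2)[OF that that(2)] .
    note Ki = complex_hilbert.closed_subspaceD(3,4)[OF hil[OF le(1)] K_sub[OF le(1)]]
    have lin: "\<xi>' i t \<in> linear_operators (H' i) (H' (i - 1))" if t: "t \<in> carrier G" for t
    proof -
      have "\<xi> i t (x \<oplus>\<^bsub>H i\<^esub> y) = \<xi> i t x \<oplus>\<^bsub>H (i - 1)\<^esub> \<xi> i t y"
          "\<xi> i t (a \<odot>\<^bsub>H i\<^esub> x) = a \<odot>\<^bsub>H (i - 1)\<^esub> \<xi> i t x"
        if "x \<in> K i" "y \<in> K i" for x y a
        using \<xi>_lin[OF i t] subsetD[OF KH[OF le(1)] that(1)] subsetD[OF KH[OF le(1)] that(2)]
        by (simp_all add: linear_operators_def)
      then show ?thesis
        using \<xi>K[OF i t] ops'(1)[OF le(1)] ops'(1)[OF le(2)] ops2[OF le(1)] ops2[OF le(2)]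
        by (auto simp: linear_operators_def carrier' \<xi>'[OF le(1)] Ki simp del: One_nat_def)
    qed
    obtain C where C: "\<And>t x. t \<in> carrier G \<Longrightarrow> x \<in> carrier (H i) \<Longrightarrow>
        hnorm (H (i - 1)) (\<xi> i t x) \<le> C * hnorm (H i) x"
      using fam[OF i] by blast
    have "hnorm (H' (i - 1)) (\<xi>' i t y) \<le> C * hnorm (H' i) y"
      if t: "t \<in> carrier G" and y: "y \<in> carrier (H' i)" for t y
    proof -
      obtain x where x: "x \<in> K i" "y = J i x" using y carrier' by auto
      then have "x \<in> carrier (H i)" using KH[OF le(1)] by auto
      from C[OF t this] show ?thesis
        using x ops'(3)[OF le(1) x(1) x(1)] ops'(3)[OF le(2) \<xi>K[OF i t x(1)] \<xi>K[OF i t x(1)]]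
        by (simp add: \<xi>' le)
    qed
    then show ?thesis
      unfolding bounded_family_iff[OF hil'[OF le(1)] hil'[OF le(2)]] using lin by blast
  qed
  have word: "foldr (\<lambda>j. \<xi>' j (t j)) [Suc i..<Suc d] (Inl 1) = J i (k i t)"
    if "i \<le> d" and t: "t \<in> {1..d} \<rightarrow> carrier G" for i t
    using that(1)
  proof (induction "d - i" arbitrary: i)
    case 0
    then show ?case by (simp add: k_def J_def)
  next
    case (Suc n)
    then have "foldr (\<lambda>j. \<xi>' j (t j)) [Suc (Suc i)..<Suc d] (Inl 1) = J (Suc i) (k (Suc i) t)"
      by simp
    moreover have "[Suc i..<Suc d] = Suc i # [Suc (Suc i)..<Suc d]"
      using Suc(2) upt_conv_Cons[of "Suc i" "Suc d"] by simp
    moreover have "Suc i \<le> d" using Suc(2) by simp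
    ultimately show ?case
      using \<xi>'[of "Suc i" "k (Suc i) t" "t (Suc i)"] kK[of "Suc i" t] t k_step[of "Suc i" t]
      by simp
  qed
  have "multiplier_factorization G d \<phi> H' \<xi>'"
    unfolding multiplier_factorization_def
  proof (intro conjI allI impI ballI)
    fix t assume t: "t \<in> {1..d} \<rightarrow> carrier G"
    have "Inl (\<phi> (foldr (\<lambda>i. mult G (t i)) [1..<Suc d] \<one>\<^bsub>G\<^esub>)) = k 0 t"
      using fact' t unfolding k_def One_nat_def by blast
    then show "Inl (\<phi> (foldr (\<lambda>i. mult G (t i)) [1..<Suc d] \<one>\<^bsub>G\<^esub>)) =
        foldr (\<lambda>i. \<xi>' i (t i)) [1..<Suc d] (Inl 1)"
      using word[of 0 t] t by (simp add: J_def flip: sum.sel(1) del: upt_Suc) (metis sum.sel(1))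
  qed (use hil' H'_end fam' in auto)
  then show ?thesis using \<phi> unfolding multiplier_space_def by blast
qed

end

(*
  Let x_t be free generators of a free subgroup of G, indexed by triples t = (n, l, r), and let W_n
  be the Fourier matrix of size N = n + 1.  The function separating M_d(G) from M_(d+1)(G) is
  supported on the positive words x_(t_1) ... x_(t_(d+1)) whose letters all have the same first
  component n, where its value is N^(-(d-1)/2) times the product over i of W_n(r_i, l_(i+1)).

  It is not in M_(d+1)(G): N^(-1/2) W_n is unitary, so summing a factorization over the indices
  l and r against the conjugate matrices bounds N^(1/2) by a constant independent of n.

  It is in M_d(G): consider the path 1, s_1, s_1 s_2, ..., w in the tree of the free group.  It
  crosses each edge of the geodesic from 1 to w with total sign 1, and by Chen's identity the
  signed count survives if the d + 1 crossings are required to occur in order.  Distributing d + 1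
  crossings over d segments leaves at most d - 1 of the links W_n(r_i, l_(i+1)) cut between different
  segments.  A cut link costs a factor N^(1/2), an uncut one costs nothing.  The crossing counts are
  realised by sparse operators on an l2 space, so no further loss occurs.
*)
theory Submission
  imports "HOL-Analysis.Infinite_Sum" "HOL-Analysis.Convex" "HOL-Algebra.Coset" Defs
begin

section \<open>Signed crossings in a ping-pong configuration\<close>

text \<open>The weight balances two counts. A word of \<open>d + 1\<close> letters has
  \<open>d\<close> links, and with one operator per letter each link gains \<open>N^(1/2)\<close> in
  the lower bound, so the weight leaves exactly one such factor; \<open>d\<close> segments have
  \<open>d - 1\<close> boundaries, so the same weight pays for every link that can be cut. A cut
  link is expensive because the factors act from the right: when the letter after the link has been
  read, the letter before it has not, and the vector passed on needs a component for each of the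
  \<open>N\<close> possible row indices. A column of \<open>W_n\<close> has norm
  \<open>N^(1/2)\<close>, whereas a link inside one segment is a scalar of modulus one. The obstacle
  is cancellation. The factors are arbitrary elements of \<open>G\<close>, their path may backtrack,
  and no letter of the word belongs to a definite factor. Signed ordered counts split over any path,
  but they help only if the operators that realise them are bounded uniformly in the factor; this
  rests on each segment crossing boundedly many words of each length, counted from either
  end.\<close>

lemma card_le_one_if_unique:
  assumes "\<And>a b. a \<in> S \<Longrightarrow> b \<in> S \<Longrightarrow> a = b"
  shows "finite S" "card S \<le> 1"
proof -
  have "S = {} \<or> (\<exists>a. S = {a})" using assms by blast
  then show "finite S" "card S \<le> 1" by auto
qed

text \<open>In a free group \<open>A t\<close> and \<open>B t\<close> are the reduced words
  beginning with \<open>x t\<close> and with its inverse. They are sets in all of \<open>G\<close>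
  because the factors of a product range over all of \<open>G\<close>.\<close>

locale ping_pong = group G for G :: "('g, 'm) monoid_scheme" (structure) +
  fixes x :: "'t \<Rightarrow> 'g" and A B :: "'t \<Rightarrow> 'g set"
  assumes x_closed [simp]: "x t \<in> carrier G"
    and A_iff: "u \<in> carrier G \<Longrightarrow> x t \<otimes> u \<in> A t \<longleftrightarrow> u \<notin> B t"
    and A_disjoint: "q \<in> A t \<Longrightarrow> q \<in> A t' \<Longrightarrow> t = t'"
    and B_disjoint: "q \<in> B t \<Longrightarrow> q \<in> B t' \<Longrightarrow> t = t'"
    and A_B_disjoint: "q \<in> A t \<Longrightarrow> q \<in> B t' \<Longrightarrow> False"
    and one_notin: "\<one> \<notin> A t" "\<one> \<notin> B t"
begin

primrec val :: "'t list \<Rightarrow> 'g" where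
  "val [] = \<one>"
| "val (t # z) = x t \<otimes> val z"

text \<open>Elements of \<open>A t\<close> lie beyond the edge from \<open>\<one>\<close> to \<open>x t\<close>, and a word \<open>z\<close> spells a path of edges
  starting at \<open>\<one>\<close>.  Then \<open>beyond z q\<close> says that \<open>q\<close> lies beyond all of them, and \<open>crossing z p q\<close> counts
  with sign the ways in which the geodesic from \<open>p\<close> to \<open>q\<close> crosses all of them in order; it can only do
  so backwards if there is just one edge.\<close>

primrec beyond :: "'t list \<Rightarrow> 'g \<Rightarrow> bool" where
  "beyond [] q \<longleftrightarrow> True"
| "beyond (t # z) q \<longleftrightarrow> q \<in> A t \<and> beyond z (inv x t \<otimes> q)"

fun crossing :: "'t list \<Rightarrow> 'g \<Rightarrow> 'g \<Rightarrow> int" where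
  "crossing [] p q = 1"
| "crossing (t # v) p q =
     of_bool (p \<notin> A t \<and> beyond (t # v) q) - of_bool (v = [] \<and> p \<in> A t \<and> q \<notin> A t)"

lemma val_closed [simp]: "val z \<in> carrier G"
  by (induction z) auto

lemma val_append: "val (v @ z) = val v \<otimes> val z"
  by (induction v) (simp_all add: m_assoc)

lemma inv_mult_B: "q \<in> carrier G \<Longrightarrow> q \<notin> A t \<Longrightarrow> inv x t \<otimes> q \<in> B t"
  using A_iff[of "inv x t \<otimes> q" t] by (simp flip: m_assoc)

text \<open>A positive word does not backtrack: if \<open>q\<close> were outside \<open>A t\<close>,
  then \<open>inv x t \<otimes> q\<close> would lie in \<open>B t\<close>, which is disjoint from
  \<open>A (hd z)\<close>.\<close>

lemma beyond_tail:
  assumes "q \<in> carrier G" "z \<noteq> []" "beyond z (inv x t \<otimes> q)"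
  shows "q \<in> A t"
proof (rule ccontr)
  assume "q \<notin> A t"
  then have "inv x t \<otimes> q \<in> B t" using assms by (simp add: inv_mult_B)
  moreover have "inv x t \<otimes> q \<in> A (hd z)" using assms by (cases z) auto
  ultimately show False by (rule A_B_disjoint[rotated])
qed

lemma inv_val_Cons: "q \<in> carrier G \<Longrightarrow> inv val (t # v) \<otimes> q = inv val v \<otimes> (inv x t \<otimes> q)"
  by (simp add: inv_mult_group m_assoc)

text \<open>This is Chen's identity for a first point before all edges, where
  \<open>crossing\<close> reduces to \<open>beyond\<close>. The term \<open>k = 0\<close> puts the
  whole crossing on the second segment; all others share the condition \<open>q \<in> A t\<close>
  and form the same sum for the tail.\<close>

lemma beyond_chen:
  assumes "q \<in> carrier G" "r \<in> carrier G"
  shows "(\<Sum>k\<le>length z. of_bool (beyond (take k z) q) *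
      crossing (drop k z) (inv val (take k z) \<otimes> q) (inv val (take k z) \<otimes> r)) =
    of_bool (beyond z r)"
  using assms
proof (induction z arbitrary: q r)
  case Nil
  then show ?case by simp
next
  case (Cons t z)
  let ?q = "inv x t \<otimes> q" and ?r = "inv x t \<otimes> r"
  have "(\<Sum>k\<le>length (t # z). of_bool (beyond (take k (t # z)) q) *
      crossing (drop k (t # z)) (inv val (take k (t # z)) \<otimes> q) (inv val (take k (t # z)) \<otimes> r)) =
    crossing (t # z) q r + of_bool (q \<in> A t) * (\<Sum>k\<le>length z. of_bool (beyond (take k z) ?q) *
      crossing (drop k z) (inv val (take k z) \<otimes> ?q) (inv val (take k z) \<otimes> ?r))"
    using Cons.prems
    by (simp only: list.size sum.atMost_Suc_shift add_Suc_right add_0_right)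
       (simp add: inv_val_Cons sum_distrib_left of_bool_conj mult.assoc del: val.simps(2) crossing.simps(2))
  also have "\<dots> = crossing (t # z) q r + of_bool (q \<in> A t) * of_bool (beyond z ?r)"
    using Cons by simp
  also have "\<dots> = of_bool (beyond (t # z) r)"
    using beyond_tail[of r z t] Cons.prems by (cases "z = []") auto
  finally show ?case .
qed

text \<open>Chen's identity: an ordered crossing by the path from \<open>p\<close> through \<open>q\<close> to \<open>r\<close> crosses an initial
  part of the word on the first segment and the rest on the second.\<close>

lemma crossing_chen:
  assumes "p \<in> carrier G" "q \<in> carrier G" "r \<in> carrier G"
  shows "(\<Sum>k\<le>length z. crossing (take k z) p q *
      crossing (drop k z) (inv val (take k z) \<otimes> q) (inv val (take k z) \<otimes> r)) = crossing z p r"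
proof (cases z)
  case Nil
  then show ?thesis by simp
next
  case (Cons t z')
  let ?q = "inv x t \<otimes> q" and ?r = "inv x t \<otimes> r"
  have step: "crossing (t # v) p q = of_bool (p \<notin> A t \<and> q \<in> A t) * of_bool (beyond v ?q) -
      of_bool (v = [] \<and> p \<in> A t \<and> q \<notin> A t)" for v
    by simp
  let ?N = "\<lambda>k. crossing (drop k z') (inv val (take k z') \<otimes> ?q) (inv val (take k z') \<otimes> ?r)"
  have "(\<Sum>k\<le>length z. crossing (take k z) p q *
      crossing (drop k z) (inv val (take k z) \<otimes> q) (inv val (take k z) \<otimes> r)) =
    crossing (t # z') q r + (\<Sum>k\<le>length z'. crossing (t # take k z') p q * ?N k)"
    using assms unfolding Cons
    by (simp only: list.size sum.atMost_Suc_shift add_Suc_right add_0_right)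
       (simp add: inv_val_Cons del: val.simps(2) crossing.simps(2))
  also have "(\<Sum>k\<le>length z'. crossing (t # take k z') p q * ?N k) =
     of_bool (p \<notin> A t \<and> q \<in> A t) * (\<Sum>k\<le>length z'. of_bool (beyond (take k z') ?q) * ?N k)
     - (\<Sum>k\<le>length z'. of_bool (take k z' = [] \<and> p \<in> A t \<and> q \<notin> A t) * ?N k)"
    unfolding step by (simp add: left_diff_distrib sum_subtractf sum_distrib_left mult.assoc)
  also have "(\<Sum>k\<le>length z'. of_bool (beyond (take k z') ?q) * ?N k) = of_bool (beyond z' ?r)"
    by (rule beyond_chen) (use assms in simp_all)
  \<comment> \<open>A backward crossing occurs only for a one-letter prefix, so this sum collapses
    to \<open>k = 0\<close>.\<close>
  also have "(\<Sum>k\<le>length z'. of_bool (take k z' = [] \<and> p \<in> A t \<and> q \<notin> A t) * ?N k) =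
      of_bool (p \<in> A t \<and> q \<notin> A t) * crossing z' ?q ?r"
  proof -
    have "(\<Sum>k\<le>length z'. of_bool (take k z' = [] \<and> p \<in> A t \<and> q \<notin> A t) * ?N k) =
      (\<Sum>k\<in>{0}. of_bool (take k z' = [] \<and> p \<in> A t \<and> q \<notin> A t) * ?N k)"
      by (rule sum.mono_neutral_right) auto
    then show ?thesis using assms by simp
  qed
  also have "crossing (t # z') q r + (of_bool (p \<notin> A t \<and> q \<in> A t) * of_bool (beyond z' ?r) -
      of_bool (p \<in> A t \<and> q \<notin> A t) * crossing z' ?q ?r) = crossing z p r"
  proof (cases z')
    case Nil
    then show ?thesis unfolding Cons by auto
  next
    case (Cons t' z'')
    have b: "beyond z r \<longleftrightarrow> r \<in> A t \<and> beyond z' ?r" using \<open>z = t # z'\<close> by simp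
    \<comment> \<open>Here \<open>?q\<close> lies in \<open>B t\<close>, hence in none of the sets
      \<open>A\<close>. If also \<open>p \<in> A t\<close>, the backward crossing of the edge
      \<open>t\<close> cancels against the forward one on the second segment.\<close>
    have "crossing z' ?q ?r = of_bool (beyond z' ?r)" if "q \<notin> A t"
      using inv_mult_B[OF assms(2) that] A_B_disjoint[of ?q t' t] Cons by auto
    moreover have "beyond z' ?r \<Longrightarrow> r \<in> A t" using beyond_tail[of r z' t] Cons assms by simp
    ultimately show ?thesis using b Cons unfolding \<open>z = t # z'\<close>
      by (cases "q \<in> A t"; cases "p \<in> A t"; cases "beyond z' ?r")
        (simp_all del: beyond.simps(2))
  qed
  finally show ?thesis .
qed

lemma crossing_same: "crossing z p p = of_bool (z = [])"
  by (cases z) auto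

lemma beyond_val:
  assumes "u \<in> carrier G" "\<And>t. u \<notin> B t"
  shows "beyond z (val z \<otimes> u)"
proof (induction z)
  case (Cons t z)
  have "val z \<otimes> u \<notin> B t'" for t'
  proof (cases z)
    case Nil
    then show ?thesis using assms by simp
  next
    case (Cons t'' z')
    then have "val z \<otimes> u \<in> A t''" using \<open>beyond z (val z \<otimes> u)\<close> by simp
    then show ?thesis using A_B_disjoint by blast
  qed
  then have "val (t # z) \<otimes> u \<in> A t" using A_iff[of "val z \<otimes> u" t] assms by (simp add: m_assoc)
  moreover have "inv x t \<otimes> (val (t # z) \<otimes> u) = val z \<otimes> u"
    using assms by (simp add: m_assoc[symmetric])
  ultimately show ?case using Cons by simp
qed simp

lemma crossing_val: "crossing z \<one> (val z) = 1"
  using beyond_val[of \<one> z] one_notin by (cases z) auto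

section \<open>Uniqueness of words and sparsity of crossing counts\<close>

lemma beyond_unique:
  "beyond v q \<Longrightarrow> beyond v' q \<Longrightarrow> length v = length v' \<Longrightarrow> v = v'"
proof (induction v arbitrary: q v')
  case (Cons t v)
  then obtain t' v'' where v': "v' = t' # v''" by (cases v') auto
  then have "t = t'" using Cons A_disjoint by auto
  then show ?case using Cons v' by auto
qed simp

lemma val_inject:
  assumes "val z = val z'" "length z = length z'"
  shows "z = z'"
  using beyond_unique[of z "val z" z'] beyond_val[of \<one> z] beyond_val[of \<one> z'] one_notin assms
  by auto

text \<open>If the first letter is cancelled, so is every later one: each step puts the rest of the
  product into a set \<open>B\<close>, hence outside the next set \<open>A\<close>.\<close>

lemma last_in_B:
  assumes "u \<in> carrier G" "val (w @ [t]) \<otimes> u \<notin> A (hd (w @ [t]))"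
  shows "u \<in> B t"
  using assms(2)
proof (induction w)
  case Nil
  then show ?case using assms(1) A_iff by simp
next
  case (Cons t' w)
  then have "val (w @ [t]) \<otimes> u \<in> B t'"
    using A_iff[of "val (w @ [t]) \<otimes> u" t'] assms(1) by (simp add: m_assoc)
  then have "val (w @ [t]) \<otimes> u \<notin> A (hd (w @ [t]))" using A_B_disjoint by blast
  then show ?case by (rule Cons.IH)
qed

text \<open>The last letter \<open>t\<close> is determined by \<open>u \<in> B t\<close>, these sets
  being disjoint. It is then absorbed into \<open>u\<close>, which is why the induction peels
  letters off the right end.\<close>

lemma not_beyond_first_unique:
  assumes "u \<in> carrier G" "length v = length v'"
    and "v \<noteq> [] \<longrightarrow> val v \<otimes> u \<notin> A (hd v)" "v' \<noteq> [] \<longrightarrow> val v' \<otimes> u \<notin> A (hd v')"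
  shows "v = v'"
  using assms
proof (induction v arbitrary: u v' rule: rev_induct)
  case (snoc t w)
  obtain w' t' where v': "v' = w' @ [t']" using snoc.prems(2) by (cases v' rule: rev_cases) auto
  have "u \<in> B t" "u \<in> B t'"
    using snoc.prems(3,4) last_in_B[OF snoc.prems(1)] unfolding v' by blast+
  then have t: "t = t'" using B_disjoint by blast
  have "w = w'"
    by (rule snoc.IH[of "x t \<otimes> u"])
       (use snoc.prems t in \<open>auto simp: v' val_append m_assoc hd_append split: if_splits\<close>)
  with t v' show ?case by simp
qed auto

text \<open>The forward count singles out one word of each length, read off from \<open>q\<close>,
  and the backward count one letter, read off from \<open>p\<close>. This will bound the number of
  entries in a row of \<open>step\<close>.\<close>

lemma crossing_row:
  "finite {v. length v = k \<and> crossing v p q \<noteq> 0}" (is "finite ?S")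
  "card {v. length v = k \<and> crossing v p q \<noteq> 0} \<le> 2"
proof -
  let ?P = "{v. length v = k \<and> beyond v q}" and ?M = "{v. \<exists>t. v = [t] \<and> p \<in> A t}"
  have sub: "?S \<subseteq> ?P \<union> ?M"
  proof
    fix v assume "v \<in> ?S"
    then show "v \<in> ?P \<union> ?M" by (cases v) (auto split: if_splits)
  qed
  have P: "finite ?P" "card ?P \<le> 1" by (rule card_le_one_if_unique; use beyond_unique in blast)+
  have M: "finite ?M" "card ?M \<le> 1" by (rule card_le_one_if_unique; use A_disjoint in blast)+
  show "finite ?S" using sub P M finite_subset by blast
  have "card ?S \<le> card (?P \<union> ?M)" using sub P M by (intro card_mono) auto
  also have "\<dots> \<le> 2" using card_Un_le[of ?P ?M] P M by linarith
  finally show "card ?S \<le> 2" .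
qed

text \<open>In a column of \<open>step\<close> the state after the word \<open>v\<close> is fixed,
  so both endpoints are known relative to the end of \<open>v\<close>. A forward crossing needs a
  start not beyond the first letter, a backward one needs \<open>u \<in> B t\<close>.\<close>

lemma crossing_column:
  assumes "u \<in> carrier G" "u' \<in> carrier G"
  shows "finite {v. length v = k \<and> crossing v (val v \<otimes> u') (val v \<otimes> u) \<noteq> 0}" (is "finite ?S")
    "card {v. length v = k \<and> crossing v (val v \<otimes> u') (val v \<otimes> u) \<noteq> 0} \<le> 2"
proof -
  let ?P = "{v. length v = k \<and> (v \<noteq> [] \<longrightarrow> val v \<otimes> u' \<notin> A (hd v))}"
  let ?M = "{v. \<exists>t. v = [t] \<and> u \<in> B t}"
  have sub: "?S \<subseteq> ?P \<union> ?M"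
  proof
    fix v assume v: "v \<in> ?S"
    show "v \<in> ?P \<union> ?M"
    proof (cases v)
      case (Cons t w)
      then show ?thesis using v assms A_iff[of u t] by (auto split: if_splits)
    qed (use v in auto)
  qed
  have P: "finite ?P" "card ?P \<le> 1"
    by (rule card_le_one_if_unique; use not_beyond_first_unique[OF assms(2)] in blast)+
  have M: "finite ?M" "card ?M \<le> 1" by (rule card_le_one_if_unique; use B_disjoint in blast)+
  show "finite ?S" using sub P M finite_subset by blast
  have "card ?S \<le> card (?P \<union> ?M)" using sub P M by (intro card_mono) auto
  also have "\<dots> \<le> 2" using card_Un_le[of ?P ?M] P M by linarith
  finally show "card ?S \<le> 2" .
qed

end

section \<open>Ping-pong from a nonabelian free subgroup\<close>

locale free_pair = group G for G :: "('g, 'm) monoid_scheme" (structure) +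
  fixes F S :: "'g set" and a b :: 'g
  assumes F: "subgroup F G" and S: "S \<subseteq> F"
    and bij: "bij_betw (word_value G) (reduced_words S) F"
    and ab: "a \<in> S" "b \<in> S" "a \<noteq> b"
begin

definition letter :: "'g \<Rightarrow> bool \<Rightarrow> 'g" where
  "letter s c = (if c then s else inv s)"

text \<open>Words are assigned to all of \<open>G\<close>, not only to \<open>F\<close>, by projecting along representatives of the right
  cosets; the representative of \<open>F\<close> must be \<open>\<one>\<close> for \<open>\<one>\<close> to get the empty word.\<close>

definition coset_rep :: "'g \<Rightarrow> 'g" where
  "coset_rep q = (if q \<in> F then \<one> else SOME r. r \<in> F #> q)"

definition word :: "'g \<Rightarrow> ('g \<times> bool) list" where
  "word q = inv_into (reduced_words S) (word_value G) (q \<otimes> inv coset_rep q)"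

definition b_headed :: "bool \<Rightarrow> 'g set" where
  "b_headed c = {q \<in> carrier G. word q \<noteq> [] \<and> hd (word q) = (b, c)}"

lemma F_carrier: "f \<in> F \<Longrightarrow> f \<in> carrier G"
  using F subgroup.subset by blast

lemma letter_F: "s \<in> S \<Longrightarrow> letter s c \<in> F"
  using S F by (auto simp: letter_def subgroup.m_inv_closed)

lemma letter_carrier [simp]: "s \<in> S \<Longrightarrow> letter s c \<in> carrier G"
  using letter_F F_carrier by blast

lemma word_value_Cons: "word_value G ((s, c) # w) = letter s c \<otimes> word_value G w"
  by (simp add: word_value_def letter_def)

lemma word_value_carrier: "w \<in> lists (S \<times> UNIV) \<Longrightarrow> word_value G w \<in> carrier G"
proof (induction w)
  case (Cons l w)
  then show ?case by (cases l) (auto simp: word_value_Cons)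
qed (simp add: word_value_def)

lemma coset_rep_props:
  assumes "q \<in> carrier G"
  shows "coset_rep q \<in> carrier G" "q \<otimes> inv coset_rep q \<in> F"
    "f \<in> F \<Longrightarrow> coset_rep (f \<otimes> q) = coset_rep q"
proof -
  have r: "coset_rep q \<in> F #> q"
  proof (cases "q \<in> F")
    case True
    then have "F #> q = F" using F assms by (simp add: coset_join2)
    then show ?thesis using True F by (simp add: coset_rep_def subgroup.one_closed)
  next
    case False
    have "q \<in> F #> q" using F assms by (simp add: rcos_self)
    then show ?thesis using False by (auto simp: coset_rep_def intro: someI)
  qed
  then obtain h where h: "h \<in> F" "coset_rep q = h \<otimes> q" by (auto simp: r_coset_def)
  then show "coset_rep q \<in> carrier G" using F_carrier assms by simp
  have "q \<otimes> inv coset_rep q = inv h"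
    using h assms F_carrier[of h] by (simp add: inv_mult_group m_assoc[symmetric])
  then show "q \<otimes> inv coset_rep q \<in> F" using h F by (simp add: subgroup.m_inv_closed)
  show "coset_rep (f \<otimes> q) = coset_rep q" if f: "f \<in> F"
  proof -
    have "f \<otimes> q \<in> F #> q" using f by (auto simp: r_coset_def)
    then have "F #> (f \<otimes> q) = F #> q" using F assms by (metis repr_independence)
    moreover have "f \<otimes> q \<in> F \<longleftrightarrow> q \<in> F"
    proof
      assume "f \<otimes> q \<in> F"
      then have "inv f \<otimes> (f \<otimes> q) \<in> F" using f F by (simp add: subgroup.m_inv_closed subgroup.m_closed)
      then show "q \<in> F" using f F_carrier assms by (simp add: m_assoc[symmetric])
    qed (use f F in \<open>simp add: subgroup.m_closed\<close>)
    ultimately show ?thesis by (simp add: coset_rep_def)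
  qed
qed

lemma word_props:
  assumes "q \<in> carrier G"
  shows "word q \<in> reduced_words S" "word_value G (word q) = q \<otimes> inv coset_rep q"
proof -
  have im: "word_value G ` reduced_words S = F" using bij by (simp add: bij_betw_def)
  show "word q \<in> reduced_words S" "word_value G (word q) = q \<otimes> inv coset_rep q"
    unfolding word_def using coset_rep_props(2)[OF assms] im by (simp_all add: inv_into_into f_inv_into_f)
qed

text \<open>Left multiplication by \<open>F\<close> keeps the coset representative, so it acts on
  the words of all elements of \<open>G\<close> as it does on those of \<open>F\<close>.\<close>

lemma word_eqI:
  assumes "q \<in> carrier G" "w \<in> reduced_words S" "f \<in> F" "word_value G w = f \<otimes> (q \<otimes> inv coset_rep q)"
  shows "word (f \<otimes> q) = w"
proof -
  have "(f \<otimes> q) \<otimes> inv coset_rep (f \<otimes> q) = word_value G w"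
    using assms coset_rep_props[OF assms(1)] F_carrier by (simp add: m_assoc)
  then show ?thesis
    unfolding word_def using assms(2) bij by (simp add: bij_betw_def)
qed

lemma word_one: "word \<one> = []"
proof -
  have "\<one> \<in> F" using F by (simp add: subgroup.one_closed)
  then have "word (\<one> \<otimes> \<one>) = []"
    by (intro word_eqI) (simp_all add: coset_rep_def reduced_words_def word_value_def)
  then show ?thesis by simp
qed

lemma reduced_Cons:
  "(s, c) # w \<in> reduced_words S \<longleftrightarrow> s \<in> S \<and> w \<in> reduced_words S \<and> (w \<noteq> [] \<longrightarrow> hd w \<noteq> (s, \<not> c))"
  by (cases w) (auto simp: reduced_words_def)

text \<open>If \<open>b\<close> cancels a leading inverse, the rest cannot begin with
  \<open>b\<close>, the word having been reduced; otherwise \<open>b\<close> becomes the first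
  letter.\<close>

lemma b_headed_iff:
  assumes "q \<in> carrier G"
  shows "b \<otimes> q \<in> b_headed True \<longleftrightarrow> q \<notin> b_headed False"
proof -
  have bF: "b \<in> F" and bc: "b \<in> carrier G" using ab S F_carrier by auto
  note w = word_props[OF assms]
  show ?thesis
  proof (cases "q \<in> b_headed False")
    case True
    then obtain w' where w': "word q = (b, False) # w'" by (cases "word q") (auto simp: b_headed_def)
    then have r: "w' \<in> reduced_words S" "w' \<noteq> [] \<longrightarrow> hd w' \<noteq> (b, True)"
      using w(1) by (simp_all add: reduced_Cons)
    then have "word_value G w' \<in> carrier G" by (intro word_value_carrier) (simp add: reduced_words_def)
    moreover have "inv b \<otimes> word_value G w' = q \<otimes> inv coset_rep q"
      using w(2) w' by (simp add: word_value_Cons letter_def)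
    ultimately have "word_value G w' = b \<otimes> (q \<otimes> inv coset_rep q)"
      using bc by (metis inv_closed m_assoc r_inv l_one)
    then have "word (b \<otimes> q) = w'" using word_eqI[OF assms r(1) bF] by simp
    then show ?thesis using r(2) True by (auto simp: b_headed_def)
  next
    case False
    then have "(b, True) # word q \<in> reduced_words S"
      using w(1) ab assms by (auto simp: reduced_Cons b_headed_def)
    then have "word (b \<otimes> q) = (b, True) # word q"
      using w(2) by (intro word_eqI[OF assms _ bF]) (simp_all add: word_value_Cons letter_def)
    then show ?thesis using False assms bc by (simp add: b_headed_def)
  qed
qed

lemma word_power_a:
  assumes "q \<in> carrier G" "word q \<noteq> [] \<longrightarrow> fst (hd (word q)) \<noteq> a"
  shows "word (letter a c [^] (k::nat) \<otimes> q) = replicate k (a, c) @ word q"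
proof (induction k)
  case (Suc k)
  let ?w = "replicate k (a, c) @ word q" and ?q = "letter a c [^] k \<otimes> q"
  have q: "?q \<in> carrier G" using assms ab by simp
  have "(a, c) # ?w \<in> reduced_words S"
    using word_props(1)[OF q] assms(2) ab unfolding Suc reduced_Cons
    by (cases k) (auto simp: prod_eq_iff)
  then have "word (letter a c \<otimes> ?q) = (a, c) # ?w"
    using word_props(2)[OF q] letter_F ab unfolding Suc
    by (intro word_eqI[OF q]) (simp_all add: word_value_Cons)
  moreover have "letter a c \<otimes> ?q = letter a c [^] Suc k \<otimes> q"
    using assms ab by (simp add: m_assoc[symmetric] nat_pow_Suc2[symmetric] del: nat_pow_Suc)
  ultimately show ?case by simp
qed (use assms in simp)

lemma b_headed_power:
  assumes "q \<in> carrier G" "word q = [] \<or> q \<in> b_headed c'" "k > 0"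
  shows "letter a c [^] (k::nat) \<otimes> q \<notin> b_headed c''"
proof -
  have "word (letter a c [^] k \<otimes> q) = replicate k (a, c) @ word q"
    using assms ab by (intro word_power_a) (auto simp: b_headed_def)
  moreover have "replicate k (a, c) = (a, c) # replicate (k - 1) (a, c)"
    using assms(3) by (cases k) auto
  ultimately show ?thesis using ab by (auto simp: b_headed_def)
qed

text \<open>Conjugates of \<open>b\<close> by distinct powers of \<open>a\<close> are the classical
  infinite free family inside a free group of rank two.\<close>

lemma ping_pong_conjugates:
  fixes e :: "'t \<Rightarrow> nat"
  assumes e: "inj e"
  shows "ping_pong G (\<lambda>t. a [^] e t \<otimes> b \<otimes> inv (a [^] e t))
     (\<lambda>t. {q \<in> carrier G. inv (a [^] e t) \<otimes> q \<in> b_headed True})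
     (\<lambda>t. {q \<in> carrier G. inv (a [^] e t) \<otimes> q \<in> b_headed False})"
proof -
  have ac: "a \<in> carrier G" and bc: "b \<in> carrier G" using ab S F_carrier by auto
  \<comment> \<open>Otherwise a \<open>b\<close>-headed word would arise from another one by
    multiplication with a positive power of \<open>a\<close>, but the result begins with
    \<open>a\<close>.\<close>
  have disj: False
    if q: "q \<in> carrier G" and 1: "inv (a [^] k) \<otimes> q \<in> b_headed c" and 2: "inv (a [^] j) \<otimes> q \<in> b_headed c'"
      and "k < j" for q and k j :: nat and c c'
  proof -
    have "a [^] j = a [^] k \<otimes> a [^] (j - k)" using \<open>k < j\<close> ac by (simp add: nat_pow_mult)
    then have "inv (a [^] k) \<otimes> a [^] j = a [^] (j - k)" using ac by (simp add: m_assoc[symmetric])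
    then have "inv (a [^] k) \<otimes> q = a [^] (j - k) \<otimes> (inv (a [^] j) \<otimes> q)"
      using q ac by (metis inv_closed inv_solve_left m_assoc m_closed nat_pow_closed)
    moreover have "letter a True [^] (j - k) \<otimes> (inv (a [^] j) \<otimes> q) \<notin> b_headed c"
      using q ac 2 \<open>k < j\<close> by (intro b_headed_power) auto
    ultimately show False using 1 by (simp add: letter_def)
  qed
  have disj': "j = k"
    if q: "q \<in> carrier G" "inv (a [^] k) \<otimes> q \<in> b_headed c" "inv (a [^] j) \<otimes> q \<in> b_headed c'"
    for q and k j :: nat and c c'
    using disj[OF q(1,2,3)] disj[OF q(1,3,2)] by (metis linorder_neqE_nat)
  have one: "inv (a [^] k) \<otimes> \<one> \<notin> b_headed c" for k :: nat and c
  proof (cases "k = 0")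
    case True
    then show ?thesis by (simp add: b_headed_def word_one)
  next
    case False
    then have "letter a False [^] k \<otimes> \<one> \<notin> b_headed c"
      by (intro b_headed_power) (auto simp: word_one)
    then show ?thesis using ac by (simp add: letter_def nat_pow_inv)
  qed
  show ?thesis
  proof (intro ping_pong.intro ping_pong_axioms.intro is_group)
    fix u t assume u: "u \<in> carrier G"
    have "inv (a [^] e t) \<otimes> (a [^] e t \<otimes> b \<otimes> inv (a [^] e t) \<otimes> u) = b \<otimes> (inv (a [^] e t) \<otimes> u)"
      using u ac bc by (simp add: m_assoc[symmetric])
    then show "a [^] e t \<otimes> b \<otimes> inv (a [^] e t) \<otimes> u \<in> {q \<in> carrier G. inv (a [^] e t) \<otimes> q \<in> b_headed True} \<longleftrightarrow>
       u \<notin> {q \<in> carrier G. inv (a [^] e t) \<otimes> q \<in> b_headed False}"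
      using u ac bc b_headed_iff[of "inv (a [^] e t) \<otimes> u"] by simp
  next
    fix q t t'
    assume q: "q \<in> {q \<in> carrier G. inv (a [^] e t) \<otimes> q \<in> b_headed True}"
      "q \<in> {q \<in> carrier G. inv (a [^] e t') \<otimes> q \<in> b_headed False}"
    then have "e t' = e t" using disj'[of q] by blast
    then show False using q by (auto simp: b_headed_def)
  next
    fix q t t'
    assume "q \<in> {q \<in> carrier G. inv (a [^] e t) \<otimes> q \<in> b_headed True}"
      "q \<in> {q \<in> carrier G. inv (a [^] e t') \<otimes> q \<in> b_headed True}"
    then show "t = t'" using disj' e by (blast dest: injD)
  next
    fix q t t'
    assume "q \<in> {q \<in> carrier G. inv (a [^] e t) \<otimes> q \<in> b_headed False}"
      "q \<in> {q \<in> carrier G. inv (a [^] e t') \<otimes> q \<in> b_headed False}"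
    then show "t = t'" using disj' e by (blast dest: injD)
  qed (use ac bc one in auto)
qed

end

text \<open>A word commutes with everything that commutes with all generators. This is applied first
  to a generator and then to any element of \<open>F\<close>. The contrapositive supplies two
  distinct generators.\<close>

lemma comm_group_if_one_generator:
  assumes G: "group G" and F: "subgroup F G" and S: "S \<subseteq> F"
    and bij: "bij_betw (word_value G) (reduced_words S) F"
    and one: "\<And>a b. a \<in> S \<Longrightarrow> b \<in> S \<Longrightarrow> a = b"
  shows "comm_group (G\<lparr>carrier := F\<rparr>)"
proof -
  interpret group G by fact
  have Fc: "f \<in> carrier G" if "f \<in> F" for f using that F subgroup.subset by blast
  have wc: "word_value G w \<in> carrier G" if "w \<in> lists (S \<times> UNIV)" for w
    using that
  proof (induction w)
    case (Cons l w)
    then show ?case using S Fc by (cases l) (auto simp: word_value_def)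
  qed (simp add: word_value_def)
  have comm: "word_value G w \<otimes>\<^bsub>G\<^esub> g = g \<otimes>\<^bsub>G\<^esub> word_value G w"
    if "w \<in> lists (S \<times> UNIV)" and g: "g \<in> carrier G" and sg: "\<And>s. s \<in> S \<Longrightarrow> s \<otimes>\<^bsub>G\<^esub> g = g \<otimes>\<^bsub>G\<^esub> s" for w g
    using that(1)
  proof (induction w)
    case Nil
    then show ?case using g by (simp add: word_value_def)
  next
    case (Cons l w)
    obtain s c where l: "l = (s, c)" by force
    then have s: "s \<in> S" "s \<in> carrier G" using Cons S Fc by auto
    let ?l = "if c then s else inv\<^bsub>G\<^esub> s"
    have lg: "?l \<otimes>\<^bsub>G\<^esub> g = g \<otimes>\<^bsub>G\<^esub> ?l"
    proof -
      have "inv\<^bsub>G\<^esub> s \<otimes>\<^bsub>G\<^esub> g = inv\<^bsub>G\<^esub> s \<otimes>\<^bsub>G\<^esub> (g \<otimes>\<^bsub>G\<^esub> s) \<otimes>\<^bsub>G\<^esub> inv\<^bsub>G\<^esub> s" using s g by (simp add: m_assoc)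
      also have "\<dots> = g \<otimes>\<^bsub>G\<^esub> inv\<^bsub>G\<^esub> s"
        unfolding sg[OF s(1), symmetric] using s g by (simp add: m_assoc[symmetric])
      finally show ?thesis using sg[OF s(1)] by simp
    qed
    have lc: "?l \<in> carrier G" using s by simp
    have w: "word_value G w \<in> carrier G" "word_value G w \<otimes>\<^bsub>G\<^esub> g = g \<otimes>\<^bsub>G\<^esub> word_value G w"
      using Cons wc by auto
    have "word_value G (l # w) = ?l \<otimes>\<^bsub>G\<^esub> word_value G w" by (simp add: word_value_def l)
    moreover have "?l \<otimes>\<^bsub>G\<^esub> word_value G w \<otimes>\<^bsub>G\<^esub> g = g \<otimes>\<^bsub>G\<^esub> (?l \<otimes>\<^bsub>G\<^esub> word_value G w)"
      using m_assoc[OF lc w(1) g] m_assoc[OF lc g w(1)] m_assoc[OF g lc w(1)] w(2) lg by argo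
    ultimately show ?case by simp
  qed
  have im: "\<exists>w. w \<in> lists (S \<times> UNIV) \<and> f = word_value G w" if "f \<in> F" for f
    using bij that by (auto simp: bij_betw_def reduced_words_def)
  have sF: "s \<otimes>\<^bsub>G\<^esub> f = f \<otimes>\<^bsub>G\<^esub> s" if s: "s \<in> S" and f: "f \<in> F" for s f
  proof -
    obtain w where w: "w \<in> lists (S \<times> UNIV)" "f = word_value G w" using im[OF f] by blast
    have "word_value G w \<otimes>\<^bsub>G\<^esub> s = s \<otimes>\<^bsub>G\<^esub> word_value G w"
    proof (rule comm[OF w(1)])
      show "s \<in> carrier G" using s S Fc by blast
      show "s' \<otimes>\<^bsub>G\<^esub> s = s \<otimes>\<^bsub>G\<^esub> s'" if "s' \<in> S" for s' using one[OF that s] by simp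
    qed
    then show ?thesis using w(2) by simp
  qed
  have "f \<otimes>\<^bsub>G\<^esub> g = g \<otimes>\<^bsub>G\<^esub> f" if f: "f \<in> F" and g: "g \<in> F" for f g
  proof -
    obtain w where w: "w \<in> lists (S \<times> UNIV)" "f = word_value G w" using im[OF f] by blast
    have "word_value G w \<otimes>\<^bsub>G\<^esub> g = g \<otimes>\<^bsub>G\<^esub> word_value G w"
      by (rule comm[OF w(1) Fc[OF g] sF[OF _ g]])
    then show ?thesis using w(2) by simp
  qed
  then show ?thesis
    by (intro group.group_comm_groupI subgroup.subgroup_is_group[OF F G]) simp
qed

lemma ping_pong_exists:
  fixes G :: "('g, 'm) monoid_scheme"
  assumes "group G" "has_nonabelian_free_subgroup G"
  obtains x and A B :: "'t :: countable \<Rightarrow> 'g set" where "ping_pong G x A B"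
proof -
  obtain F S where FS: "subgroup F G" "S \<subseteq> F" "bij_betw (word_value G) (reduced_words S) F"
    "\<not> comm_group (G\<lparr>carrier := F\<rparr>)"
    using assms(2) by (auto simp: has_nonabelian_free_subgroup_def free_subgroup_def)
  then obtain a b where "a \<in> S" "b \<in> S" "a \<noteq> b"
    using comm_group_if_one_generator[OF assms(1)] by blast
  then interpret free_pair G F S a b
    using FS assms(1) by (intro free_pair.intro free_pair_axioms.intro)
  show thesis
    using ping_pong_conjugates[of "to_nat :: 't \<Rightarrow> nat"] that by simp
qed

section \<open>The space of square-summable functions\<close>

definition ell2 :: "('x \<Rightarrow> complex) set" where
  "ell2 = {f. (\<lambda>x. (cmod (f x))\<^sup>2) summable_on UNIV}"

definition ell2_space :: "('x \<Rightarrow> complex) hilbert" where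
  "ell2_space = \<lparr>carrier = ell2, mult = (\<lambda>f g x. f x * g x), one = (\<lambda>_. 1),
     zero = (\<lambda>_. 0), add = (\<lambda>f g x. f x + g x), smult = (\<lambda>a f x. a * f x),
     cinner = (\<lambda>f g. \<Sum>\<^sub>\<infinity>x. f x * cnj (g x))\<rparr>"

lemma ell2_space_simps [simp]:
  "carrier ell2_space = ell2" "\<zero>\<^bsub>ell2_space\<^esub> = (\<lambda>_. 0)"
  "f \<oplus>\<^bsub>ell2_space\<^esub> g = (\<lambda>x. f x + g x)" "a \<odot>\<^bsub>ell2_space\<^esub> f = (\<lambda>x. a * f x)"
  "cinner ell2_space f g = (\<Sum>\<^sub>\<infinity>x. f x * cnj (g x))"
  by (simp_all add: ell2_space_def)

lemma ell2_bounded_sums: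
  assumes "\<And>F. finite F \<Longrightarrow> (\<Sum>x\<in>F. (cmod (f x))\<^sup>2) \<le> C"
  shows "f \<in> ell2" "(\<Sum>\<^sub>\<infinity>x. (cmod (f x))\<^sup>2) \<le> C"
proof -
  have "(\<lambda>x. (cmod (f x))\<^sup>2) summable_on UNIV"
    by (rule nonneg_bdd_above_summable_on) (auto intro!: bdd_aboveI2 assms)
  then show "f \<in> ell2" "(\<Sum>\<^sub>\<infinity>x. (cmod (f x))\<^sup>2) \<le> C"
    by (auto simp: ell2_def intro!: infsum_le_finite_sums assms)
qed

lemma ell2_sum_le:
  "f \<in> ell2 \<Longrightarrow> finite F \<Longrightarrow> (\<Sum>x\<in>F. (cmod (f x))\<^sup>2) \<le> (\<Sum>\<^sub>\<infinity>x. (cmod (f x))\<^sup>2)"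
  by (auto simp: ell2_def intro!: finite_sum_le_infsum)

lemma ell2_inner_summable:
  assumes "f \<in> ell2" "g \<in> ell2"
  shows "(\<lambda>x. f x * cnj (g x)) summable_on UNIV"
proof -
  have "(\<lambda>x. (cmod (f x))\<^sup>2 + (cmod (g x))\<^sup>2) summable_on UNIV"
    using assms by (auto simp: ell2_def intro: summable_on_add)
  then have "(\<lambda>x. cmod (f x * cnj (g x))) summable_on UNIV"
  proof (rule Infinite_Sum.summable_on_comparison_test)
    fix x
    show "cmod (f x * cnj (g x)) \<le> (cmod (f x))\<^sup>2 + (cmod (g x))\<^sup>2"
    proof -
      define a b where "a = cmod (f x)" and "b = cmod (g x)"
      have "0 \<le> a * b" by (simp add: a_def b_def)
      moreover have "2 * (a * b) \<le> a\<^sup>2 + b\<^sup>2" using sum_squares_bound[of a b] by (simp only: mult.assoc)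
      ultimately have "a * b \<le> a\<^sup>2 + b\<^sup>2" by linarith
      then show ?thesis by (simp add: norm_mult a_def b_def)
    qed
  qed simp
  then show ?thesis by (rule abs_summable_summable)
qed

lemma ell2_add: "f \<in> ell2 \<Longrightarrow> g \<in> ell2 \<Longrightarrow> (\<lambda>x. f x + g x) \<in> ell2"
proof -
  assume fg: "f \<in> ell2" "g \<in> ell2"
  have le: "(cmod (f x + g x))\<^sup>2 \<le> 2 * (cmod (f x))\<^sup>2 + 2 * (cmod (g x))\<^sup>2" for x
  proof -
    have "(cmod (f x + g x))\<^sup>2 \<le> (cmod (f x) + cmod (g x))\<^sup>2"
      by (intro power_mono norm_triangle_ineq) simp
    also have "\<dots> \<le> 2 * (cmod (f x))\<^sup>2 + 2 * (cmod (g x))\<^sup>2"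
      using sum_squares_bound[of "cmod (f x)" "cmod (g x)"] by (simp add: power2_sum)
    finally show ?thesis .
  qed
  have "(\<Sum>x\<in>F. (cmod (f x + g x))\<^sup>2) \<le>
      2 * (\<Sum>\<^sub>\<infinity>x. (cmod (f x))\<^sup>2) + 2 * (\<Sum>\<^sub>\<infinity>x. (cmod (g x))\<^sup>2)" if F: "finite F" for F
  proof -
    have "(\<Sum>x\<in>F. (cmod (f x + g x))\<^sup>2) \<le> 2 * (\<Sum>x\<in>F. (cmod (f x))\<^sup>2) + 2 * (\<Sum>x\<in>F. (cmod (g x))\<^sup>2)"
      unfolding sum_distrib_left sum.distrib[symmetric] by (intro sum_mono le)
    also have "\<dots> \<le> 2 * (\<Sum>\<^sub>\<infinity>x. (cmod (f x))\<^sup>2) + 2 * (\<Sum>\<^sub>\<infinity>x. (cmod (g x))\<^sup>2)"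
      using ell2_sum_le[OF fg(1) F] ell2_sum_le[OF fg(2) F] by linarith
    finally show ?thesis .
  qed
  then show ?thesis by (rule ell2_bounded_sums(1))
qed

lemma ell2_smult: "f \<in> ell2 \<Longrightarrow> (\<lambda>x. a * f x) \<in> ell2"
  by (auto simp: ell2_def norm_mult power_mult_distrib intro: summable_on_cmult_right)

lemma ell2_zero [simp]: "(\<lambda>_. 0) \<in> ell2"
  by (simp add: ell2_def)

text \<open>Valid for every \<open>f\<close>: without summability both infinite sums have the
  default value 0, and for this reason the proof supplies an equivalence of summability.\<close>

lemma hnorm_ell2: "hnorm ell2_space f = sqrt (\<Sum>\<^sub>\<infinity>x. (cmod (f x))\<^sup>2)"
proof -
  have "(\<Sum>\<^sub>\<infinity>x. f x * cnj (f x)) = (\<Sum>\<^sub>\<infinity>x. of_real ((cmod (f x))\<^sup>2))"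
    by (rule infsum_cong) (simp add: complex_norm_square del: of_real_power)
  also have "\<dots> = of_real (\<Sum>\<^sub>\<infinity>x. (cmod (f x))\<^sup>2)"
  proof (rule infsum_bounded_linear_strong[OF _ bounded_linear_of_real])
    show "(\<lambda>x. complex_of_real ((cmod (f x))\<^sup>2)) summable_on UNIV \<longleftrightarrow>
        (\<lambda>x. (cmod (f x))\<^sup>2) summable_on UNIV"
      using summable_on_of_real[where 'a = complex, of "\<lambda>x. (cmod (f x))\<^sup>2" UNIV] summable_on_Re[of "\<lambda>x. complex_of_real ((cmod (f x))\<^sup>2)" UNIV]
      by auto
  qed
  finally show ?thesis by (simp add: hnorm_def)
qed

lemma cmod_le_hnorm_ell2: "f \<in> ell2 \<Longrightarrow> cmod (f x) \<le> hnorm ell2_space f"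
  using ell2_sum_le[of f "{x}"] by (simp add: hnorm_ell2 real_le_rsqrt)

lemma module_ell2: "module complex_ring (ell2_space :: ('x \<Rightarrow> complex) hilbert)"
proof (rule moduleI)
  show "abelian_group (ell2_space :: ('x \<Rightarrow> complex) hilbert)"
  proof (rule abelian_groupI)
    fix f :: "'x \<Rightarrow> complex" assume "f \<in> carrier ell2_space"
    then show "\<exists>g\<in>carrier ell2_space. g \<oplus>\<^bsub>ell2_space\<^esub> f = \<zero>\<^bsub>ell2_space\<^esub>"
      using ell2_smult[of f "- 1"] by (intro bexI[of _ "\<lambda>x. - 1 * f x"]) auto
  qed (auto simp: ell2_add algebra_simps)
qed (auto simp: cring_complex_ring ell2_smult algebra_simps)

lemma ell2_minus: "f \<in> ell2 \<Longrightarrow> g \<in> ell2 \<Longrightarrow> f \<ominus>\<^bsub>ell2_space\<^esub> g = (\<lambda>x. f x - g x)"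
  by (simp add: complex_module_minus[OF module_ell2])

lemma ell2_diff: "f \<in> ell2 \<Longrightarrow> g \<in> ell2 \<Longrightarrow> (\<lambda>x. f x - g x) \<in> ell2"
  using ell2_add[OF _ ell2_smult[of g "- 1"], of f] by simp

lemma complex_hilbert_ell2: "complex_hilbert (ell2_space :: ('x \<Rightarrow> complex) hilbert)"
proof (intro complex_hilbert.intro complex_hilbert_axioms.intro module_ell2)
  fix \<sigma> :: "nat \<Rightarrow> 'x \<Rightarrow> complex"
  assume \<sigma>: "\<And>n. \<sigma> n \<in> carrier ell2_space"
    and cauchy: "\<And>e. e > 0 \<Longrightarrow> \<exists>N. \<forall>m\<ge>N. \<forall>n\<ge>N. hnorm ell2_space (\<sigma> m \<ominus>\<^bsub>ell2_space\<^esub> \<sigma> n) < e"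
  have \<sigma>': "\<sigma> n \<in> ell2" for n using \<sigma> by simp
  have "Cauchy (\<lambda>n. \<sigma> n x)" for x
    unfolding Cauchy_def
  proof (intro allI impI)
    fix e :: real assume "e > 0"
    from cauchy[OF this] obtain N
      where N: "\<And>m n. m \<ge> N \<Longrightarrow> n \<ge> N \<Longrightarrow> hnorm ell2_space (\<lambda>x. \<sigma> m x - \<sigma> n x) < e"
      by (auto simp: ell2_minus \<sigma>')
    have "dist (\<sigma> m x) (\<sigma> n x) < e" if "m \<ge> N" "n \<ge> N" for m n
      using cmod_le_hnorm_ell2[OF ell2_diff[OF \<sigma>' \<sigma>'], of m x n] N[OF that] by (simp add: dist_norm)
    then show "\<exists>M. \<forall>m\<ge>M. \<forall>n\<ge>M. dist (\<sigma> m x) (\<sigma> n x) < e" by blast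
  qed
  then have "\<exists>y. (\<lambda>n. \<sigma> n x) \<longlonglongrightarrow> y" for x
    using Cauchy_convergent convergentD by blast
  then obtain f where f: "\<And>x. (\<lambda>n. \<sigma> n x) \<longlonglongrightarrow> f x" by metis
  \<comment> \<open>The pointwise limit \<open>f\<close> is not yet known to lie in
    \<open>ell2\<close>. Over a finite set the limit in \<open>n\<close> may be taken; the resulting
    bounds give membership of the difference together with its norm.\<close>
  have tail: "\<exists>N. \<forall>m\<ge>N. (\<lambda>x. \<sigma> m x - f x) \<in> ell2 \<and> hnorm ell2_space (\<lambda>x. \<sigma> m x - f x) \<le> e"
    if "e > 0" for e
  proof -
    from cauchy[OF that] obtain N
      where N: "\<And>m n. m \<ge> N \<Longrightarrow> n \<ge> N \<Longrightarrow> hnorm ell2_space (\<lambda>x. \<sigma> m x - \<sigma> n x) < e"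
      by (auto simp: ell2_minus \<sigma>')
    have "(\<Sum>x\<in>F. (cmod (\<sigma> m x - f x))\<^sup>2) \<le> e\<^sup>2" if m: "m \<ge> N" and F: "finite F" for m F
    proof (rule tendsto_upperbound)
      show "(\<lambda>n. \<Sum>x\<in>F. (cmod (\<sigma> m x - \<sigma> n x))\<^sup>2) \<longlonglongrightarrow> (\<Sum>x\<in>F. (cmod (\<sigma> m x - f x))\<^sup>2)"
        by (intro tendsto_intros f)
      have "(\<Sum>x\<in>F. (cmod (\<sigma> m x - \<sigma> n x))\<^sup>2) \<le> e\<^sup>2" if "n \<ge> N" for n
      proof -
        have "(\<Sum>x\<in>F. (cmod (\<sigma> m x - \<sigma> n x))\<^sup>2) \<le> (\<Sum>\<^sub>\<infinity>x. (cmod (\<sigma> m x - \<sigma> n x))\<^sup>2)"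
          by (rule ell2_sum_le[OF ell2_diff F]) (rule \<sigma>')+
        also have "\<dots> = (hnorm ell2_space (\<lambda>x. \<sigma> m x - \<sigma> n x))\<^sup>2"
          by (simp add: hnorm_ell2 infsum_nonneg)
        also have "\<dots> \<le> e\<^sup>2"
          using N[OF m that] by (intro power_mono) (simp_all add: hnorm_ell2 infsum_nonneg)
        finally show ?thesis .
      qed
      then show "\<forall>\<^sub>F n in sequentially. (\<Sum>x\<in>F. (cmod (\<sigma> m x - \<sigma> n x))\<^sup>2) \<le> e\<^sup>2"
        by (auto simp: eventually_sequentially)
    qed simp
    note * = ell2_bounded_sums[OF this]
    have "(\<lambda>x. \<sigma> m x - f x) \<in> ell2 \<and> hnorm ell2_space (\<lambda>x. \<sigma> m x - f x) \<le> e" if "m \<ge> N" for m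
      using *[OF that] \<open>e > 0\<close> by (simp add: hnorm_ell2 real_le_lsqrt)
    then show ?thesis by blast
  qed
  from tail[of 1] obtain m where "(\<lambda>x. \<sigma> m x - f x) \<in> ell2" by auto
  from ell2_diff[OF \<sigma>'[of m] this] have fl: "f \<in> ell2" by simp
  have "(\<lambda>n. hnorm ell2_space (\<lambda>x. \<sigma> n x - f x)) \<longlonglongrightarrow> 0"
  proof (rule LIMSEQ_I)
    fix r :: real assume "r > 0"
    then obtain N where N: "\<forall>m\<ge>N. hnorm ell2_space (\<lambda>x. \<sigma> m x - f x) \<le> r / 2"
      using tail[of "r / 2"] by auto
    have "norm (hnorm ell2_space (\<lambda>x. \<sigma> n x - f x) - 0) < r" if "n \<ge> N" for n
    proof -
      have "hnorm ell2_space (\<lambda>x. \<sigma> n x - f x) \<le> r / 2" using N that by blast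
      moreover have "hnorm ell2_space (\<lambda>x. \<sigma> n x - f x) \<ge> 0" by (simp add: hnorm_ell2 infsum_nonneg)
      ultimately show ?thesis using \<open>r > 0\<close> unfolding real_norm_def by linarith
    qed
    then show "\<exists>no. \<forall>n\<ge>no. norm (hnorm ell2_space (\<lambda>x. \<sigma> n x - f x) - 0) < r" by blast
  qed
  then show "\<exists>f\<in>carrier ell2_space. (\<lambda>n. hnorm ell2_space (\<sigma> n \<ominus>\<^bsub>ell2_space\<^esub> f)) \<longlonglongrightarrow> 0"
    using fl by (intro bexI[of _ f]) (simp_all add: ell2_minus \<sigma>')
next
  fix f g h :: "'x \<Rightarrow> complex"
  assume "f \<in> carrier ell2_space" "g \<in> carrier ell2_space" "h \<in> carrier ell2_space"
  then show "cinner ell2_space (f \<oplus>\<^bsub>ell2_space\<^esub> g) h = cinner ell2_space f h + cinner ell2_space g h"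
    by (simp add: distrib_right infsum_add ell2_inner_summable)
next
  fix f g :: "'x \<Rightarrow> complex" and a
  assume "f \<in> carrier ell2_space" "g \<in> carrier ell2_space"
  show "cinner ell2_space (a \<odot>\<^bsub>ell2_space\<^esub> f) g = a * cinner ell2_space f g"
    by (simp add: mult.assoc infsum_cmult_right')
next
  fix f g :: "'x \<Rightarrow> complex"
  show "cinner ell2_space f g = cnj (cinner ell2_space g f)"
    using infsum_cnj[of "\<lambda>x. g x * cnj (f x)" UNIV] by (simp add: mult.commute)
next
  fix f :: "'x \<Rightarrow> complex"
  assume f: "f \<in> carrier ell2_space" "f \<noteq> \<zero>\<^bsub>ell2_space\<^esub>"
  then obtain x where "0 < cmod (f x)" by auto
  also have "\<dots> \<le> hnorm ell2_space f" using f(1) by (intro cmod_le_hnorm_ell2) simp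
  finally have "hnorm ell2_space f > 0" .
  then show "Re (cinner ell2_space f f) > 0" by (simp add: hnorm_def)
qed

text \<open>Cauchy-Schwarz in each row of at most \<open>M\<close> terms, then summation by columns.
  Columns are measured by their sum of squares because a column of \<open>step\<close> may hold
  \<open>N\<close> entries of size \<open>N^(-1/2)\<close> for arbitrarily large
  \<open>N\<close>.\<close>

lemma ell2_schur_test:
  fixes R :: "'x \<Rightarrow> 'v set" and c :: "'x \<Rightarrow> 'v \<Rightarrow> complex" and \<tau> :: "'x \<Rightarrow> 'v \<Rightarrow> 'y"
  assumes R: "\<And>x. finite (R x)" "\<And>x. card (R x) \<le> M"
    and col: "\<And>y P. finite P \<Longrightarrow> P \<subseteq> {(x, v). v \<in> R x \<and> \<tau> x v = y} \<Longrightarrow>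
      (\<Sum>(x, v)\<in>P. (cmod (c x v))\<^sup>2) \<le> K"
    and f: "f \<in> ell2"
  defines "D \<equiv> \<lambda>f x. \<Sum>v\<in>R x. c x v * f (\<tau> x v)"
  shows "D f \<in> ell2" "hnorm ell2_space (D f) \<le> sqrt (real M * K) * hnorm ell2_space f"
proof -
  let ?S = "\<Sum>\<^sub>\<infinity>y. (cmod (f y))\<^sup>2"
  have bd: "(\<Sum>x\<in>F. (cmod (D f x))\<^sup>2) \<le> real M * K * ?S" if F: "finite F" for F
  proof -
    have row: "(cmod (D f x))\<^sup>2 \<le> real M * (\<Sum>v\<in>R x. (cmod (c x v))\<^sup>2 * (cmod (f (\<tau> x v)))\<^sup>2)" for x
    proof -
      have "(cmod (D f x))\<^sup>2 \<le> (\<Sum>v\<in>R x. cmod (c x v * f (\<tau> x v)))\<^sup>2"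
        unfolding D_def by (intro power_mono) (simp_all add: norm_sum)
      also have "\<dots> \<le> (\<Sum>v\<in>R x. (cmod (c x v * f (\<tau> x v)))\<^sup>2) * card (R x)"
        by (rule sum_squared_le_sum_of_squares)
      also have "\<dots> \<le> real M * (\<Sum>v\<in>R x. (cmod (c x v * f (\<tau> x v)))\<^sup>2)"
        using R(2)[of x] by (subst mult.commute) (intro mult_right_mono, auto intro: sum_nonneg)
      finally show ?thesis by (simp add: norm_mult power_mult_distrib)
    qed
    let ?P = "Sigma F R"
    have fin: "finite ?P" using F R(1) by blast
    let ?t = "\<lambda>(x, v). \<tau> x v"
    have "(\<Sum>x\<in>F. (cmod (D f x))\<^sup>2) \<le>
        (\<Sum>x\<in>F. real M * (\<Sum>v\<in>R x. (cmod (c x v))\<^sup>2 * (cmod (f (\<tau> x v)))\<^sup>2))"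
      by (rule sum_mono) (rule row)
    also have "\<dots> = real M * (\<Sum>x\<in>F. \<Sum>v\<in>R x. (cmod (c x v))\<^sup>2 * (cmod (f (\<tau> x v)))\<^sup>2)"
      by (rule sum_distrib_left[symmetric])
    also have "(\<Sum>x\<in>F. \<Sum>v\<in>R x. (cmod (c x v))\<^sup>2 * (cmod (f (\<tau> x v)))\<^sup>2) =
        (\<Sum>(x, v)\<in>?P. (cmod (c x v))\<^sup>2 * (cmod (f (\<tau> x v)))\<^sup>2)"
      using F R(1) by (simp add: sum.Sigma)
    also have "\<dots> = (\<Sum>y\<in>?t ` ?P. \<Sum>p\<in>{p \<in> ?P. ?t p = y}. (\<lambda>(x, v). (cmod (c x v))\<^sup>2 * (cmod (f (\<tau> x v)))\<^sup>2) p)"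
      by (rule sum.image_gen[OF fin])
    also have "\<dots> \<le> (\<Sum>y\<in>?t ` ?P. K * (cmod (f y))\<^sup>2)"
    proof (rule sum_mono)
      fix y
      have "(\<Sum>p\<in>{p \<in> ?P. ?t p = y}. (\<lambda>(x, v). (cmod (c x v))\<^sup>2 * (cmod (f (\<tau> x v)))\<^sup>2) p) =
         (\<Sum>p\<in>{p \<in> ?P. ?t p = y}. (\<lambda>(x, v). (cmod (c x v))\<^sup>2) p) * (cmod (f y))\<^sup>2"
        unfolding sum_distrib_right by (rule sum.cong) auto
      also have "\<dots> \<le> K * (cmod (f y))\<^sup>2"
        using fin by (intro mult_right_mono col[of _ y]) auto
      finally show "(\<Sum>p\<in>{p \<in> ?P. ?t p = y}. (\<lambda>(x, v). (cmod (c x v))\<^sup>2 * (cmod (f (\<tau> x v)))\<^sup>2) p) \<le> \<dots>" .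
    qed
    also have "\<dots> = K * (\<Sum>y\<in>?t ` ?P. (cmod (f y))\<^sup>2)" by (simp add: sum_distrib_left)
    also have "\<dots> \<le> K * ?S"
      using col[of "{}"] fin by (intro mult_left_mono ell2_sum_le f) auto
    finally show ?thesis by (simp add: mult_left_mono mult.assoc)
  qed
  show "D f \<in> ell2" by (rule ell2_bounded_sums(1)[OF bd])
  show "hnorm ell2_space (D f) \<le> sqrt (real M * K) * hnorm ell2_space f"
    using ell2_bounded_sums(2)[OF bd] by (simp add: hnorm_ell2 flip: real_sqrt_mult)
qed

section \<open>Factorizations and Fourier matrices\<close>

lemma hnorm_scalars: "hnorm scalars (Inl z) = cmod z"
  by (simp add: hnorm_def scalars_def cmod_def power2_eq_square)

lemma multiplier_factorizationD:
  assumes "multiplier_factorization G d \<phi> H \<xi>"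
  shows "i \<le> d \<Longrightarrow> complex_hilbert (H i)" "H 0 = scalars" "H d = scalars"
    "i \<in> {1..d} \<Longrightarrow> t \<in> carrier G \<Longrightarrow> \<xi> i t \<in> linear_operators (H i) (H (i - 1))"
    "i \<in> {1..d} \<Longrightarrow> \<exists>C. \<forall>t\<in>carrier G. \<forall>v\<in>carrier (H i).
       hnorm (H (i - 1)) (\<xi> i t v) \<le> C * hnorm (H i) v"
    "\<tau> \<in> {1..d} \<rightarrow> carrier G \<Longrightarrow>
       Inl (\<phi> (foldr (\<lambda>i. mult G (\<tau> i)) [1..<Suc d] \<one>\<^bsub>G\<^esub>)) =
       foldr (\<lambda>i. \<xi> i (\<tau> i)) [1..<Suc d] (Inl 1)"
proof -
  note * = assms[unfolded multiplier_factorization_def]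
  show hil: "complex_hilbert (H i)" if "i \<le> d" for i using * that by blast
  show "H 0 = scalars" "H d = scalars" using * by blast+
  have "(\<forall>t\<in>carrier G. \<xi> i t \<in> linear_operators (H i) (H (i - 1))) \<and>
      (\<exists>C. \<forall>t\<in>carrier G. \<forall>v\<in>carrier (H i). hnorm (H (i - 1)) (\<xi> i t v) \<le> C * hnorm (H i) v)"
    if "i \<in> {1..d}" for i
    using bounded_family_iff[of "H i" "H (i - 1)" "carrier G" "\<xi> i"] hil[of i] hil[of "i - 1"] * that
    by auto
  then show "i \<in> {1..d} \<Longrightarrow> t \<in> carrier G \<Longrightarrow> \<xi> i t \<in> linear_operators (H i) (H (i - 1))"
    "i \<in> {1..d} \<Longrightarrow> \<exists>C. \<forall>t\<in>carrier G. \<forall>v\<in>carrier (H i).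
       hnorm (H (i - 1)) (\<xi> i t v) \<le> C * hnorm (H i) v" by blast+
  show "\<tau> \<in> {1..d} \<rightarrow> carrier G \<Longrightarrow>
       Inl (\<phi> (foldr (\<lambda>i. mult G (\<tau> i)) [1..<Suc d] \<one>\<^bsub>G\<^esub>)) =
       foldr (\<lambda>i. \<xi> i (\<tau> i)) [1..<Suc d] (Inl 1)" using * by blast
qed

lemma multiplier_factorizationI:
  assumes hil: "\<And>i. i \<le> d \<Longrightarrow> complex_hilbert (H i)" and "H 0 = scalars" "H d = scalars"
    and "\<And>i t. i \<in> {1..d} \<Longrightarrow> t \<in> carrier G \<Longrightarrow> \<xi> i t \<in> linear_operators (H i) (H (i - 1))"
    and "\<And>i. i \<in> {1..d} \<Longrightarrow> \<exists>C. \<forall>t\<in>carrier G. \<forall>v\<in>carrier (H i).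
       hnorm (H (i - 1)) (\<xi> i t v) \<le> C * hnorm (H i) v"
    and "\<And>\<tau>. \<tau> \<in> {1..d} \<rightarrow> carrier G \<Longrightarrow>
       Inl (\<phi> (foldr (\<lambda>i. mult G (\<tau> i)) [1..<Suc d] \<one>\<^bsub>G\<^esub>)) =
       foldr (\<lambda>i. \<xi> i (\<tau> i)) [1..<Suc d] (Inl 1)"
  shows "multiplier_factorization G d \<phi> H \<xi>"
  unfolding multiplier_factorization_def
proof (intro conjI)
  show "\<forall>i\<in>{1..d}. (\<forall>t\<in>carrier G. \<xi> i t \<in> bounded_operators (H i) (H (i - 1))) \<and>
        bdd_above ((\<lambda>t. op_norm (H i) (H (i - 1)) (\<xi> i t)) ` carrier G)"
  proof
    fix i assume i: "i \<in> {1..d}"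
    then have "complex_hilbert (H i)" "complex_hilbert (H (i - 1))" by (auto intro: hil)
    note * = iffD2[OF bounded_family_iff[OF this]]
    show "(\<forall>t\<in>carrier G. \<xi> i t \<in> bounded_operators (H i) (H (i - 1))) \<and>
        bdd_above ((\<lambda>t. op_norm (H i) (H (i - 1)) (\<xi> i t)) ` carrier G)"
      by (rule *, rule conjI[OF ballI[OF assms(4)[OF i]] assms(5)[OF i]])
  qed
qed (use assms in blast)+

section \<open>Inclusion of consecutive multiplier spaces\<close>

lemma linear_operators_comp:
  "S \<in> linear_operators E F \<Longrightarrow> T \<in> linear_operators F K \<Longrightarrow> T \<circ> S \<in> linear_operators E K"
  by (auto simp: linear_operators_def Pi_iff)

text \<open>The last variable is set to the unit and the constant operator that results is absorbed
  into \<open>\<xi> d\<close>.\<close>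

lemma multiplier_space_Suc_subset:
  fixes G :: "('g, 'm) monoid_scheme"
  assumes G: "group G" and d: "d \<ge> 1"
  shows "multiplier_space (Suc d) G \<subseteq> multiplier_space d G"
proof
  fix \<phi> assume "\<phi> \<in> multiplier_space (Suc d) G"
  then obtain H :: "nat \<Rightarrow> (complex + ('g list \<Rightarrow> complex)) hilbert" and \<xi>
    where \<phi>: "\<phi> \<in> carrier G \<rightarrow>\<^sub>E UNIV" "bdd_above ((\<lambda>t. cmod (\<phi> t)) ` carrier G)"
      and fact: "multiplier_factorization G (Suc d) \<phi> H \<xi>"
    by (auto simp: multiplier_space_def)
  interpret group G by fact
  note D = multiplier_factorizationD[OF fact]
  define H' where "H' = H(d := scalars)"
  define \<xi>' where "\<xi>' i t = (if i = d then \<xi> d t \<circ> \<xi> (Suc d) \<one>\<^bsub>G\<^esub> else \<xi> i t)" for i t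
  have last: "\<xi> (Suc d) \<one>\<^bsub>G\<^esub> \<in> linear_operators scalars (H d)"
    using D(4)[of "Suc d" "\<one>\<^bsub>G\<^esub>"] D(3) by simp
  have "multiplier_factorization G d \<phi> H' \<xi>'"
  proof (rule multiplier_factorizationI)
    show "complex_hilbert (H' i)" if "i \<le> d" for i
      using D(1)[of i] that by (simp add: H'_def complex_hilbert_scalars)
    show "H' 0 = scalars" "H' d = scalars" using D(2) by (simp_all add: H'_def)
    show "\<xi>' i t \<in> linear_operators (H' i) (H' (i - 1))" if "i \<in> {1..d}" "t \<in> carrier G" for i t
      using linear_operators_comp[OF last] D(4)[of i t] that d by (auto simp: \<xi>'_def H'_def)
    show "\<exists>C. \<forall>t\<in>carrier G. \<forall>v\<in>carrier (H' i). hnorm (H' (i - 1)) (\<xi>' i t v) \<le> C * hnorm (H' i) v"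
      if i: "i \<in> {1..d}" for i
    proof (cases "i = d")
      case False
      then show ?thesis using D(5)[of i] i by (auto simp: \<xi>'_def H'_def)
    next
      case True
      obtain C where C: "\<And>t v. t \<in> carrier G \<Longrightarrow> v \<in> carrier (H d) \<Longrightarrow>
          hnorm (H (d - 1)) (\<xi> d t v) \<le> C * hnorm (H d) v"
        using D(5)[of d] i True by auto
      obtain C' where C': "\<And>v. v \<in> carrier scalars \<Longrightarrow>
          hnorm (H d) (\<xi> (Suc d) \<one>\<^bsub>G\<^esub> v) \<le> C' * hnorm scalars v"
        using D(5)[of "Suc d"] D(3) by auto
      have "hnorm (H (d - 1)) (\<xi> d t (\<xi> (Suc d) \<one>\<^bsub>G\<^esub> v)) \<le> (\<bar>C\<bar> * C') * hnorm scalars v"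
        if t: "t \<in> carrier G" and v: "v \<in> carrier scalars" for t v
      proof -
        have w: "\<xi> (Suc d) \<one>\<^bsub>G\<^esub> v \<in> carrier (H d)" using last v by (auto simp: linear_operators_def)
        have "hnorm (H (d - 1)) (\<xi> d t (\<xi> (Suc d) \<one>\<^bsub>G\<^esub> v)) \<le> C * hnorm (H d) (\<xi> (Suc d) \<one>\<^bsub>G\<^esub> v)"
          by (rule C[OF t w])
        also have "\<dots> \<le> \<bar>C\<bar> * hnorm (H d) (\<xi> (Suc d) \<one>\<^bsub>G\<^esub> v)"
          using complex_hilbert.hnorm_ge[OF D(1) w] by (intro mult_right_mono) auto
        also have "\<dots> \<le> \<bar>C\<bar> * (C' * hnorm scalars v)"
          by (intro mult_left_mono C' v) simp
        finally show ?thesis by (simp add: mult.assoc)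
      qed
      then show ?thesis using True d by (auto simp: \<xi>'_def H'_def)
    qed
    show "Inl (\<phi> (foldr (\<lambda>i. mult G (\<tau> i)) [1..<Suc d] \<one>\<^bsub>G\<^esub>)) =
        foldr (\<lambda>i. \<xi>' i (\<tau> i)) [1..<Suc d] (Inl 1)" if \<tau>: "\<tau> \<in> {1..d} \<rightarrow> carrier G" for \<tau>
    proof -
      let ?\<tau> = "\<tau>(Suc d := \<one>\<^bsub>G\<^esub>)"
      have "?\<tau> \<in> {1..Suc d} \<rightarrow> carrier G" using \<tau> by auto
      note D(6)[OF this]
      moreover have "[1..<Suc (Suc d)] = [1..<Suc d] @ [Suc d]" by simp
      moreover have "foldr (\<lambda>i. mult G (?\<tau> i)) [1..<Suc d] \<one>\<^bsub>G\<^esub> = foldr (\<lambda>i. mult G (\<tau> i)) [1..<Suc d] \<one>\<^bsub>G\<^esub>"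
        by (rule foldr_cong) auto
      moreover have "foldr (\<lambda>i. \<xi> i (?\<tau> i)) [1..<Suc d] (\<xi> (Suc d) \<one>\<^bsub>G\<^esub> (Inl 1)) =
          foldr (\<lambda>i. \<xi>' i (\<tau> i)) [1..<Suc d] (Inl 1)"
      proof -
        have "[1..<Suc d] = [1..<d] @ [d]" using d by simp
        moreover have "foldr (\<lambda>i. \<xi> i (?\<tau> i)) [1..<d] v = foldr (\<lambda>i. \<xi>' i (\<tau> i)) [1..<d] v" for v
          by (rule foldr_cong) (auto simp: \<xi>'_def)
        ultimately show ?thesis by (simp add: \<xi>'_def)
      qed
      ultimately show ?thesis by (simp del: upt_Suc)
    qed
  qed
  then show "\<phi> \<in> multiplier_space d G" by (rule multiplier_spaceI[OF G \<phi>])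
qed

section \<open>Finite sums of vectors\<close>

context complex_hilbert
begin

lemma cinner_finsum_left:
  assumes "finite A" "f \<in> A \<rightarrow> carrier H" "y \<in> carrier H"
  shows "cinner H (finsum H f A) y = (\<Sum>a\<in>A. cinner H (f a) y)"
  using assms
proof (induction A)
  case (insert a A)
  then show ?case by (subst M.finsum_insert) (auto simp: cinner_add_left Pi_iff)
qed simp

lemma cinner_finsum_right:
  assumes "finite A" "f \<in> A \<rightarrow> carrier H" "y \<in> carrier H"
  shows "cinner H y (finsum H f A) = (\<Sum>a\<in>A. cinner H y (f a))"
  using assms
proof (induction A)
  case (insert a A)
  then show ?case by (subst M.finsum_insert) (auto simp: cinner_add_right Pi_iff)
qed simp

lemma hnorm_triangle:
  assumes "x \<in> carrier H" "y \<in> carrier H"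
  shows "hnorm H (x \<oplus> y) \<le> hnorm H x + hnorm H y"
proof (rule power2_le_imp_le)
  have "complex_of_real ((hnorm H (x \<oplus> y))\<^sup>2) = cinner H (x \<oplus> y) (x \<oplus> y)"
    using assms by (simp only: cinner_self M.a_closed)
  also have "\<dots> = of_real ((hnorm H x)\<^sup>2) + of_real ((hnorm H y)\<^sup>2) + (cinner H x y + cnj (cinner H x y))"
    using assms cinner_commute[of y x]
    by (simp add: cinner_add_left cinner_add_right cinner_self[OF assms(1)] cinner_self[OF assms(2)])
  finally have "(hnorm H (x \<oplus> y))\<^sup>2 = (hnorm H x)\<^sup>2 + (hnorm H y)\<^sup>2 + 2 * Re (cinner H x y)"
    by (simp add: complex_eq_iff)
  also have "\<dots> \<le> (hnorm H x)\<^sup>2 + (hnorm H y)\<^sup>2 + 2 * (hnorm H x * hnorm H y)"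
    using cauchy_schwarz[OF assms] complex_Re_le_cmod[of "cinner H x y"] by linarith
  finally show "(hnorm H (x \<oplus> y))\<^sup>2 \<le> (hnorm H x + hnorm H y)\<^sup>2" by (simp add: power2_sum)
qed (simp add: hnorm_ge assms)

lemma hnorm_finsum_le:
  assumes "finite A" "f \<in> A \<rightarrow> carrier H"
  shows "hnorm H (finsum H f A) \<le> (\<Sum>a\<in>A. hnorm H (f a))"
  using assms
proof (induction A)
  case (insert a A)
  then have "hnorm H (f a \<oplus> finsum H f A) \<le> hnorm H (f a) + hnorm H (finsum H f A)"
    by (intro hnorm_triangle) auto
  then show ?case using insert by (subst M.finsum_insert) auto
qed simp

end

lemma linear_operators_finsum:
  assumes E: "complex_hilbert E" and F: "complex_hilbert F" and T: "T \<in> linear_operators E F"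
    and A: "finite A" and f: "f \<in> A \<rightarrow> carrier E"
  shows "T (finsum E f A) = finsum F (\<lambda>a. T (f a)) A"
proof -
  interpret E: complex_hilbert E by fact
  interpret F: complex_hilbert F by fact
  have Tc: "T v \<in> carrier F" if "v \<in> carrier E" for v using T that by (auto simp: linear_operators_def)
  show ?thesis
    using A f
  proof (induction A)
    case empty
    have "T (0 \<odot>\<^bsub>E\<^esub> \<zero>\<^bsub>E\<^esub>) = 0 \<odot>\<^bsub>F\<^esub> T \<zero>\<^bsub>E\<^esub>"
      using T E.M.zero_closed unfolding linear_operators_def by blast
    then show ?case using E.smult_l_null[of "\<zero>\<^bsub>E\<^esub>"] F.smult_l_null[of "T \<zero>\<^bsub>E\<^esub>"] Tc by simp
  next
    case (insert a A)
    have "T (f a \<oplus>\<^bsub>E\<^esub> finsum E f A) = T (f a) \<oplus>\<^bsub>F\<^esub> T (finsum E f A)"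
      using T insert.prems by (auto simp: linear_operators_def)
    then show ?case using insert Tc by (simp add: Pi_iff)
  qed
qed

lemma finsum_scalars:
  assumes "finite A"
  shows "finsum (scalars :: (complex + 'h) hilbert) (\<lambda>a. Inl (f a)) A = Inl (\<Sum>a\<in>A. f a)"
proof -
  interpret complex_hilbert "scalars :: (complex + 'h) hilbert" by (rule complex_hilbert_scalars)
  have c: "Inl z \<in> carrier (scalars :: (complex + 'h) hilbert)" for z by (simp add: scalars_def)
  show ?thesis
    using assms
  proof (induction A)
    case empty
    show ?case by simp (simp add: scalars_def)
  next
    case (insert a A)
    then have "finsum (scalars :: (complex + 'h) hilbert) (\<lambda>a. Inl (f a)) (insert a A) = Inl (f a) \<oplus>\<^bsub>scalars\<^esub> Inl (\<Sum>a\<in>A. f a)"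
      using c by simp
    then show ?case using insert by (simp add: scalars_def)
  qed
qed

section \<open>Fourier matrices and the lower bound\<close>

definition fourier :: "nat \<Rightarrow> nat \<Rightarrow> nat \<Rightarrow> complex" where
  "fourier n r l = cis (2 * pi * real l / real n) ^ r"

lemma norm_fourier [simp]: "cmod (fourier n r l) = 1"
  by (simp add: fourier_def norm_power)

lemma fourier_orthogonal:
  assumes "l < n" "l' < n"
  shows "(\<Sum>r<n. cnj (fourier n r l) * fourier n r l') = (if l = l' then of_nat n else 0)"
proof -
  let ?\<omega> = "\<lambda>l. cis (2 * pi * real l / real n)"
  let ?z = "cnj (?\<omega> l) * ?\<omega> l'"
  have bij: "bij_betw ?\<omega> {..<n} {z. z ^ n = 1}"
    using assms by (intro bij_betw_roots_unity) auto
  have unit: "cnj (?\<omega> l) * ?\<omega> l = 1" by (simp add: cis_cnj cis_mult)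
  have "(\<Sum>r<n. cnj (fourier n r l) * fourier n r l') = (\<Sum>r<n. ?z ^ r)"
    by (simp add: fourier_def power_mult_distrib)
  also have "\<dots> = (if l = l' then of_nat n else 0)"
  proof (cases "l = l'")
    case True
    then show ?thesis using unit by simp
  next
    case False
    have "?z \<noteq> 1"
    proof
      assume z: "?z = 1"
      have "?\<omega> l' = (cnj (?\<omega> l) * ?\<omega> l) * ?\<omega> l'" by (simp only: unit mult_1)
      also have "\<dots> = ?\<omega> l * ?z" by (simp only: ac_simps)
      also have "\<dots> = ?\<omega> l" by (simp only: z mult_1_right)
      finally have "?\<omega> l' = ?\<omega> l" .
      then show False using bij assms False by (auto simp: bij_betw_def inj_on_def)
    qed
    moreover have "?\<omega> l ^ n = 1" "?\<omega> l' ^ n = 1"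
      using bij assms by (auto simp: bij_betw_def)
    then have "?z ^ n = 1" by (simp add: power_mult_distrib flip: complex_cnj_power)
    ultimately show ?thesis using False by (simp add: geometric_sum)
  qed
  finally show ?thesis .
qed

text \<open>Orthogonality with vector coefficients: the conjugate matrix acts on
  \<open>n\<close>-tuples of vectors as \<open>sqrt n\<close> times an isometry.\<close>

lemma (in complex_hilbert) fourier_parseval:
  assumes u: "\<And>l. l < n \<Longrightarrow> u l \<in> carrier H"
  shows "(\<Sum>r<n. (hnorm H (finsum H (\<lambda>l. cnj (fourier n r l) \<odot> u l) {..<n}))\<^sup>2) =
    real n * (\<Sum>l<n. (hnorm H (u l))\<^sup>2)"
proof -
  let ?w = "\<lambda>r. finsum H (\<lambda>l. cnj (fourier n r l) \<odot> u l) {..<n}"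
  have w: "?w r \<in> carrier H" for r using u by (intro M.finsum_closed) auto
  have "complex_of_real (\<Sum>r<n. (hnorm H (?w r))\<^sup>2) = (\<Sum>r<n. cinner H (?w r) (?w r))"
    by (simp only: of_real_sum cinner_self[OF w])
  also have "\<dots> = (\<Sum>r<n. \<Sum>l<n. \<Sum>l'<n. cnj (fourier n r l) * fourier n r l' * cinner H (u l) (u l'))"
  proof (rule sum.cong[OF refl])
    fix r
    have "cinner H (?w r) (?w r) = (\<Sum>l<n. cinner H (cnj (fourier n r l) \<odot> u l) (?w r))"
      using u w by (intro cinner_finsum_left) auto
    also have "\<dots> = (\<Sum>l<n. \<Sum>l'<n. cinner H (cnj (fourier n r l) \<odot> u l) (cnj (fourier n r l') \<odot> u l'))"
      using u by (intro sum.cong refl cinner_finsum_right) auto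
    also have "\<dots> = (\<Sum>l<n. \<Sum>l'<n. cnj (fourier n r l) * fourier n r l' * cinner H (u l) (u l'))"
      using u by (intro sum.cong refl) (simp add: cinner_smult_left cinner_smult_right)
    finally show "cinner H (?w r) (?w r) = \<dots>" .
  qed
  also have "\<dots> = (\<Sum>l<n. \<Sum>l'<n. (\<Sum>r<n. cnj (fourier n r l) * fourier n r l') * cinner H (u l) (u l'))"
    by (subst sum.swap, rule sum.cong[OF refl], subst sum.swap) (simp add: sum_distrib_right)
  also have "\<dots> = (\<Sum>l<n. \<Sum>l'<n. (if l = l' then of_nat n * cinner H (u l) (u l') else 0))"
    by (intro sum.cong refl) (simp add: fourier_orthogonal)
  also have "\<dots> = (\<Sum>l<n. of_nat n * of_real ((hnorm H (u l))\<^sup>2))"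
    using u by (intro sum.cong refl) (simp add: cinner_self del: of_real_power)
  also have "\<dots> = complex_of_real (real n * (\<Sum>l<n. (hnorm H (u l))\<^sup>2))"
    by (simp add: sum_distrib_left)
  finally show ?thesis by (simp only: of_real_eq_iff)
qed

lemma foldr_linear_operators:
  assumes "i \<ge> 1" "\<And>j. j \<in> {1..<i} \<Longrightarrow> T j \<in> linear_operators (H j) (H (j - 1))"
  shows "foldr T [1..<i] \<in> linear_operators (H (i - 1)) (H 0)"
  using assms
proof (induction i rule: dec_induct)
  case base
  then show ?case by (auto simp: linear_operators_def id_def)
next
  case (step i)
  have "foldr T [1..<i] \<circ> T i \<in> linear_operators (H i) (H 0)"
    using step by (intro linear_operators_comp[of _ _ "H (i - 1)"]) auto
  moreover have "foldr T [1..<Suc i] = foldr T [1..<i] \<circ> T i" using step(1) by auto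
  ultimately show ?case by (simp only: diff_Suc_1)
qed

text \<open>The vectors \<open>u\<close> in the proof are the tails of the factorization summed, from the right, against
  the conjugate Fourier matrices; the value of a prefix at such a vector loses all its phases.\<close>

lemma chain_lower_bound:
  fixes H :: "nat \<Rightarrow> (complex + 'h) hilbert"
  assumes hil: "\<And>i. i \<le> D \<Longrightarrow> complex_hilbert (H i)" and ends: "H 0 = scalars" "H D = scalars"
    and D: "D \<ge> 1" and n: "n \<ge> 1"
    and lin: "\<And>i l r. i \<in> {1..D} \<Longrightarrow> l < n \<Longrightarrow> r < n \<Longrightarrow>
      \<eta> i l r \<in> linear_operators (H i) (H (i - 1))"
    and bd: "\<And>i l r v. i \<in> {1..D} \<Longrightarrow> l < n \<Longrightarrow> r < n \<Longrightarrow> v \<in> carrier (H i) \<Longrightarrow>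
      hnorm (H (i - 1)) (\<eta> i l r v) \<le> C * hnorm (H i) v"
    and C: "C \<ge> 0"
    and val: "\<And>l r. (\<And>i. l i < n) \<Longrightarrow> (\<And>i. r i < n) \<Longrightarrow>
      foldr (\<lambda>i. \<eta> i (l i) (r i)) [1..<Suc D] (Inl 1) =
      Inl (c * (\<Prod>i\<in>{1..<D}. fourier n (r i) (l (Suc i))))"
  shows "cmod c * sqrt (real n) ^ (D - 1) \<le> C ^ D"
proof -
  \<comment> \<open>The cost of one backward step: \<open>C\<close> for the operator and three
    factors \<open>sqrt n\<close>, from Cauchy-Schwarz over \<open>r\<close>, from Parseval and from
    the number of vectors \<open>u l\<close>. The value gains \<open>n^2\<close> in the same step,
    so each link yields a surplus of \<open>sqrt n\<close>.\<close>
  define K where "K = C * (real n * sqrt (real n))"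
  have K: "K \<ge> 0" using C by (simp add: K_def)
  \<comment> \<open>\<open>u l0\<close> replaces the tail from position \<open>i\<close> on. Its
    left index \<open>l0\<close> stays free because it is still linked to the right index at
    position \<open>i - 1\<close>.\<close>
  define Q where "Q i u \<longleftrightarrow> (\<forall>l<n. u l \<in> carrier (H (i - 1)) \<and> hnorm (H (i - 1)) (u l) \<le> C * K ^ (D - i)) \<and>
     (\<forall>l r l0. (\<forall>j. l j < n \<and> r j < n) \<longrightarrow> l0 < n \<longrightarrow>
        foldr (\<lambda>j. \<eta> j (l j) (r j)) [1..<i] (u l0) =
        Inl (of_nat n ^ (2 * (D - i)) * c * (\<Prod>j\<in>{1..<i}. fourier n (r j) ((l(i := l0)) (Suc j)))))"
    for i u
  have "\<exists>u. Q 1 u"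
    using D
  proof (induction rule: inc_induct)
    case base
    have one: "Inl 1 \<in> carrier (H D)" "hnorm (H D) (Inl 1) = 1"
      by (simp add: ends scalars_def) (simp add: ends hnorm_scalars)
    have upt: "[1..<Suc D] = [1..<D] @ [D]" using D by simp
    \<comment> \<open>The right index of the last letter enters no link and is set to 0.\<close>
    have "Q D (\<lambda>l. \<eta> D l 0 (Inl 1))"
      unfolding Q_def
    proof (intro conjI allI impI)
      fix l assume l: "l < n"
      have "\<eta> D l 0 \<in> linear_operators (H D) (H (D - 1))" using D l n by (intro lin) auto
      then show "\<eta> D l 0 (Inl 1) \<in> carrier (H (D - 1))" using one by (auto simp: linear_operators_def)
      show "hnorm (H (D - 1)) (\<eta> D l 0 (Inl 1)) \<le> C * K ^ (D - D)"
        using bd[of D l 0 "Inl 1"] one D l n by simp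
    next
      fix l r :: "nat \<Rightarrow> nat" and l0 assume lr: "\<forall>j. l j < n \<and> r j < n" and l0: "l0 < n"
      let ?l = "l(D := l0)" and ?r = "r(D := 0 :: nat)"
      have "foldr (\<lambda>j. \<eta> j (?l j) (?r j)) [1..<Suc D] (Inl 1) =
          Inl (c * (\<Prod>i\<in>{1..<D}. fourier n (?r i) (?l (Suc i))))"
        using lr l0 n by (intro val) auto
      moreover have "foldr (\<lambda>j. \<eta> j (?l j) (?r j)) [1..<D] v = foldr (\<lambda>j. \<eta> j (l j) (r j)) [1..<D] v" for v
        by (rule foldr_cong) auto
      moreover have "(\<Prod>i\<in>{1..<D}. fourier n (?r i) (?l (Suc i))) = (\<Prod>i\<in>{1..<D}. fourier n (r i) (?l (Suc i)))"
        by (rule prod.cong) auto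
      ultimately show "foldr (\<lambda>j. \<eta> j (l j) (r j)) [1..<D] (\<eta> D l0 0 (Inl 1)) =
        Inl (of_nat n ^ (2 * (D - D)) * c * (\<Prod>j\<in>{1..<D}. fourier n (r j) (?l (Suc j))))"
        unfolding upt by simp
    qed
    then show ?case by blast
  next
    case (step i)
    then obtain u where u: "Q (Suc i) u" by blast
    have i: "i \<in> {1..D}" "i < D" "i - 1 \<le> D" using step by auto
    interpret E: complex_hilbert "H i" using hil i by simp
    interpret F: complex_hilbert "H (i - 1)" using hil i by simp
    define U where "U = C * K ^ (D - Suc i)"
    have U: "U \<ge> 0" using C K by (simp add: U_def)
    have uc: "u l \<in> carrier (H i)" and un: "hnorm (H i) (u l) \<le> U" if "l < n" for l
      using u that by (simp_all add: Q_def U_def)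
    have uval: "foldr (\<lambda>j. \<eta> j (l j) (r j)) [1..<Suc i] (u l0) =
        Inl (of_nat n ^ (2 * (D - Suc i)) * c * (\<Prod>j\<in>{1..<Suc i}. fourier n (r j) ((l(Suc i := l0)) (Suc j))))"
      if "\<forall>j. l j < n \<and> r j < n" "l0 < n" for l r l0
      using u that unfolding Q_def by blast
    \<comment> \<open>The conjugate entries cancel the phase of the link at \<open>i\<close>, so the
      sums over \<open>l\<close> and then \<open>r\<close> add equal terms.\<close>
    define w where "w r = finsum (H i) (\<lambda>l. cnj (fourier n r l) \<odot>\<^bsub>H i\<^esub> u l) {..<n}" for r
    have wc: "w r \<in> carrier (H i)" for r
      unfolding w_def using uc by (intro E.M.finsum_closed) auto
    have wn: "(\<Sum>r<n. hnorm (H i) (w r)) \<le> real n * (sqrt (real n) * U)"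
    proof (rule power2_le_imp_le)
      have "(\<Sum>r<n. hnorm (H i) (w r))\<^sup>2 \<le> (\<Sum>r<n. (hnorm (H i) (w r))\<^sup>2) * real (card {..<n})"
        by (rule sum_squared_le_sum_of_squares)
      also have "\<dots> = real n * (\<Sum>l<n. (hnorm (H i) (u l))\<^sup>2) * real n"
        unfolding w_def using uc by (subst E.fourier_parseval) auto
      also have "\<dots> \<le> real n * (\<Sum>l<n. U\<^sup>2) * real n"
        using un uc E.hnorm_ge by (intro mult_right_mono mult_left_mono sum_mono power_mono) auto
      also have "\<dots> = (real n * (sqrt (real n) * U))\<^sup>2"
        by (simp add: power_mult_distrib) (simp add: power2_eq_square)
      finally show "(\<Sum>r<n. hnorm (H i) (w r))\<^sup>2 \<le> (real n * (sqrt (real n) * U))\<^sup>2" .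
    qed (use U in simp)
    define u' where "u' l = finsum (H (i - 1)) (\<lambda>r. \<eta> i l r (w r)) {..<n}" for l
    have \<eta>w: "\<eta> i l r (w r) \<in> carrier (H (i - 1))" if "l < n" "r < n" for l r
      using lin[OF i(1) that] wc by (auto simp: linear_operators_def)
    have "Q i u'"
      unfolding Q_def
    proof (intro conjI allI impI)
      fix l assume l: "l < n"
      show "u' l \<in> carrier (H (i - 1))" unfolding u'_def using \<eta>w l by (intro F.M.finsum_closed) auto
      have "hnorm (H (i - 1)) (u' l) \<le> (\<Sum>r<n. hnorm (H (i - 1)) (\<eta> i l r (w r)))"
        unfolding u'_def using \<eta>w l by (intro F.hnorm_finsum_le) auto
      also have "\<dots> \<le> (\<Sum>r<n. C * hnorm (H i) (w r))"
        using bd[OF i(1) l _ wc] by (intro sum_mono) auto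
      also have "\<dots> \<le> C * (real n * (sqrt (real n) * U))"
        unfolding sum_distrib_left[symmetric] by (rule mult_left_mono[OF wn C])
      also have "\<dots> = C * K ^ (D - i)"
        using i by (simp add: U_def K_def flip: Suc_diff_Suc)
      finally show "hnorm (H (i - 1)) (u' l) \<le> C * K ^ (D - i)" .
    next
      fix l r :: "nat \<Rightarrow> nat" and l0 assume lr: "\<forall>j. l j < n \<and> r j < n" and l0: "l0 < n"
      define pre where "pre = foldr (\<lambda>j. \<eta> j (l j) (r j)) [1..<i]"
      let ?l = "l(i := l0)"
      let ?P = "\<Prod>j\<in>{1..<i}. fourier n (r j) (?l (Suc j))"
      let ?c = "of_nat n ^ (2 * (D - Suc i)) * c"
      have pre: "pre \<in> linear_operators (H (i - 1)) scalars"
        unfolding pre_def ends(1)[symmetric]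
        using i lr by (intro foldr_linear_operators lin) auto
      have step: "(pre \<circ> \<eta> i l0 r0) (u l') = Inl (?c * (?P * fourier n r0 l'))"
        if "r0 < n" "l' < n" for r0 l'
      proof -
        have "foldr (\<lambda>j. \<eta> j (?l j) ((r(i := r0)) j)) [1..<Suc i] (u l') =
            Inl (?c * (\<Prod>j\<in>{1..<Suc i}. fourier n ((r(i := r0)) j) ((?l(Suc i := l')) (Suc j))))"
          using lr l0 that by (intro uval) auto
        moreover have "[1..<Suc i] = [1..<i] @ [i]" using i by simp
        moreover have "foldr (\<lambda>j. \<eta> j (?l j) ((r(i := r0)) j)) [1..<i] v = pre v" for v
          unfolding pre_def by (rule foldr_cong) auto
        moreover have "(\<Prod>j\<in>{1..<Suc i}. fourier n ((r(i := r0)) j) ((?l(Suc i := l')) (Suc j))) =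
            ?P * fourier n r0 l'"
        proof -
          have "(\<Prod>j\<in>{1..<i}. fourier n ((r(i := r0)) j) ((?l(Suc i := l')) (Suc j))) = ?P"
            by (rule prod.cong) auto
          moreover have "{1..<Suc i} = insert i {1..<i}" using i by auto
          ultimately show ?thesis by (simp add: mult.commute)
        qed
        ultimately show ?thesis by simp
      qed
      have comp: "pre \<circ> \<eta> i l0 r0 \<in> linear_operators (H i) scalars" if "r0 < n" for r0
        by (rule linear_operators_comp[OF lin[OF i(1) l0 that] pre])
      have inl: "Inl z \<in> carrier (scalars :: (complex + 'h) hilbert)" for z by (simp add: scalars_def)
      interpret S: complex_hilbert "scalars :: (complex + 'h) hilbert" by (rule complex_hilbert_scalars)
      have inner: "(pre \<circ> \<eta> i l0 r0) (w r0) = Inl (of_nat n * (?c * ?P))" if r0: "r0 < n" for r0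
      proof -
        have "(pre \<circ> \<eta> i l0 r0) (w r0) =
            finsum scalars (\<lambda>l'. (pre \<circ> \<eta> i l0 r0) (cnj (fourier n r0 l') \<odot>\<^bsub>H i\<^esub> u l')) {..<n}"
          unfolding w_def using uc
          by (intro linear_operators_finsum[OF E.complex_hilbert_axioms complex_hilbert_scalars comp[OF r0]]) auto
        also have "\<dots> = finsum scalars (\<lambda>l'. Inl (?c * ?P)) {..<n}"
        proof (rule S.M.finsum_cong'[OF refl])
          fix l' assume l': "l' \<in> {..<n}"
          have "(pre \<circ> \<eta> i l0 r0) (cnj (fourier n r0 l') \<odot>\<^bsub>H i\<^esub> u l') =
              cnj (fourier n r0 l') \<odot>\<^bsub>scalars\<^esub> (pre \<circ> \<eta> i l0 r0) (u l')"
            using comp[OF r0] uc l' unfolding linear_operators_def by blast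
          also have "\<dots> = Inl (cnj (fourier n r0 l') * (?c * (?P * fourier n r0 l')))"
            using step[OF r0] l' by (simp add: scalars_def)
          also have "\<dots> = Inl ((fourier n r0 l' * cnj (fourier n r0 l')) * (?c * ?P))"
            by (simp only: ac_simps)
          also have "fourier n r0 l' * cnj (fourier n r0 l') = 1"
            by (simp add: complex_norm_square[symmetric])
          finally show "(pre \<circ> \<eta> i l0 r0) (cnj (fourier n r0 l') \<odot>\<^bsub>H i\<^esub> u l') = Inl (?c * ?P)"
            by (simp only: mult_1)
        qed (use inl in auto)
        also have "\<dots> = Inl (of_nat n * (?c * ?P))"
          by (subst finsum_scalars) simp_all
        finally show ?thesis .
      qed
      have "pre (u' l0) = finsum scalars (\<lambda>r0. (pre \<circ> \<eta> i l0 r0) (w r0)) {..<n}"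
        unfolding u'_def comp_def using \<eta>w l0
        by (intro linear_operators_finsum[OF F.complex_hilbert_axioms complex_hilbert_scalars pre]) auto
      also have "\<dots> = finsum scalars (\<lambda>r0. Inl (of_nat n * (?c * ?P))) {..<n}"
        by (rule S.M.finsum_cong'[OF refl]) (use inl inner in auto)
      also have "\<dots> = Inl (of_nat n * (of_nat n * (?c * ?P)))"
        by (subst finsum_scalars) simp_all
      also have "of_nat n * (of_nat n * (?c * ?P)) = of_nat n ^ (2 * (D - i)) * c * ?P"
        using i by (simp add: Suc_diff_Suc[symmetric] del: Suc_diff_Suc)
      finally show "foldr (\<lambda>j. \<eta> j (l j) (r j)) [1..<i] (u' l0) =
          Inl (of_nat n ^ (2 * (D - i)) * c * ?P)"
        by (simp only: pre_def)
    qed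
    then show ?case by blast
  qed
  then obtain u where u: "Q 1 u" by blast
  have "hnorm scalars (u 0) \<le> C * K ^ (D - 1)" "u 0 = Inl (of_nat n ^ (2 * (D - 1)) * c)"
    using u n by (auto simp: Q_def ends dest!: spec[of _ 0] spec[of _ "\<lambda>_. 0"])
  then have "real n ^ (2 * (D - 1)) * cmod c \<le> C * K ^ (D - 1)"
    by (simp add: hnorm_scalars norm_mult norm_power)
  also have "\<dots> = C ^ D * (sqrt (real n) ^ (D - 1) * real n ^ (D - 1))"
    using D by (cases D) (simp_all add: K_def power_mult_distrib)
  \<comment> \<open>Rearranged to exhibit the common factor \<open>n^(3(D-1)/2)\<close>, which is
    then cancelled.\<close>
  finally have "(real n ^ (D - 1) * sqrt (real n) ^ (D - 1)) * (cmod c * sqrt (real n) ^ (D - 1)) \<le>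
      (real n ^ (D - 1) * sqrt (real n) ^ (D - 1)) * C ^ D"
  proof -
    assume *: "real n ^ (2 * (D - 1)) * cmod c \<le> C ^ D * (sqrt (real n) ^ (D - 1) * real n ^ (D - 1))"
    have "sqrt (real n) ^ (D - 1) * sqrt (real n) ^ (D - 1) = real n ^ (D - 1)"
      by (simp flip: power_mult_distrib)
    then have "(real n ^ (D - 1) * sqrt (real n) ^ (D - 1)) * (cmod c * sqrt (real n) ^ (D - 1)) =
        real n ^ (D - 1) * real n ^ (D - 1) * cmod c" by (metis (no_types) mult.assoc mult.commute)
    also have "\<dots> = real n ^ (2 * (D - 1)) * cmod c" by (simp add: mult_2 power_add)
    finally show ?thesis using * by (simp only: ac_simps)
  qed
  then show ?thesis using n by (subst (asm) mult_le_cancel_left_pos) auto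
qed

section \<open>The separating multiplier\<close>

type_synonym letter = "nat \<times> nat \<times> nat"

fun label :: "letter \<Rightarrow> nat \<times> nat" where
  "label (n, l, r) = (n, r)"

text \<open>The condition \<open>r \<le> n\<close> leaves only \<open>n + 1\<close> labels that can
  precede a given letter; the column estimate rests on this count.\<close>

fun link :: "(nat \<times> nat) option \<Rightarrow> letter \<Rightarrow> complex" where
  "link None t = 1"
| "link (Some (n, r)) (n', l, r') = (if n = n' \<and> r \<le> n then fourier (Suc n) r l else 0)"

primrec amp :: "(nat \<times> nat) option \<Rightarrow> letter list \<Rightarrow> complex" where
  "amp lab [] = 1"
| "amp lab (t # z) = link lab t * amp (Some (label t)) z"

text \<open>The common first component of the letters, which fixes the matrix size. For
  \<open>None\<close> and the empty word it is arbitrary; in valid states it then occurs only with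
  exponent 0.\<close>

definition block :: "(nat \<times> nat) option \<Rightarrow> letter list \<Rightarrow> nat" where
  "block lab z = (case lab of Some (n, r) \<Rightarrow> n | None \<Rightarrow> fst (hd z))"

definition src :: "(nat \<times> nat) option \<Rightarrow> nat \<Rightarrow> letter list \<Rightarrow> (nat \<times> nat) option" where
  "src lab m v = (if v = [] then lab else if m = 0 then None else Some (label (last v)))"

lemma cmod_link: "cmod (link lab t) \<le> 1"
  by (cases lab; cases t) auto

lemma cmod_amp: "cmod (amp lab z) \<le> 1"
proof (induction z arbitrary: lab)
  case (Cons t z)
  show ?case using mult_mono[OF cmod_link[of lab t] Cons[of "Some (label t)"]] by (simp add: norm_mult)
qed simp

lemma amp_append: "amp lab (v @ z) = amp lab v * amp (src lab (length z) v) z"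
proof (induction v arbitrary: lab)
  case Nil
  then show ?case by (simp add: src_def)
next
  case (Cons t v)
  then show ?case by (cases v; cases z) (auto simp: src_def)
qed

text \<open>A nonzero amplitude forces equal first components at every link.\<close>

lemma fst_last_eq_block:
  assumes "v \<noteq> []" "amp lab v \<noteq> 0"
  shows "fst (last v) = block lab v"
  using assms
proof (induction v arbitrary: lab)
  case (Cons t v)
  have t: "fst t = block lab (t # v)"
    using Cons.prems by (cases lab; cases t) (auto simp: block_def split: if_splits)
  show ?case
  proof (cases v)
    case (Cons t' v')
    then have "fst (last v) = block (Some (label t)) v"
      using Cons.prems \<open>amp lab (t # v) \<noteq> 0\<close> by (intro Cons.IH) auto
    moreover have "block (Some (label t)) v = fst t" by (cases t) (simp add: block_def)
    ultimately show ?thesis using t Cons by simp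
  qed (use t in simp)
qed simp

definition wt :: "nat \<Rightarrow> nat \<Rightarrow> real" where
  "wt n k = 1 / sqrt (real (Suc n)) ^ k"

lemma wt_add: "wt n (j + k) = wt n j * wt n k"
  by (simp add: wt_def power_add)

lemma wt_bounds: "0 \<le> wt n k" "wt n k \<le> 1"
  by (simp_all add: wt_def one_le_power)

lemma wt_square: "k > 0 \<Longrightarrow> (wt n k)\<^sup>2 \<le> 1 / real (Suc n)"
proof -
  assume "k > 0"
  then have "wt n k = wt n 1 * wt n (k - 1)" by (simp flip: wt_add)
  then have "wt n k \<le> wt n 1" using wt_bounds[of n 1] wt_bounds[of n "k - 1"] by (simp add: mult_left_le)
  then have "(wt n k)\<^sup>2 \<le> (wt n 1)\<^sup>2" by (intro power_mono wt_bounds)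
  then show ?thesis by (simp add: wt_def power_divide)
qed

lemma card_length_le:
  assumes "\<And>k. finite {v. length v = k \<and> Q v}" "\<And>k. card {v. length v = k \<and> Q v} \<le> c"
  shows "finite {v. length v \<le> m \<and> Q v}" "card {v. length v \<le> m \<and> Q v} \<le> c * Suc m"
proof -
  have eq: "{v. length v \<le> m \<and> Q v} = (\<Union>k\<le>m. {v. length v = k \<and> Q v})" by auto
  show "finite {v. length v \<le> m \<and> Q v}" unfolding eq using assms(1) by blast
  have "card {v. length v \<le> m \<and> Q v} \<le> (\<Sum>k\<le>m. card {v. length v = k \<and> Q v})"
    unfolding eq by (rule card_UN_le) simp
  also have "\<dots> \<le> (\<Sum>k\<le>m. c)" by (intro sum_mono assms(2))
  finally show "card {v. length v \<le> m \<and> Q v} \<le> c * Suc m" by (simp add: mult.commute)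
qed

section \<open>States and transfer operators\<close>

text \<open>In a state \<open>(y, m, lab)\<close> the last \<open>m\<close> letters \<open>z\<close> of the final word have been crossed, \<open>y\<close> is the
  product read so far times the inverse of \<open>val z\<close>, and \<open>lab\<close> is the label to which the letter
  preceding \<open>z\<close> has to be linked (\<^const>\<open>None\<close> if no link is left open).\<close>

type_synonym 'g state = "'g \<times> nat \<times> (nat \<times> nat) option"

locale link_multiplier = ping_pong G x A B
  for G :: "('g, 'm) monoid_scheme" (structure) and x :: "letter \<Rightarrow> 'g" and A B +
  fixes d :: nat
  assumes d: "d \<ge> 2"
begin

text \<open>Exponents of \<open>N\<^sup>-\<^sup>1\<^sup>/\<^sup>2\<close> in the amplitude of a state after \<open>d - i\<close> of the \<open>d\<close> factors: one per factor
  as long as a link is open.  The size \<open>N\<close> is unknown while \<open>m = 0\<close>, so factors passed before the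
  first and after the last crossing are accounted for at these crossings.\<close>

definition expo :: "nat \<Rightarrow> nat \<Rightarrow> nat" where
  "expo i m = (if m = 0 then 0 else if m = Suc d then d - 1 else d - i)"

text \<open>For \<open>m = 0\<close> there is no letter yet to be linked, for
  \<open>m = Suc d\<close> none precedes; in between a link is always open.\<close>

definition valid :: "nat \<Rightarrow> (nat \<times> nat) option \<Rightarrow> bool" where
  "valid m lab \<longleftrightarrow> m \<le> Suc d \<and> (lab = None \<longleftrightarrow> m = 0 \<or> m = Suc d)"

text \<open>Words spell paths from \<open>\<one>\<close>, so the segment from \<open>\<one>\<close>
  to \<open>s\<close> is translated by \<open>inv y\<close>, which moves the start \<open>y\<close>
  of the path to \<open>\<one>\<close>.\<close>

fun moves :: "'g \<Rightarrow> 'g state \<Rightarrow> letter list set" where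
  "moves s (y, m, lab) = (if y \<in> carrier G \<and> valid m lab
     then {v. length v \<le> m \<and> crossing v (inv y) (inv y \<otimes> s) \<noteq> 0} else {})"

fun target :: "'g \<Rightarrow> 'g state \<Rightarrow> letter list \<Rightarrow> 'g state" where
  "target s (y, m, lab) v = (inv s \<otimes> y \<otimes> val v, m - length v, src lab (m - length v) v)"

text \<open>The weight is the quotient of the weights in \<open>state_vec\<close> for the two
  states. By \<open>expo_mono\<close> the subtraction does not truncate on valid states when
  \<open>i\<close> is in \<open>{1..d}\<close>.\<close>

fun coef :: "nat \<Rightarrow> 'g \<Rightarrow> 'g state \<Rightarrow> letter list \<Rightarrow> complex" where
  "coef i s (y, m, lab) v = of_int (crossing v (inv y) (inv y \<otimes> s)) *
     of_real (wt (block lab v) (expo (i - 1) m - expo i (m - length v))) * amp lab v"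

definition step :: "nat \<Rightarrow> 'g \<Rightarrow> ('g state \<Rightarrow> complex) \<Rightarrow> 'g state \<Rightarrow> complex" where
  "step i s f w = (\<Sum>v\<in>moves s w. coef i s w v * f (target s w v))"

text \<open>The sum has at most one term, since words of equal length are determined by their value.\<close>

fun state_vec :: "nat \<Rightarrow> 'g \<Rightarrow> 'g state \<Rightarrow> complex" where
  "state_vec i g (y, m, lab) = (if y \<in> carrier G \<and> valid m lab then
     \<Sum>z | length z = m \<and> val z = inv y \<otimes> g. of_int (crossing z (inv y) (inv y \<otimes> g)) *
       of_real (wt (block lab z) (expo i m)) * amp lab z else 0)"

lemma abs_crossing_le: "\<bar>crossing v p q\<bar> \<le> 1"
  by (cases v) auto

lemma expo_mono: "i \<in> {1..d} \<Longrightarrow> m \<le> m' \<Longrightarrow> m' \<le> Suc d \<Longrightarrow> expo i m \<le> expo (i - 1) m'"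
  using d by (auto simp: expo_def)

lemma target_inv:
  assumes "s \<in> carrier G" "y \<in> carrier G" "g \<in> carrier G"
  shows "inv (inv s \<otimes> y \<otimes> val v) = inv val v \<otimes> (inv y \<otimes> s)"
    "inv (inv s \<otimes> y \<otimes> val v) \<otimes> g = inv val v \<otimes> (inv y \<otimes> (s \<otimes> g))"
  using assms by (simp_all add: inv_mult_group m_assoc)

lemma valid_target:
  "valid m lab \<Longrightarrow> length v \<le> m \<Longrightarrow> valid (m - length v) (src lab (m - length v) v)"
  by (cases v) (auto simp: valid_def src_def)

text \<open>Words of one length are determined by their value, so \<open>z'\<close> can continue
  \<open>v\<close> only if \<open>v @ z'\<close> is \<open>z\<close> itself.\<close>

lemma val_solutions:
  assumes "length z = m" "val z = r" "length v \<le> m"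
  shows "{z'. length z' = m - length v \<and> val z' = inv val v \<otimes> r} =
    (if v = take (length v) z then {drop (length v) z} else {})"
proof -
  have r: "r \<in> carrier G" using assms(2) by auto
  have "length z' = m - length v \<and> val z' = inv val v \<otimes> r \<longleftrightarrow> v @ z' = z" for z'
  proof
    assume z': "length z' = m - length v \<and> val z' = inv val v \<otimes> r"
    then have "val (v @ z') = val z" using r assms by (simp add: val_append m_assoc[symmetric])
    then show "v @ z' = z" by (rule val_inject) (use z' assms in simp)
  next
    assume z: "v @ z' = z"
    then have "r = val v \<otimes> val z'" using assms(2) val_append[of v z'] by simp
    then show "length z' = m - length v \<and> val z' = inv val v \<otimes> r"
      using assms(1) z by (auto simp: m_assoc[symmetric])
  qed
  then show ?thesis by (auto simp: append_eq_conv_conj)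
qed

text \<open>\<open>crossing_chen\<close> in operator form. The word \<open>z\<close> is unique, only
  its prefixes contribute, and for every splitting the weights and amplitudes multiply to those of
  \<open>z\<close>; the sum of crossing counts over the splittings remains.\<close>

lemma step_state_vec:
  assumes i: "i \<in> {1..d}" and s: "s \<in> carrier G" and g: "g \<in> carrier G"
  shows "step i s (state_vec i g) = state_vec (i - 1) (s \<otimes> g)"
proof
  fix w :: "'g state"
  obtain y m lab where w: "w = (y, m, lab)" by (cases w) auto
  show "step i s (state_vec i g) w = state_vec (i - 1) (s \<otimes> g) w"
  proof (cases "y \<in> carrier G \<and> valid m lab")
    case False
    then show ?thesis by (auto simp: step_def w)
  next
    case True
    then have y: "y \<in> carrier G" and va: "valid m lab" by auto
    let ?p = "inv y" and ?q = "inv y \<otimes> s" and ?r = "inv y \<otimes> (s \<otimes> g)"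
    have pqr: "?p \<in> carrier G" "?q \<in> carrier G" "?r \<in> carrier G" using y s g by auto
    have sv: "state_vec i g (target s w v) =
       (\<Sum>z' | length z' = m - length v \<and> val z' = inv val v \<otimes> ?r.
          of_int (crossing z' (inv val v \<otimes> ?q) (inv val v \<otimes> ?r)) *
          of_real (wt (block (src lab (m - length v) v) z') (expo i (m - length v))) *
          amp (src lab (m - length v) v) z')" if "length v \<le> m" for v
      using valid_target[OF va that] s y g unfolding w target.simps state_vec.simps
      unfolding target_inv(2)[OF s y g] unfolding target_inv(1)[OF s y g] by simp
    show ?thesis
    proof (cases "\<exists>z. length z = m \<and> val z = ?r")
      case False
      have "state_vec i g (target s w v) = 0" if v: "length v \<le> m" for v
      proof -
        have none: "{z'. length z' = m - length v \<and> val z' = inv val v \<otimes> ?r} = {}"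
        proof safe
          fix z' assume z': "length z' = m - length v" "val z' = inv val v \<otimes> ?r"
          then have "length (v @ z') = m \<and> val (v @ z') = ?r"
            using v pqr(3) by (simp add: val_append m_assoc[symmetric] del: inv_mult_group)
          then show "z' \<in> {}" using False by blast
        qed
        show ?thesis unfolding sv[OF v] none by (rule sum.empty)
      qed
      then have "step i s (state_vec i g) w = 0"
        unfolding step_def by (intro sum.neutral) (auto simp: w)
      moreover have none: "{z. length z = m \<and> val z = ?r} = {}" using False by blast
      have "state_vec (i - 1) (s \<otimes> g) w = 0"
        unfolding w state_vec.simps none by simp
      ultimately show ?thesis by simp
    next
      case True
      then obtain z where z: "length z = m" "val z = ?r" by blast
      let ?W = "of_real (wt (block lab z) (expo (i - 1) m)) * amp lab z"
      let ?N = "\<lambda>k. crossing (take k z) ?p ?q *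
          crossing (drop k z) (inv val (take k z) \<otimes> ?q) (inv val (take k z) \<otimes> ?r)"
      define f where "f v = coef i s w v * state_vec i g (target s w v)" for v
      have f: "f v = (if v = take (length v) z then of_int (?N (length v)) * ?W else 0)"
        if v: "length v \<le> m" for v
      proof (cases "v = take (length v) z")
        case False
        then show ?thesis unfolding f_def sv[OF v] val_solutions[OF z v] by simp
      next
        case True
        define k where "k = length v"
        define z' where "z' = drop k z"
        have zv: "z = v @ z'" using True by (metis append_take_drop_id k_def z'_def)
        have len: "length z' = m - length v" using z by (simp add: z'_def k_def)
        have S: "{z'. length z' = m - length v \<and> val z' = inv val v \<otimes> ?r} = {z'}"
          using val_solutions[OF z v] True by (simp add: z'_def k_def)
        have amp: "amp lab z = amp lab v * amp (src lab (m - length v) v) z'"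
          unfolding zv amp_append len ..
        have wt: "wt (block lab v) (expo (i - 1) m - expo i (m - length v)) *
            wt (block (src lab (m - length v) v) z') (expo i (m - length v)) = wt (block lab z) (expo (i - 1) m)"
          if nz: "amp lab v \<noteq> 0"
        proof -
          have le: "expo i (m - length v) \<le> expo (i - 1) m"
            using va by (intro expo_mono[OF i]) (auto simp: valid_def)
          show ?thesis
          proof (cases "m - length v = 0")
            case True
            then have "z' = []" using len by simp
            then show ?thesis unfolding zv True by (simp add: expo_def wt_def)
          next
            case False
            have z'_block: "block (src lab (m - length v) v) z' = block lab z"
            proof (cases "v = []")
              case True
              then show ?thesis using zv by (simp add: src_def)
            next
              case v: False
              have "block (src lab (m - length v) v) z' = fst (last v)"
                using False v by (cases "last v") (simp add: src_def block_def)
              moreover have "block lab z = block lab v" using v unfolding zv by (simp add: block_def split: option.split)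
              ultimately show ?thesis using fst_last_eq_block[OF v nz] by simp
            qed
            show ?thesis
            proof (cases "v = [] \<and> lab = None")
              case True
              \<comment> \<open>Letters remain but no link is open, so \<open>m = Suc d\<close>. The
                exponent must vanish, since \<open>block lab v\<close> is arbitrary here.\<close>
              then have "expo (i - 1) m - expo i (m - length v) = 0"
                using va False by (auto simp: valid_def expo_def)
              then show ?thesis using True le z'_block by (simp add: wt_def)
            next
              case v: False
              have "block lab v = block lab z"
              proof (cases "v = []")
                case True
                then show ?thesis using v by (auto simp: block_def)
              next
                case False
                then show ?thesis unfolding zv by (simp add: block_def split: option.split)
              qed
              then show ?thesis using le z'_block by (simp flip: wt_add)
            qed
          qed
        qed
        have "f v = of_int (?N k) *
          (of_real (wt (block lab v) (expo (i - 1) m - expo i (m - length v)) *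
            wt (block (src lab (m - length v) v) z') (expo i (m - length v))) *
           (amp lab v * amp (src lab (m - length v) v) z'))"
          unfolding f_def sv[OF v] S using True by (simp add: w k_def z'_def)
        also have "\<dots> = of_int (?N k) * ?W"
          using wt amp by (cases "amp lab v = 0") auto
        finally show ?thesis using True by (simp add: k_def)
      qed
      have inj: "inj_on (\<lambda>k. take k z) {..m}" using z by (auto simp: inj_on_def dest: arg_cong[of _ _ length])
      have fin: "finite (moves s w)"
        using card_length_le(1)[OF crossing_row] by (simp add: w)
      have "step i s (state_vec i g) w = sum f (moves s w)" by (simp add: step_def f_def)
      \<comment> \<open>Moves and prefixes of \<open>z\<close> are compared through their
        intersection: a move that is no prefix has no continuation, and a prefix that is no move has
        crossing count 0.\<close>
      also have "\<dots> = sum f (moves s w \<inter> (\<lambda>k. take k z) ` {..m})"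
      proof (rule sum.mono_neutral_right[OF fin])
        show "\<forall>v\<in>moves s w - moves s w \<inter> (\<lambda>k. take k z) ` {..m}. f v = 0"
          using f y va by (auto simp: w)
      qed auto
      also have "\<dots> = sum f ((\<lambda>k. take k z) ` {..m})"
      proof (rule sum.mono_neutral_left)
        show "\<forall>v\<in>(\<lambda>k. take k z) ` {..m} - moves s w \<inter> (\<lambda>k. take k z) ` {..m}. f v = 0"
          using y va by (auto simp: w f_def z)
      qed auto
      also have "\<dots> = (\<Sum>k\<le>m. f (take k z))"
        using sum.reindex[OF inj, of f] by simp
      also have "\<dots> = (\<Sum>k\<le>m. of_int (?N k) * ?W)"
        by (rule sum.cong[OF refl]) (simp add: f z)
      also have "\<dots> = of_int (\<Sum>k\<le>length z. ?N k) * ?W"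
        by (simp add: z sum_distrib_right)
      also have "(\<Sum>k\<le>length z. ?N k) = crossing z ?p ?r" by (rule crossing_chen[OF pqr])
      also have "of_int (crossing z ?p ?r) * ?W = state_vec (i - 1) (s \<otimes> g) w"
      proof -
        have "{z'. length z' = m \<and> val z' = ?r} = {z}" using z val_inject by auto
        then show ?thesis using y va by (simp add: w)
      qed
      finally show ?thesis .
    qed
  qed
qed

section \<open>Uniform bounds for the transfer operators\<close>

lemma finite_moves: "finite (moves s w)"
proof (cases w)
  case (fields y m lab)
  show ?thesis
    using card_length_le(1)[OF crossing_row, of m "inv y" "inv y \<otimes> s"] by (simp add: fields)
qed

lemma card_moves: "card (moves s w) \<le> 2 * Suc (Suc d)"
proof (cases w)
  case (fields y m lab)
  have "card {v. length v \<le> m \<and> crossing v (inv y) (inv y \<otimes> s) \<noteq> 0} \<le> 2 * Suc m"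
    by (rule card_length_le(2)[OF crossing_row])
  then show ?thesis by (simp add: fields valid_def)
qed

lemma coef_le_one: "(cmod (coef i s w v))\<^sup>2 \<le> 1"
proof (cases w)
  case (fields y m lab)
  have "cmod (of_int (crossing v (inv y) (inv y \<otimes> s))) \<le> 1"
    using abs_crossing_le[of v "inv y" "inv y \<otimes> s"] by simp
  moreover have "cmod (of_real (wt n k)) \<le> 1" for n k using wt_bounds[of n k] by simp
  ultimately have "cmod (coef i s w v) \<le> 1"
    unfolding fields coef.simps norm_mult using cmod_amp[of lab v] by (intro mult_le_one) auto
  then show ?thesis by (simp add: abs_square_le_1)
qed

text \<open>While a link is open, crossing at least one letter uses up at least one unit of the
  exponent, which supplies the factor \<open>N^(-1/2)\<close>.\<close>

lemma coef_interior_le: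
  assumes "i \<in> {1..d}" "valid m (Some (n, r))" "v \<noteq> []" "length v \<le> m"
  shows "(cmod (coef i s (y, m, Some (n, r)) v))\<^sup>2 \<le>
    (if n = fst (hd v) \<and> r \<le> n then 1 / real (Suc n) else 0)"
proof -
  obtain a l b v' where v: "v = (a, l, b) # v'" using assms(3) by (cases v) auto
  show ?thesis
  proof (cases "n = fst (hd v) \<and> r \<le> n")
    case False
    then show ?thesis by (auto simp: v)
  next
    case True
    define k where "k = expo (i - 1) m - expo i (m - length v)"
    have "k > 0" using assms by (auto simp: k_def expo_def valid_def v)
    have c: "cmod (of_int (crossing v (inv y) (inv y \<otimes> s))) * cmod (amp (Some (n, r)) v) \<le> 1"
      using abs_crossing_le[of v "inv y" "inv y \<otimes> s"] cmod_amp[of "Some (n, r)" v]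
      by (intro mult_le_one) auto
    have "cmod (coef i s (y, m, Some (n, r)) v) =
        wt n k * (cmod (of_int (crossing v (inv y) (inv y \<otimes> s))) * cmod (amp (Some (n, r)) v))"
      using wt_bounds(1)[of n k] by (simp add: norm_mult block_def k_def)
    also have "\<dots> \<le> wt n k" using c wt_bounds(1)[of n k] by (intro mult_left_le)
    finally have "(cmod (coef i s (y, m, Some (n, r)) v))\<^sup>2 \<le> (wt n k)\<^sup>2" by (intro power_mono) auto
    also have "\<dots> \<le> 1 / real (Suc n)" by (rule wt_square[OF \<open>k > 0\<close>])
    finally show ?thesis using True by simp
  qed
qed

text \<open>Given \<open>v\<close> and the state reached, only the label of \<open>w\<close> can
  vary, and only when a letter is crossed with a link open. It then has \<open>N\<close> relevant
  values, each with squared entry at most \<open>1 / N\<close>: here the weight pays for a cut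
  link.\<close>

lemma coef_column_word:
  assumes i: "i \<in> {1..d}" and s: "s \<in> carrier G" and P: "finite P"
    "\<And>w. w \<in> P \<Longrightarrow> v \<in> moves s w \<and> target s w v = (y, m, lab)"
  shows "(\<Sum>w\<in>P. (cmod (coef i s w v))\<^sup>2) \<le> 1"
proof -
  define y' where "y' = s \<otimes> y \<otimes> inv val v"
  define m' where "m' = m + length v"
  have form: "\<exists>lab'. w = (y', m', lab') \<and> valid m' lab' \<and> (v = [] \<longrightarrow> lab' = lab)" if "w \<in> P" for w
  proof (cases w)
    case (fields y1 m1 lab1)
    have w: "y1 \<in> carrier G" "valid m1 lab1" "length v \<le> m1" "y = inv s \<otimes> y1 \<otimes> val v"
      "m = m1 - length v" "lab = src lab1 m v"
      using P(2)[OF that] by (auto simp: fields split: if_splits)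
    have "y1 = y'" unfolding y'_def w(4) using s w(1) by (simp add: m_assoc) (simp add: m_assoc[symmetric])
    then show ?thesis using w by (auto simp: fields m'_def src_def)
  qed
  show ?thesis
  proof (cases "v = [] \<or> m' = Suc d")
    case True
    have "w = w'" if "w \<in> P" "w' \<in> P" for w w'
      using form[OF that(1)] form[OF that(2)] True by (auto simp: valid_def)
    then have "card P \<le> 1" by (rule card_le_one_if_unique)
    then show ?thesis
      using sum_mono[of P "\<lambda>w. (cmod (coef i s w v))\<^sup>2" "\<lambda>_. 1", OF coef_le_one] by simp
  next
    case False
    define n0 where "n0 = fst (hd v)"
    define h where "h w = (case w of (_, _, Some (n, r)) \<Rightarrow> if n = n0 \<and> r \<le> n then 1 / real (Suc n) else 0
        | _ \<Rightarrow> 0)" for w :: "'g \<times> nat \<times> (nat \<times> nat) option"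
    let ?I = "(\<lambda>r. (y', m', Some (n0, r))) ` {..n0}"
    have "(\<Sum>w\<in>P. (cmod (coef i s w v))\<^sup>2) \<le> sum h P"
    proof (rule sum_mono)
      fix w assume "w \<in> P"
      then obtain lab' where w: "w = (y', m', lab')" "valid m' lab'" using form by blast
      then obtain n r where nr: "lab' = Some (n, r)" using False by (cases lab') (auto simp: valid_def m'_def)
      show "(cmod (coef i s w v))\<^sup>2 \<le> h w"
        using coef_interior_le[of i m' n r v s y'] i False w nr by (simp add: h_def n0_def m'_def)
    qed
    also have "\<dots> = sum h (P \<inter> ?I)"
    proof (rule sum.mono_neutral_right[OF P(1)])
      show "\<forall>w\<in>P - P \<inter> ?I. h w = 0"
      proof
        fix w assume w: "w \<in> P - P \<inter> ?I"
        then obtain lab' where "w = (y', m', lab')" using form by blast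
        then show "h w = 0" using w by (cases lab') (auto simp: h_def)
      qed
    qed auto
    also have "\<dots> \<le> sum h ?I"
      by (rule sum_mono2) (auto simp: h_def)
    also have "\<dots> = (\<Sum>r\<le>n0. h (y', m', Some (n0, r)))"
      by (subst sum.reindex) (auto simp: inj_on_def)
    also have "\<dots> = 1" by (simp add: h_def)
    finally show ?thesis .
  qed
qed

text \<open>\<open>y\<close> and \<open>s\<close> determine the endpoints relative to the end of
  \<open>v\<close>, so \<open>crossing_column\<close> leaves two words for each of the
  \<open>d + 2\<close> possible lengths.\<close>

lemma coef_column:
  assumes i: "i \<in> {1..d}" and s: "s \<in> carrier G" and P: "finite P"
    "P \<subseteq> {(w, v). v \<in> moves s w \<and> target s w v = w0}"
  shows "(\<Sum>(w, v)\<in>P. (cmod (coef i s w v))\<^sup>2) \<le> real (2 * Suc (Suc d))"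
proof -
  obtain y m lab where w0: "w0 = (y, m, lab)" by (cases w0) auto
  define V where "V = {v. length v \<le> Suc d \<and>
    crossing v (val v \<otimes> (inv y \<otimes> inv s)) (val v \<otimes> inv y) \<noteq> 0}"
  show ?thesis
  proof (cases "y \<in> carrier G")
    case False
    have "P = {}"
    proof (rule ccontr)
      assume "P \<noteq> {}"
      then obtain w v where "v \<in> moves s w" "target s w v = (y, m, lab)" using P w0 by fast
      then show False using False s by (cases w) (auto split: if_splits)
    qed
    then show ?thesis by simp
  next
    case y: True
    have u: "inv y \<in> carrier G" "inv y \<otimes> inv s \<in> carrier G" using y s by simp_all
    have V: "finite V" "card V \<le> 2 * Suc (Suc d)"
      unfolding V_def by (rule card_length_le[OF crossing_column[OF u]])+
    have sub: "snd ` P \<subseteq> V"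
    proof
      fix v assume "v \<in> snd ` P"
      then obtain w where "v \<in> moves s w" "target s w v = (y, m, lab)" using P w0 by fastforce
      then obtain y1 m1 lab1 where w: "y1 \<in> carrier G" "valid m1 lab1" "length v \<le> m1"
        "crossing v (inv y1) (inv y1 \<otimes> s) \<noteq> 0" "y = inv s \<otimes> y1 \<otimes> val v"
        by (cases w) (auto split: if_splits)
      have "inv y = inv val v \<otimes> (inv y1 \<otimes> s)" unfolding w(5) using s w(1) by (simp add: target_inv)
      then have "val v \<otimes> inv y = inv y1 \<otimes> s" using s w(1) by (simp add: m_assoc[symmetric])
      moreover from this have "val v \<otimes> (inv y \<otimes> inv s) = inv y1"
        using s w(1) y by (simp add: m_assoc[symmetric]) (simp add: m_assoc)
      ultimately show "v \<in> V" using w by (simp add: V_def valid_def)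
    qed
    have "(\<Sum>(w, v)\<in>P. (cmod (coef i s w v))\<^sup>2) =
        (\<Sum>v\<in>snd ` P. \<Sum>p\<in>{p \<in> P. snd p = v}. (\<lambda>(w, v). (cmod (coef i s w v))\<^sup>2) p)"
      by (rule sum.image_gen[OF P(1)])
    also have "\<dots> \<le> (\<Sum>v\<in>snd ` P. 1)"
    proof (rule sum_mono)
      fix v
      have "(\<Sum>p\<in>{p \<in> P. snd p = v}. (\<lambda>(w, v). (cmod (coef i s w v))\<^sup>2) p) =
          (\<Sum>w\<in>fst ` {p \<in> P. snd p = v}. (cmod (coef i s w v))\<^sup>2)"
        by (subst sum.reindex) (auto simp: inj_on_def intro: sum.cong)
      also have "\<dots> \<le> 1"
        by (rule coef_column_word[OF i s, of _ v y m lab]) (use P w0 in auto)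
      finally show "(\<Sum>p\<in>{p \<in> P. snd p = v}. (\<lambda>(w, v). (cmod (coef i s w v))\<^sup>2) p) \<le> 1" .
    qed
    also have "\<dots> \<le> real (card V)" using card_mono[OF V(1) sub] by simp
    also have "\<dots> \<le> real (2 * Suc (Suc d))" using V(2) by linarith
    finally show ?thesis .
  qed
qed

text \<open>\<open>2 * (d + 2)\<close> bounds both the row count and the column sum, so the norm
  bound depends neither on \<open>s\<close> nor on the matrix sizes.\<close>

lemma step_bounded:
  assumes "i \<in> {1..d}" "s \<in> carrier G" "f \<in> ell2"
  shows "step i s f \<in> ell2" "hnorm ell2_space (step i s f) \<le> real (2 * Suc (Suc d)) * hnorm ell2_space f"
proof -
  note * = ell2_schur_test[where R = "moves s" and c = "coef i s" and \<tau> = "target s",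
      OF finite_moves card_moves coef_column[OF assms(1,2)] assms(3)]
  show "step i s f \<in> ell2" using *(1) by (simp add: step_def[abs_def])
  show "hnorm ell2_space (step i s f) \<le> real (2 * Suc (Suc d)) * hnorm ell2_space f"
    using *(2) by (simp add: step_def[abs_def] real_sqrt_mult_self)
qed

lemma step_add: "step i s (\<lambda>w. f w + g w) = (\<lambda>w. step i s f w + step i s g w)"
  by (auto simp: step_def distrib_left sum.distrib)

lemma step_smult: "step i s (\<lambda>w. a * f w) = (\<lambda>w. a * step i s f w)"
  by (auto simp: step_def sum_distrib_left mult.left_commute)

section \<open>The factorization into \<open>d\<close> operators\<close>

definition space :: "nat \<Rightarrow> (complex + ('g state \<Rightarrow> complex)) hilbert" where
  "space i = (if i = 0 \<or> i = d then scalars else transport Inr ell2 ell2_space)"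

text \<open>The chain begins and ends in the scalars: operator \<open>d\<close> is preceded by the
  embedding along the start vector, and operator 1 is followed by evaluation at the final state,
  which is the case \<open>i = 0\<close> of \<open>encode\<close>.\<close>

definition decode :: "nat \<Rightarrow> complex + ('g state \<Rightarrow> complex) \<Rightarrow> 'g state \<Rightarrow> complex" where
  "decode i v = (if i = d then (\<lambda>w. projl v * state_vec d \<one> w) else projr v)"

definition encode :: "nat \<Rightarrow> ('g state \<Rightarrow> complex) \<Rightarrow> complex + ('g state \<Rightarrow> complex)" where
  "encode i f = (if i = 0 then Inl (f (\<one>, Suc d, None)) else Inr f)"

definition multiplier :: "'g \<Rightarrow> complex" where
  "multiplier w = (if w \<in> carrier G then state_vec 0 w (\<one>, Suc d, None) else undefined)"

text \<open>A constant path crosses no edge, so only the empty word survives.\<close>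

lemma state_vec_start: "state_vec d \<one> w = (if w = (\<one>, 0, None) then 1 else 0)"
proof -
  obtain y m lab where w: "w = (y, m, lab)" by (cases w) auto
  show ?thesis
  proof (cases "y \<in> carrier G \<and> valid m lab")
    case False
    then show ?thesis by (auto simp: w valid_def)
  next
    case True
    let ?S = "{z. length z = m \<and> val z = inv y}"
    have eq: "state_vec d \<one> w = (\<Sum>z\<in>?S. if z = [] then 1 else 0)"
      using True unfolding w state_vec.simps
      by (auto simp: crossing_same expo_def wt_def intro!: sum.cong)
    show ?thesis
    proof (cases "m = 0 \<and> y = \<one>")
      case m: True
      then have "?S = {[]}" by auto
      then show ?thesis using m True unfolding eq by (simp add: w valid_def)
    next
      case False
      have "[] \<notin> ?S"
      proof
        assume "[] \<in> ?S"
        then have m: "m = 0" and "inv y = \<one>" by auto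
        then have "inv (inv y) = \<one>" by simp
        then show False using True False m by simp
      qed
      then have "(\<Sum>z\<in>?S. if z = [] then 1 else 0) = (0 :: complex)" by (intro sum.neutral) auto
      then show ?thesis using False unfolding eq by (auto simp: w)
    qed
  qed
qed

lemma state_vec_start_ell2: "state_vec d \<one> \<in> ell2"
proof (rule ell2_bounded_sums(1))
  fix F :: "'g state set" assume F: "finite F"
  have "(\<Sum>w\<in>F. (cmod (state_vec d \<one> w))\<^sup>2) = (\<Sum>w\<in>F. if w = (\<one>, 0, None) then 1 else 0)"
    by (rule sum.cong) (auto simp: state_vec_start)
  also have "\<dots> \<le> 1" using F by simp
  finally show "(\<Sum>w\<in>F. (cmod (state_vec d \<one> w))\<^sup>2) \<le> 1" .
qed

lemma inj_Inr: "inj_on (Inr :: ('g state \<Rightarrow> complex) \<Rightarrow> complex + ('g state \<Rightarrow> complex)) ell2"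
  by simp

lemma closed_subspace_ell2: "complex_hilbert.closed_subspace (ell2_space :: ('g state \<Rightarrow> complex) hilbert) ell2"
  using complex_hilbert.closed_subspace_carrier[OF complex_hilbert_ell2] by simp

lemma complex_hilbert_space: "complex_hilbert (space i)"
  unfolding space_def
  using complex_hilbert_transport[OF complex_hilbert_ell2 closed_subspace_ell2 inj_Inr]
  by (auto simp: complex_hilbert_scalars)

lemma decode:
  assumes i: "i \<in> {1..d}" and u: "u \<in> carrier (space i)" and v: "v \<in> carrier (space i)"
  shows "decode i v \<in> ell2"
    "decode i (u \<oplus>\<^bsub>space i\<^esub> v) = (\<lambda>w. decode i u w + decode i v w)"
    "decode i (a \<odot>\<^bsub>space i\<^esub> v) = (\<lambda>w. a * decode i v w)"
    "hnorm ell2_space (decode i v) \<le> (1 + hnorm ell2_space (state_vec d \<one>)) * hnorm (space i) v"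
proof -
  let ?N = "hnorm ell2_space (state_vec d \<one>)"
  have N: "?N \<ge> 0" by (simp add: hnorm_ell2 infsum_nonneg)
  have "decode i v \<in> ell2 \<and>
    decode i (u \<oplus>\<^bsub>space i\<^esub> v) = (\<lambda>w. decode i u w + decode i v w) \<and>
    decode i (a \<odot>\<^bsub>space i\<^esub> v) = (\<lambda>w. a * decode i v w) \<and>
    hnorm ell2_space (decode i v) \<le> (1 + ?N) * hnorm (space i) v"
  proof (cases "i = d")
    case True
    then have sp: "space i = scalars" by (simp add: space_def)
    then obtain a' b where ab: "u = Inl a'" "v = Inl b" using u v by (auto simp: scalars_def)
    have "hnorm ell2_space (decode i v) = cmod b * ?N"
      using complex_hilbert.hnorm_smult[OF complex_hilbert_ell2, of "state_vec d \<one>" b] state_vec_start_ell2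
      by (simp add: True ab decode_def)
    also have "\<dots> \<le> (1 + ?N) * cmod b" by (simp add: distrib_right)
    finally show ?thesis
      using ell2_smult[OF state_vec_start_ell2, of b] True sp
      by (auto simp: decode_def ab hnorm_scalars) (auto simp: scalars_def algebra_simps)
  next
    case False
    then have sp: "space i = transport Inr ell2 ell2_space" using i by (simp add: space_def)
    then obtain f g where fg: "u = Inr f" "v = Inr g" "f \<in> ell2" "g \<in> ell2" using u v by auto
    note t = transport_ops[OF inj_Inr, where H = ell2_space]
    have "hnorm (space i) v \<ge> 0" using complex_hilbert.hnorm_ge[OF complex_hilbert_space v] .
    then have "hnorm (space i) v \<le> (1 + ?N) * hnorm (space i) v" using N by (simp add: distrib_right)
    moreover have "hnorm (space i) v = hnorm ell2_space g" unfolding sp fg by (rule t(4)[OF fg(4)])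
    ultimately show ?thesis
      using False fg t(1)[OF fg(3) fg(4)] t(2)[OF fg(4), of a] by (simp add: decode_def sp)
  qed
  then show "decode i v \<in> ell2"
    "decode i (u \<oplus>\<^bsub>space i\<^esub> v) = (\<lambda>w. decode i u w + decode i v w)"
    "decode i (a \<odot>\<^bsub>space i\<^esub> v) = (\<lambda>w. a * decode i v w)"
    "hnorm ell2_space (decode i v) \<le> (1 + ?N) * hnorm (space i) v" by blast+
qed

lemma encode:
  assumes i: "i < d" and f: "f \<in> ell2" and g: "g \<in> ell2"
  shows "encode i f \<in> carrier (space i)"
    "encode i (\<lambda>w. f w + g w) = encode i f \<oplus>\<^bsub>space i\<^esub> encode i g"
    "encode i (\<lambda>w. a * f w) = a \<odot>\<^bsub>space i\<^esub> encode i f"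
    "hnorm (space i) (encode i f) \<le> hnorm ell2_space f"
proof -
  have "encode i f \<in> carrier (space i) \<and>
    encode i (\<lambda>w. f w + g w) = encode i f \<oplus>\<^bsub>space i\<^esub> encode i g \<and>
    encode i (\<lambda>w. a * f w) = a \<odot>\<^bsub>space i\<^esub> encode i f \<and>
    hnorm (space i) (encode i f) \<le> hnorm ell2_space f"
  proof (cases "i = 0")
    case True
    then have sp: "space i = scalars" by (simp add: space_def)
    have "hnorm (space i) (encode i f) \<le> hnorm ell2_space f"
      unfolding sp using cmod_le_hnorm_ell2[OF f] True by (simp add: encode_def hnorm_scalars)
    moreover have "encode i f \<in> carrier scalars" "encode i (\<lambda>w. f w + g w) = encode i f \<oplus>\<^bsub>scalars\<^esub> encode i g"
      "encode i (\<lambda>w. a * f w) = a \<odot>\<^bsub>scalars\<^esub> encode i f"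
      using True by (simp_all add: encode_def scalars_def)
    ultimately show ?thesis unfolding sp by blast
  next
    case False
    then have sp: "space i = transport Inr ell2 ell2_space" using i by (simp add: space_def)
    note t = transport_ops[OF inj_Inr, where H = ell2_space]
    show ?thesis
      using False f t(1)[OF f g] t(2)[OF f, of a] t(4)[OF f] by (simp add: encode_def sp)
  qed
  then show "encode i f \<in> carrier (space i)"
    "encode i (\<lambda>w. f w + g w) = encode i f \<oplus>\<^bsub>space i\<^esub> encode i g"
    "encode i (\<lambda>w. a * f w) = a \<odot>\<^bsub>space i\<^esub> encode i f"
    "hnorm (space i) (encode i f) \<le> hnorm ell2_space f" by blast+
qed

text \<open>\<open>step_state_vec\<close> telescopes: the factors \<open>i + 1\<close> to
  \<open>d\<close> produce \<open>state_vec i (g i)\<close> for their product \<open>g i\<close>,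
  and at \<open>i = 0\<close> evaluation at the final state is \<open>multiplier\<close> by
  definition.\<close>

lemma factorization_multiplier:
  "multiplier_factorization G d multiplier space (\<lambda>i s v. encode (i - 1) (step i s (decode i v)))"
  (is "multiplier_factorization G d multiplier space ?\<xi>")
proof (rule multiplier_factorizationI)
  show "complex_hilbert (space i)" for i by (rule complex_hilbert_space)
  show "space 0 = scalars" "space d = scalars" by (simp_all add: space_def)
next
  fix i s assume i: "i \<in> {1..d}" and s: "s \<in> carrier G"
  have i': "i - 1 < d" using i by auto
  have st: "step i s (decode i v) \<in> ell2" if "v \<in> carrier (space i)" for v
    using step_bounded(1)[OF i s decode(1)[OF i that that]] .
  show "?\<xi> i s \<in> linear_operators (space i) (space (i - 1))"
    unfolding linear_operators_def
  proof (intro CollectI conjI ballI allI Pi_I)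
    fix u v and a assume u: "u \<in> carrier (space i)"
    show "?\<xi> i s u \<in> carrier (space (i - 1))" by (rule encode(1)[OF i' st[OF u] st[OF u]])
    show "?\<xi> i s (a \<odot>\<^bsub>space i\<^esub> u) = a \<odot>\<^bsub>space (i - 1)\<^esub> ?\<xi> i s u"
      unfolding decode(3)[OF i u u] step_smult by (rule encode(3)[OF i' st[OF u] st[OF u]])
    assume v: "v \<in> carrier (space i)"
    show "?\<xi> i s (u \<oplus>\<^bsub>space i\<^esub> v) = ?\<xi> i s u \<oplus>\<^bsub>space (i - 1)\<^esub> ?\<xi> i s v"
      unfolding decode(2)[OF i u v] step_add by (rule encode(2)[OF i' st[OF u] st[OF v]])
  qed
next
  fix i assume i: "i \<in> {1..d}"
  then have i': "i - 1 < d" by auto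
  let ?N = "1 + hnorm ell2_space (state_vec d \<one>)" and ?K = "real (2 * Suc (Suc d))"
  have "hnorm (space (i - 1)) (?\<xi> i s v) \<le> (?K * ?N) * hnorm (space i) v"
    if s: "s \<in> carrier G" and v: "v \<in> carrier (space i)" for s v
  proof -
    note dv = decode(1)[OF i v v]
    note st = step_bounded[OF i s dv]
    have "hnorm (space (i - 1)) (?\<xi> i s v) \<le> hnorm ell2_space (step i s (decode i v))"
      by (rule encode(4)[OF i' st(1) st(1)])
    also have "\<dots> \<le> ?K * hnorm ell2_space (decode i v)" by (rule st(2))
    also have "\<dots> \<le> ?K * (?N * hnorm (space i) v)" by (intro mult_left_mono decode(4)[OF i v v]) simp
    finally show ?thesis by (simp only: mult.assoc)
  qed
  then show "\<exists>C. \<forall>s\<in>carrier G. \<forall>v\<in>carrier (space i).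
      hnorm (space (i - 1)) (?\<xi> i s v) \<le> C * hnorm (space i) v" by blast
next
  fix t assume t: "t \<in> {1..d} \<rightarrow> carrier G"
  define g where "g i = foldr (\<lambda>j. monoid.mult G (t j)) [Suc i..<Suc d] \<one>" for i
  have upt: "[Suc i..<Suc d] = Suc i # [Suc (Suc i)..<Suc d]" if "i < d" for i
    using that upt_conv_Cons[of "Suc i" "Suc d"] by simp
  have g_step: "g i = t (Suc i) \<otimes> g (Suc i)" if "i < d" for i
    unfolding g_def upt[OF that] by (simp del: upt_Suc)
  have gc: "g i \<in> carrier G" if "i \<le> d" for i
    using that
  proof (induction i rule: inc_induct)
    case (step i)
    then show ?case using t g_step[of i] by auto
  qed (simp add: g_def)
  have "foldr (\<lambda>j. ?\<xi> j (t j)) [Suc i..<Suc d] (Inl 1) =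
      (if i = d then Inl 1 else encode i (state_vec i (g i)))" if "i \<le> d" for i
    using that
  proof (induction i rule: inc_induct)
    case (step i)
    have "decode (Suc i) (if Suc i = d then Inl 1 else encode (Suc i) (state_vec (Suc i) (g (Suc i)))) =
        state_vec (Suc i) (g (Suc i))"
      by (auto simp: decode_def encode_def g_def)
    then have "foldr (\<lambda>j. ?\<xi> j (t j)) [Suc i..<Suc d] (Inl 1) =
        encode i (local.step (Suc i) (t (Suc i)) (state_vec (Suc i) (g (Suc i))))"
      unfolding upt[OF step(2)] using step.IH by (simp del: upt_Suc)
    also have "local.step (Suc i) (t (Suc i)) (state_vec (Suc i) (g (Suc i))) = state_vec i (g i)"
      using step_state_vec[of "Suc i" "t (Suc i)" "g (Suc i)"] funcset_mem[OF t, of "Suc i"]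
        gc[of "Suc i"] step(2) by (simp add: g_step)
    finally show ?case using step by simp
  qed simp
  from this[of 0] show "Inl (multiplier (foldr (\<lambda>i. monoid.mult G (t i)) [1..<Suc d] \<one>)) =
      foldr (\<lambda>i. ?\<xi> i (t i)) [1..<Suc d] (Inl 1)"
    using d gc[of 0] by (simp add: encode_def multiplier_def g_def del: upt_Suc)
qed

section \<open>Membership and non-membership of the multiplier\<close>

lemma cmod_multiplier_le:
  assumes "w \<in> carrier G"
  shows "cmod (multiplier w) \<le> 1"
proof -
  let ?S = "{z. length z = Suc d \<and> val z = w}"
  have S: "finite ?S" "card ?S \<le> 1" by (rule card_le_one_if_unique; use val_inject in auto)+
  let ?f = "\<lambda>z. of_int (crossing z \<one> w) * of_real (wt (block None z) (expo 0 (Suc d))) * amp None z"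
  have "multiplier w = (\<Sum>z\<in>?S. ?f z)" using assms by (simp add: multiplier_def valid_def)
  also have "cmod \<dots> \<le> (\<Sum>z\<in>?S. 1)"
  proof (rule sum_norm_le)
    fix z
    have "cmod (of_int (crossing z \<one> w)) \<le> 1" using abs_crossing_le[of z \<one> w] by simp
    moreover have "cmod (of_real (wt n k)) \<le> 1" for n k using wt_bounds[of n k] by simp
    ultimately show "cmod (?f z) \<le> 1"
      unfolding norm_mult using cmod_amp[of None z] by (intro mult_le_one) auto
  qed
  also have "\<dots> \<le> 1" using S by simp
  finally show ?thesis .
qed

lemma multiplier_mem: "multiplier \<in> multiplier_space d G"
proof (rule multiplier_spaceI[OF is_group _ _ factorization_multiplier])
  show "multiplier \<in> carrier G \<rightarrow>\<^sub>E UNIV" by (auto simp: multiplier_def)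
  show "bdd_above ((\<lambda>t. cmod (multiplier t)) ` carrier G)"
    by (rule bdd_aboveI2[where M = 1]) (rule cmod_multiplier_le)
qed

lemma multiplier_val:
  assumes "length z = Suc d"
  shows "multiplier (val z) = of_real (wt (fst (hd z)) (d - 1)) * amp None z"
proof -
  have "{z'. length z' = Suc d \<and> val z' = val z} = {z}" using val_inject assms by auto
  then show ?thesis by (simp add: multiplier_def valid_def crossing_val expo_def block_def)
qed

lemma val_map: "val (map f xs) = foldr (\<lambda>i. monoid.mult G (x (f i))) xs \<one>"
  by (induction xs) simp_all

lemma amp_map_upt:
  assumes "k \<ge> 1"
  shows "amp None (map f [1..<Suc k]) = (\<Prod>i\<in>{1..<k}. link (Some (label (f i))) (f (Suc i)))"
  using assms
proof (induction k rule: dec_induct)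
  case (step k)
  have "map f [1..<Suc (Suc k)] = map f [1..<Suc k] @ [f (Suc k)]" by simp
  moreover have "src None 1 (map f [1..<Suc k]) = Some (label (f k))"
    using step by (simp add: src_def)
  moreover have "{1..<Suc k} = insert k {1..<k}" using step by auto
  ultimately show ?case using step.IH by (simp add: amp_append mult.commute del: upt_Suc)
qed simp

lemma multiplier_not_mem: "multiplier \<notin> multiplier_space (Suc d) G"
proof
  assume "multiplier \<in> multiplier_space (Suc d) G"
  then obtain H :: "nat \<Rightarrow> (complex + ('g list \<Rightarrow> complex)) hilbert" and \<xi>
    where fact: "multiplier_factorization G (Suc d) multiplier H \<xi>"
    by (auto simp: multiplier_space_def)
  note D = multiplier_factorizationD[OF fact]
  have "\<forall>i\<in>{1..Suc d}. \<exists>C. \<forall>t\<in>carrier G. \<forall>v\<in>carrier (H i).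
      hnorm (H (i - 1)) (\<xi> i t v) \<le> C * hnorm (H i) v" using D(5) by blast
  from bchoice[OF this] obtain C where C: "\<And>i t v. i \<in> {1..Suc d} \<Longrightarrow> t \<in> carrier G \<Longrightarrow>
      v \<in> carrier (H i) \<Longrightarrow> hnorm (H (i - 1)) (\<xi> i t v) \<le> C i * hnorm (H i) v" by blast
  \<comment> \<open>One constant for all positions, independent of the \<open>N\<close> chosen
    below; the contradiction rests on this.\<close>
  define K where "K = (\<Sum>i\<in>{1..Suc d}. \<bar>C i\<bar>)"
  have CK: "C i \<le> K" if "i \<in> {1..Suc d}" for i
    using member_le_sum[of i "{1..Suc d}" "\<lambda>i. \<bar>C i\<bar>"] that by (simp add: K_def)
  have bd: "hnorm (H (i - 1)) (\<xi> i t v) \<le> K * hnorm (H i) v"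
    if "i \<in> {1..Suc d}" "t \<in> carrier G" "v \<in> carrier (H i)" for i t v
  proof -
    have "hnorm (H i) v \<ge> 0" using complex_hilbert.hnorm_ge[OF D(1)] that by auto
    then show ?thesis using C[OF that] mult_right_mono[OF CK[OF that(1)]] by fastforce
  qed
  have "sqrt (real (Suc N)) \<le> K ^ Suc d" for N
  proof -
    have "cmod (of_real (wt N (d - 1))) * sqrt (real (Suc N)) ^ (Suc d - 1) \<le> K ^ Suc d"
    \<comment> \<open>Each of the \<open>Suc d\<close> variables receives a single letter with first
      component \<open>N\<close>; the matrix size is \<open>Suc N\<close>.\<close>
    proof (rule chain_lower_bound[of "Suc d" H "Suc N" "\<lambda>i l r. \<xi> i (x (N, l, r))"])
      fix l r :: "nat \<Rightarrow> nat" assume lr: "\<And>i. l i < Suc N" "\<And>i. r i < Suc N"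
      define f where "f i = (N, l i, r i)" for i
      let ?z = "map f [1..<Suc (Suc d)]"
      have z: "length ?z = Suc d" "fst (hd ?z) = N" by (simp_all add: f_def hd_map del: upt_Suc)
      have "Inl (multiplier (foldr (\<lambda>i. monoid.mult G (x (f i))) [1..<Suc (Suc d)] \<one>)) =
          foldr (\<lambda>i. \<xi> i (x (f i))) [1..<Suc (Suc d)] (Inl 1)"
        by (rule D(6)) simp
      also have "foldr (\<lambda>i. monoid.mult G (x (f i))) [1..<Suc (Suc d)] \<one> = val ?z"
        by (rule val_map[symmetric])
      also have "multiplier (val ?z) = of_real (wt N (d - 1)) * amp None ?z"
        using multiplier_val[OF z(1)] z(2) by simp
      also have "amp None ?z = (\<Prod>i\<in>{1..<Suc d}. link (Some (label (f i))) (f (Suc i)))"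
        by (rule amp_map_upt) simp
      also have "\<dots> = (\<Prod>i\<in>{1..<Suc d}. fourier (Suc N) (r i) (l (Suc i)))"
        using lr by (intro prod.cong refl) (simp add: f_def less_Suc_eq_le)
      finally show "foldr (\<lambda>i. \<xi> i (x (N, l i, r i))) [1..<Suc (Suc d)] (Inl 1) =
          Inl (of_real (wt N (d - 1)) * (\<Prod>i\<in>{1..<Suc d}. fourier (Suc N) (r i) (l (Suc i))))"
        by (simp add: f_def)
    qed (use D(1-4) bd in \<open>auto simp: K_def sum_nonneg\<close>)
    moreover have "cmod (of_real (wt N (d - 1))) * sqrt (real (Suc N)) ^ (Suc d - 1) = sqrt (real (Suc N))"
    proof -
      have "sqrt (real (Suc N)) ^ (Suc d - 1) = sqrt (real (Suc N)) ^ (d - 1) * sqrt (real (Suc N))"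
        using d by (cases d) simp_all
      moreover have "cmod (of_real (wt N (d - 1))) = wt N (d - 1)"
        using wt_bounds(1) by (simp only: norm_of_real abs_of_nonneg)
      moreover have "wt N (d - 1) * sqrt (real (Suc N)) ^ (d - 1) = 1" by (simp add: wt_def)
      ultimately show ?thesis by (simp only: mult.assoc[symmetric] mult_1)
    qed
    ultimately show ?thesis by simp
  qed
  moreover obtain N :: nat where "real N > (K ^ Suc d)\<^sup>2" using reals_Archimedean2 by blast
  then have "K ^ Suc d < sqrt (real (Suc N))" by (intro real_less_rsqrt) simp
  ultimately show False by (meson not_less)
qed

end

theorem proposition1p5:
  fixes G :: "('g, 'm) monoid_scheme" and d :: nat
  assumes "group G"
    and "has_nonabelian_free_subgroup G"
    and "d \<ge> 2"
  shows "multiplier_space (d + 1) G \<subset> multiplier_space d G"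
proof -
  obtain x :: "letter \<Rightarrow> 'g" and A B where "ping_pong G x A B"
    using ping_pong_exists[OF assms(1,2)] by blast
  then interpret link_multiplier G x A B d
    by (intro link_multiplier.intro link_multiplier_axioms.intro assms(3))
  have "multiplier_space (Suc d) G \<subseteq> multiplier_space d G"
    using assms by (intro multiplier_space_Suc_subset) auto
  then show ?thesis using multiplier_mem multiplier_not_mem by auto
qed

end
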